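(* Let $K$ and $\hat K$ be (oriented) virtual knot diagrams. If $K$ is related to $\hat K$ by a finite sequence of diagrammatic moves (Reidemeister moves and virtual Reidemeister moves), then the virtual parity groups $PG_K$ and $PG_{\hat K}$ are isomorphic.
   Context: A virtual knot diagram is an immersion of an oriented circle $S^1$ into the plane whose double points are decorated either as classical crossings (over/under information) or as virtual crossings (circled, no over/under information). The diagrammatic moves are the usual Reidemeister moves I, II, III on classical crossings, the virtual Reidemeister moves I, II, III (the same moves with all crossings virtual), and virtual Reidemeister move IV (an arc with two consecutive virtual crossings is moved past a classical crossing). Parity: label the classical crossings, choose a base point, traverse the knot and record the label of each classical crossing when encountered; each label occurs twice in the resulting cyclic word. A classical crossing is even (respectively odd) if the number of letters between its two occurrences is even (respectively odd). Virtual semi-arcs are the edges of the diagram that begin and end at a (classical or virtual) crossing, with no crossing in the interior; a diagram with $n\ge 1$ crossings in total (classical and virtual) has $2n$ virtual semi-arcs. A diagram without crossings is regarded as having a single semi-arc and no crossing relations. The virtual parity group of a diagram $K$ with $n$ crossings in total is the group $$PG_K=\langle a_1,\dots,a_{2n},s,q,\theta \mid r_{11},r_{12},\dots,r_{n1},r_{n2},[s,q],[s,\theta],[q,\theta]\rangle ,$$ where $a_1,\dots,a_{2n}$ are labels of the virtual semi-arcs, $[a,b]=aba^{-1}b^{-1}$, and the $i$th crossing gives the two relations $r_{i1},r_{i2}$ as follows. Draw the crossing with both strands oriented upward; let $x,y$ be the labels of the incoming bottom-left and bottom-right semi-arcs, and $z,w$ the labels of the outgoing top-left and top-right semi-arcs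 (so one strand runs from $x$ to $w$ and the other from $y$ to $z$). A classical crossing is positive if the over strand is the one from $x$ to $w$, and negative if the over strand is the one from $y$ to $z$. The relations are: - even positive crossing: $z=xysx^{-1}s^{-1}$, $w=sxs^{-1}$; - even negative crossing: $z=s^{-1}ys$, $w=s^{-1}y^{-1}sxy$; - odd crossing of either sign: $z=\theta^{-1}y\theta$, $w=\theta x\theta^{-1}$; - virtual crossing: $z=q^{-1}yq$, $w=qxq^{-1}$. *)

theory Defs
  imports "HOL-Analysis.Analysis" "HOL-Algebra.Group"
begin

section \<open>Groups given by generators and relators\<close>

text \<open>A letter \<open>(g, True)\<close> stands for the generator \<open>g\<close>, and \<open>(g, False)\<close> for its inverse.\<close>

type_synonym 'g gword = "('g \<times> bool) list"

definition gen :: "'g \<Rightarrow> 'g gword" where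
  "gen g = [(g, True)]"

definition winv :: "'g gword \<Rightarrow> 'g gword" where
  "winv u = rev (map (\<lambda>(g, e). (g, \<not> e)) u)"

definition wcomm :: "'g gword \<Rightarrow> 'g gword \<Rightarrow> 'g gword" where
  "wcomm u v = u @ v @ winv u @ winv v"

text \<open>The relator expressing the relation \<open>u = v\<close>.\<close>

definition weq :: "'g gword \<Rightarrow> 'g gword \<Rightarrow> 'g gword" where
  "weq u v = u @ winv v"

definition gwords :: "'g set \<Rightarrow> 'g gword set" where
  "gwords X = lists (X \<times> UNIV)"

definition pres_step :: "'g set \<Rightarrow> 'g gword set \<Rightarrow> 'g gword rel" where
  "pres_step X R =
     {(u @ r @ v, u @ v) | u r v. u \<in> gwords X \<and> v \<in> gwords X \<and>
        (r \<in> R \<or> (\<exists>g\<in>X. \<exists>e. r = [(g, e), (g, \<not> e)]))}"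

definition pres_cong :: "'g set \<Rightarrow> 'g gword set \<Rightarrow> 'g gword rel" where
  "pres_cong X R = (pres_step X R \<union> (pres_step X R)\<inverse>)\<^sup>*"

text \<open>The group \<open>\<langle>X | R\<rangle>\<close>; meaningful for \<open>R \<subseteq> gwords X\<close>.\<close>

definition presented_group :: "'g set \<Rightarrow> 'g gword set \<Rightarrow> 'g gword set monoid" where
  "presented_group X R =
     \<lparr>carrier = gwords X // pres_cong X R,
      mult = (\<lambda>A B. \<Union>u\<in>A. \<Union>v\<in>B. pres_cong X R `` {u @ v}),
      one = pres_cong X R `` {[]}\<rparr>"


section \<open>Virtual knot diagrams\<close>

text \<open>
  The oriented circle is \<open>\<real>/\<int>\<close>, so the immersed curve is a map on the reals of period 1,
  and the plane is \<^typ>\<open>complex\<close>.  The set \<open>virt\<close> consists of the virtual crossings (points of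
  the plane), and \<open>over\<close> of the parameters at which the curve runs along the over strand of a
  classical crossing.
\<close>

record virtual_diagram =
  curve :: "real \<Rightarrow> complex"
  virt :: "complex set"
  over :: "real set"

definition meets :: "virtual_diagram \<Rightarrow> real \<Rightarrow> real \<Rightarrow> bool" where
  "meets K s t \<longleftrightarrow> s - t \<notin> \<int> \<and> curve K s = curve K t"

definition crossing_times :: "virtual_diagram \<Rightarrow> real set" where
  "crossing_times K = {t. \<exists>s. meets K t s}"

definition classical_times :: "virtual_diagram \<Rightarrow> real set" where
  "classical_times K = {t \<in> crossing_times K. curve K t \<notin> virt K}"

definition crossings :: "virtual_diagram \<Rightarrow> complex set" where
  "crossings K = curve K ` crossing_times K"

definition velocity :: "virtual_diagram \<Rightarrow> real \<Rightarrow> complex" where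
  "velocity K t = vector_derivative (curve K) (at t)"

text \<open>
  The determinant of the velocities at \<open>s\<close> and \<open>t\<close>.  It is positive iff, after rotating the
  crossing so that both strands point upward, the strand at \<open>s\<close> runs from bottom left to top
  right and the strand at \<open>t\<close> from bottom right to top left.
\<close>

definition turn :: "virtual_diagram \<Rightarrow> real \<Rightarrow> real \<Rightarrow> real" where
  "turn K s t = Im (cnj (velocity K s) * velocity K t)"

definition is_virtual_knot_diagram :: "virtual_diagram \<Rightarrow> bool" where
  "is_virtual_knot_diagram K \<longleftrightarrow>
     (\<forall>t. curve K (t + 1) = curve K t) \<and>
     curve K C1_differentiable_on UNIV \<and>
     (\<forall>t. velocity K t \<noteq> 0) \<and>
     finite (crossings K) \<and>
     (\<forall>s t u. meets K s t \<and> meets K s u \<longrightarrow> t - u \<in> \<int>) \<and>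
     (\<forall>s t. meets K s t \<longrightarrow> turn K s t \<noteq> 0) \<and>
     virt K \<subseteq> crossings K \<and>
     over K \<subseteq> classical_times K \<and>
     (\<forall>s\<in>classical_times K. \<forall>t. meets K s t \<longrightarrow> (s \<in> over K \<longleftrightarrow> t \<notin> over K))"


section \<open>Semi-arcs, parity and the virtual parity group\<close>

text \<open>
  A semi-arc is a connected component of the circle \<open>\<real>/\<int>\<close> with the crossing times removed,
  represented by its preimage in \<open>\<real>\<close>.  Without crossings, the only semi-arc is the whole circle.
\<close>

definition semi_arc_of :: "virtual_diagram \<Rightarrow> real \<Rightarrow> real set" where
  "semi_arc_of K u = {v. \<exists>k::int. closed_segment u (v + of_int k) \<inter> crossing_times K = {}}"

definition semi_arcs :: "virtual_diagram \<Rightarrow> real set set" where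
  "semi_arcs K = semi_arc_of K ` (- crossing_times K)"

definition arc_ends_at :: "real set \<Rightarrow> real \<Rightarrow> bool" where
  "arc_ends_at A t \<longleftrightarrow> (\<exists>\<epsilon>>0. {t - \<epsilon><..<t} \<subseteq> A)"

definition arc_starts_at :: "real set \<Rightarrow> real \<Rightarrow> bool" where
  "arc_starts_at A t \<longleftrightarrow> (\<exists>\<epsilon>>0. {t<..<t + \<epsilon>} \<subseteq> A)"

text \<open>
  For a classical crossing passed at the times \<open>s\<close> and \<open>t\<close>: the letters of the cyclic word
  between the passage at \<open>s\<close> and the next passage, which is at \<open>s + frac (t - s)\<close>.
\<close>

definition letters_between :: "virtual_diagram \<Rightarrow> real \<Rightarrow> real \<Rightarrow> nat" where
  "letters_between K s t = card ({s<..<s + frac (t - s)} \<inter> classical_times K)"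

datatype crossing_kind = EvenPositive | EvenNegative | OddClassical | Virtual

text \<open>Here \<open>s\<close> is the time on the strand from bottom left to top right.\<close>

definition kind :: "virtual_diagram \<Rightarrow> real \<Rightarrow> real \<Rightarrow> crossing_kind" where
  "kind K s t =
     (if curve K s \<in> virt K then Virtual
      else if odd (letters_between K s t) then OddClassical
      else if s \<in> over K then EvenPositive
      else EvenNegative)"

datatype pg_gen = Arc "real set" | Gen_s | Gen_q | Gen_theta

abbreviation "w_s \<equiv> gen Gen_s"
abbreviation "w_q \<equiv> gen Gen_q"
abbreviation "w_theta \<equiv> gen Gen_theta"

fun crossing_relators ::
    "crossing_kind \<Rightarrow> pg_gen gword \<Rightarrow> pg_gen gword \<Rightarrow> pg_gen gword \<Rightarrow> pg_gen gword \<Rightarrow>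
     pg_gen gword set" where
  "crossing_relators EvenPositive x y z w =
     {weq z (x @ y @ w_s @ winv x @ winv w_s),
      weq w (w_s @ x @ winv w_s)}"
| "crossing_relators EvenNegative x y z w =
     {weq z (winv w_s @ y @ w_s),
      weq w (winv w_s @ winv y @ w_s @ x @ y)}"
| "crossing_relators OddClassical x y z w =
     {weq z (winv w_theta @ y @ w_theta),
      weq w (w_theta @ x @ winv w_theta)}"
| "crossing_relators Virtual x y z w =
     {weq z (winv w_q @ y @ w_q),
      weq w (w_q @ x @ winv w_q)}"

definition pg_generators :: "virtual_diagram \<Rightarrow> pg_gen set" where
  "pg_generators K = Arc ` semi_arcs K \<union> {Gen_s, Gen_q, Gen_theta}"

definition pg_relators :: "virtual_diagram \<Rightarrow> pg_gen gword set" where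
  "pg_relators K =
     \<Union> {crossing_relators (kind K s t) (gen (Arc x)) (gen (Arc y)) (gen (Arc z)) (gen (Arc w)) |
          s t x y z w.
          meets K s t \<and> turn K s t > 0 \<and>
          {x, y, z, w} \<subseteq> semi_arcs K \<and>
          arc_ends_at x s \<and> arc_starts_at w s \<and>
          arc_ends_at y t \<and> arc_starts_at z t} \<union>
     {wcomm w_s w_q, wcomm w_s w_theta, wcomm w_q w_theta}"

definition virtual_parity_group :: "virtual_diagram \<Rightarrow> pg_gen gword set monoid" where
  "virtual_parity_group K = presented_group (pg_generators K) (pg_relators K)"


section \<open>Diagrammatic moves\<close>

text \<open>
  Diagrams are considered up to planar isotopy and reparametrisation of the circle.  An
  orientation preserving diffeomorphism of the plane is isotopic to the identity, so planar
  isotopy amounts to applying such a diffeomorphism.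
\<close>

definition plane_diffeo :: "(complex \<Rightarrow> complex) \<Rightarrow> bool" where
  "plane_diffeo \<phi> \<longleftrightarrow> bij \<phi> \<and>
     (\<exists>\<phi>'. (\<forall>p. (\<phi> has_derivative \<phi>' p) (at p) \<and> Im (cnj (\<phi>' p 1) * \<phi>' p \<i>) > 0) \<and>
           (\<forall>v. continuous_on UNIV (\<lambda>p. \<phi>' p v)))"

definition circle_diffeo :: "(real \<Rightarrow> real) \<Rightarrow> bool" where
  "circle_diffeo h \<longleftrightarrow> (\<forall>t. h (t + 1) = h t + 1) \<and>
     (\<exists>h'. (\<forall>t. (h has_real_derivative h' t) (at t) \<and> h' t > 0) \<and> continuous_on UNIV h')"

definition planar_isotopy :: "virtual_diagram \<Rightarrow> virtual_diagram \<Rightarrow> bool" where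
  "planar_isotopy K L \<longleftrightarrow>
     (\<exists>\<phi> h. plane_diffeo \<phi> \<and> circle_diffeo h \<and>
        curve L = \<phi> \<circ> curve K \<circ> h \<and> virt L = \<phi> ` virt K \<and> over L = h -` over K)"

definition circ :: "real set \<Rightarrow> real set" where
  "circ A = {t + of_int k | t k. t \<in> A}"

text \<open>
  The part of \<open>K\<close> inside the disc \<open>D\<close> consists of the \<open>n\<close> proper arcs given by the parameter
  intervals \<open>{a i..b i}\<close>, \<open>i < n\<close>.
\<close>

definition strands ::
    "complex set \<Rightarrow> nat \<Rightarrow> (nat \<Rightarrow> real) \<Rightarrow> (nat \<Rightarrow> real) \<Rightarrow> virtual_diagram \<Rightarrow> bool" where
  "strands D n a b K \<longleftrightarrow>
     (\<forall>i<n. a i < b i \<and> b i < a i + 1) \<and>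
     (\<forall>i<n. \<forall>j<n. i \<noteq> j \<longrightarrow> circ {a i..b i} \<inter> circ {a j..b j} = {}) \<and>
     curve K -` D = (\<Union>i<n. circ {a i..b i}) \<and>
     curve K -` interior D = (\<Union>i<n. circ {a i<..<b i}) \<and>
     crossings K \<inter> frontier D = {}"

definition local_change ::
    "complex set \<Rightarrow> nat \<Rightarrow> (nat \<Rightarrow> real) \<Rightarrow> (nat \<Rightarrow> real) \<Rightarrow>
     virtual_diagram \<Rightarrow> virtual_diagram \<Rightarrow> bool" where
  "local_change D n a b K L \<longleftrightarrow>
     D homeomorphic cball (0::complex) 1 \<and>
     strands D n a b K \<and> strands D n a b L \<and>
     (\<forall>t. curve K t \<notin> interior D \<longrightarrow> curve L t = curve K t) \<and>
     virt K - D = virt L - D \<and>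
     (\<forall>t. curve K t \<notin> D \<longrightarrow> (t \<in> over K \<longleftrightarrow> t \<in> over L))"

text \<open>
  The moves are described by the crossings of the arcs in \<open>D\<close>.  Up to isotopy of \<open>D\<close> fixing the
  boundary this determines the usual pictures, with all orientations and signs.
  Each move is stated in one direction only; the equivalence relation below adds the inverses.
\<close>

text \<open>An embedded arc acquires a single self-crossing.\<close>

definition move_I :: "virtual_diagram \<Rightarrow> virtual_diagram \<Rightarrow> complex \<Rightarrow> bool" where
  "move_I K L p \<longleftrightarrow>
     (\<exists>D a b. local_change D 1 a b K L \<and> crossings K \<inter> D = {} \<and> crossings L \<inter> D = {p})"

definition reidemeister_I :: "virtual_diagram \<Rightarrow> virtual_diagram \<Rightarrow> bool" where
  "reidemeister_I K L \<longleftrightarrow> (\<exists>p. move_I K L p \<and> p \<notin> virt L)"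

definition virtual_reidemeister_I :: "virtual_diagram \<Rightarrow> virtual_diagram \<Rightarrow> bool" where
  "virtual_reidemeister_I K L \<longleftrightarrow> (\<exists>p. move_I K L p \<and> p \<in> virt L)"

text \<open>
  Two disjoint embedded arcs become embedded arcs that cross each other exactly twice, at the
  times \<open>s, s'\<close> on the first arc and \<open>t, t'\<close> on the second.  That the two crossings have opposite
  directions is automatic, since the end points of the arcs are not linked on the boundary
  of \<open>D\<close>; it is recorded here as part of the picture.
\<close>

definition move_II ::
    "virtual_diagram \<Rightarrow> virtual_diagram \<Rightarrow> real \<Rightarrow> real \<Rightarrow> real \<Rightarrow> real \<Rightarrow> bool" where
  "move_II K L s s' t t' \<longleftrightarrow>
     (\<exists>D a b. local_change D 2 a b K L \<and> crossings K \<inter> D = {} \<and>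
        {s, s'} \<subseteq> {a 0<..<b 0} \<and> {t, t'} \<subseteq> {a 1<..<b 1} \<and> s \<noteq> s' \<and> t \<noteq> t' \<and>
        curve L s = curve L t \<and> curve L s' = curve L t' \<and>
        crossings L \<inter> D = {curve L s, curve L s'} \<and>
        turn L s t * turn L s' t' < 0)"

definition reidemeister_II :: "virtual_diagram \<Rightarrow> virtual_diagram \<Rightarrow> bool" where
  "reidemeister_II K L \<longleftrightarrow>
     (\<exists>s s' t t'. move_II K L s s' t t' \<and> {curve L s, curve L s'} \<inter> virt L = {} \<and>
        (s \<in> over L \<longleftrightarrow> s' \<in> over L))"

definition virtual_reidemeister_II :: "virtual_diagram \<Rightarrow> virtual_diagram \<Rightarrow> bool" where
  "virtual_reidemeister_II K L \<longleftrightarrow>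
     (\<exists>s s' t t'. move_II K L s s' t t' \<and> {curve L s, curve L s'} \<subseteq> virt L)"

text \<open>
  Three embedded arcs, any two of which cross exactly once: \<open>u i j\<close> is the time at which arc \<open>i\<close>
  meets arc \<open>j\<close>.
\<close>

definition three_arcs ::
    "complex set \<Rightarrow> (nat \<Rightarrow> real) \<Rightarrow> (nat \<Rightarrow> real) \<Rightarrow> virtual_diagram \<Rightarrow>
     (nat \<Rightarrow> nat \<Rightarrow> real) \<Rightarrow> bool" where
  "three_arcs D a b K u \<longleftrightarrow>
     (\<forall>i<3. \<forall>j<3. i \<noteq> j \<longrightarrow> u i j \<in> {a i<..<b i} \<and> curve K (u i j) = curve K (u j i)) \<and>
     crossings K \<inter> D = {curve K (u i j) | i j. i < 3 \<and> j < 3 \<and> i \<noteq> j}"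

text \<open>
  The triangle formed by the three arcs has corners \<open>P20, P01, P12\<close>, where \<open>Pij\<close> is the crossing
  of arcs \<open>i\<close> and \<open>j\<close>; its sides \<open>P20 \<rightarrow> P01\<close>, \<open>P01 \<rightarrow> P12\<close>, \<open>P12 \<rightarrow> P20\<close> lie on the arcs 0, 1, 2.
  \<open>side u i j k\<close> tells whether the side on arc \<open>i\<close>, leading from \<open>Pki\<close> to \<open>Pij\<close>, agrees with
  the orientation of that arc.  The condition \<open>triangle\<close> says that going around these sides one
  turns the same way at all three corners, as one does around any triangle; it holds
  automatically for three arcs in a disc that cross pairwise once.
\<close>

definition side :: "(nat \<Rightarrow> nat \<Rightarrow> real) \<Rightarrow> nat \<Rightarrow> nat \<Rightarrow> nat \<Rightarrow> real" where
  "side u i j k = sgn (u i j - u i k)"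

definition triangle :: "virtual_diagram \<Rightarrow> (nat \<Rightarrow> nat \<Rightarrow> real) \<Rightarrow> bool" where
  "triangle K u \<longleftrightarrow>
     (let c01 = side u 0 1 2 * side u 1 2 0 * sgn (turn K (u 0 1) (u 1 0));
          c12 = side u 1 2 0 * side u 2 0 1 * sgn (turn K (u 1 2) (u 2 1));
          c20 = side u 2 0 1 * side u 0 1 2 * sgn (turn K (u 2 0) (u 0 2))
      in c01 = c12 \<and> c12 = c20)"

text \<open>
  One arc is moved across the crossing of the other two: on every arc the order of its two
  crossings is reversed, while the crossings keep their directions and decorations.
  Preservation of the directions is again automatic, the end points being fixed.
\<close>

definition move_III ::
    "virtual_diagram \<Rightarrow> virtual_diagram \<Rightarrow> (nat \<Rightarrow> nat \<Rightarrow> real) \<Rightarrow> bool" where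
  "move_III K L u \<longleftrightarrow>
     (\<exists>D a b u'. local_change D 3 a b K L \<and>
        three_arcs D a b K u \<and> three_arcs D a b L u' \<and> triangle K u \<and> triangle L u' \<and>
        (\<forall>i<3. \<forall>j<3. \<forall>k<3. i \<noteq> j \<and> i \<noteq> k \<and> j \<noteq> k \<longrightarrow> (u i j < u i k \<longleftrightarrow> u' i k < u' i j)) \<and>
        (\<forall>i<3. \<forall>j<3. i \<noteq> j \<longrightarrow>
           sgn (turn K (u i j) (u j i)) = sgn (turn L (u' i j) (u' j i)) \<and>
           (curve K (u i j) \<in> virt K \<longleftrightarrow> curve L (u' i j) \<in> virt L) \<and>
           (u i j \<in> over K \<longleftrightarrow> u' i j \<in> over L)))"

text \<open>
  In the classical move the arcs lie at three different heights, that is, one of the arcs is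
  the over strand at both of its crossings (the cyclic arrangement of heights is excluded).
\<close>

definition reidemeister_III :: "virtual_diagram \<Rightarrow> virtual_diagram \<Rightarrow> bool" where
  "reidemeister_III K L \<longleftrightarrow>
     (\<exists>u. move_III K L u \<and>
        (\<forall>i<3. \<forall>j<3. i \<noteq> j \<longrightarrow> curve K (u i j) \<notin> virt K) \<and>
        (\<exists>i<3. \<forall>j<3. i \<noteq> j \<longrightarrow> u i j \<in> over K))"

definition virtual_reidemeister_III :: "virtual_diagram \<Rightarrow> virtual_diagram \<Rightarrow> bool" where
  "virtual_reidemeister_III K L \<longleftrightarrow>
     (\<exists>u. move_III K L u \<and> (\<forall>i<3. \<forall>j<3. i \<noteq> j \<longrightarrow> curve K (u i j) \<in> virt K))"

definition virtual_reidemeister_IV :: "virtual_diagram \<Rightarrow> virtual_diagram \<Rightarrow> bool" where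
  "virtual_reidemeister_IV K L \<longleftrightarrow>
     (\<exists>u. move_III K L u \<and>
        (\<exists>i<3. \<forall>j<3. \<forall>k<3. j \<noteq> k \<longrightarrow> (curve K (u j k) \<in> virt K \<longleftrightarrow> j = i \<or> k = i)))"

definition diagrammatic_move :: "virtual_diagram \<Rightarrow> virtual_diagram \<Rightarrow> bool" where
  "diagrammatic_move K L \<longleftrightarrow>
     is_virtual_knot_diagram K \<and> is_virtual_knot_diagram L \<and>
     (planar_isotopy K L \<or>
      reidemeister_I K L \<or> reidemeister_II K L \<or> reidemeister_III K L \<or>
      virtual_reidemeister_I K L \<or> virtual_reidemeister_II K L \<or>
      virtual_reidemeister_III K L \<or> virtual_reidemeister_IV K L)"

definition related_by_moves :: "virtual_diagram \<Rightarrow> virtual_diagram \<Rightarrow> bool" where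
  "related_by_moves = equivclp diagrammatic_move"

end

theory Submission
  imports Defs
begin

text \<open>
  A homomorphism from the virtual parity group of \<open>K\<close> to a group \<open>G\<close> is the same as a
  colouring of \<open>K\<close> in \<open>G\<close>: three commuting elements for \<open>s\<close>, \<open>q\<close>, \<open>\<theta>\<close> and an element for
  each semi-arc, subject to the relations of the crossings (\<open>colouring_univ\<close>,
  \<open>colouring_factors\<close>).  By the Yoneda argument, the groups of \<open>K\<close> and \<open>L\<close> are isomorphic
  once, in every group, the colourings of \<open>K\<close> correspond to those of \<open>L\<close>
  (\<open>virtual_parity_groups_isomorphic\<close>).  "Corresponding" means here that the colours agree
  where the diagrams do; homomorphisms preserve this, so the correspondence is natural.

  A planar isotopy carries colourings along the reparametrisation.  Any other move changes the
  diagram inside a disc, where each strand passes at most two crossings.  A colouring is known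
  on the strands as they enter and leave the disc, and it has one more value \<open>m\<^sub>i\<close> on each
  strand, between the two crossings.  Hence a move is harmless if, for all values at the ends
  of the strands, the relations in the disc can be solved for the \<open>m\<^sub>i\<close> before the move iff
  they can be solved after it, and have at most one solution (\<open>local_isomorphism\<close>).  This is a
  computation in a group:
  \<^item> \<open>kink\<close> and \<open>bigon_parallel\<close>, \<open>bigon_antiparallel\<close> settle the first and second moves.
  \<^item> In a third move either one strand crosses both others at virtual crossings, or both at
    odd crossings.  It then only conjugates them by powers of \<open>q\<close> or \<open>\<theta>\<close>, and moving it
    across the third crossing conjugates all four labels there by the same power, which
    commutes with the parameters \<open>s\<close>, \<open>q\<close>, \<open>\<theta>\<close> of the relation (\<open>triple_conj\<close>).
  \<^item> Or all three crossings are even, and the labels behind them are given by explicit words in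
    the labels before them.  The heights of the strands determine an order of computation,
    and the words before and after the move are equal in the free group (\<open>triple_even\<close>).

  Parity is a global notion, so it has to be checked that the crossings outside the disc, and
  the crossings that survive a third move, keep their kinds.  A parity function is a function
  of time that changes between true and false at every passage of a classical crossing.  Since
  the number of passages is even, it has period 1, and a crossing is odd iff the function has the
  same value at its two passages (\<open>odd_letters_between\<close>).  A move changes the number of
  passages on each strand by an even number, so that parity functions, like colourings, agree
  outside the disc (\<open>parity_functions\<close>).  Reversing the order of two classical crossings on
  both strands of a third one does not change its parity (\<open>kinds_same\<close>), and on each of
  three classical strands the parity function takes different values at the two crossings,
  so that the number of odd crossings among the three is even (\<open>classical_good\<close>).
\<close>

section \<open>Presented groups\<close>

definition weval :: "('a, 'b) monoid_scheme \<Rightarrow> ('g \<Rightarrow> 'a) \<Rightarrow> 'g gword \<Rightarrow> 'a" where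
  "weval G f w = foldr (\<lambda>(g, e) y. (if e then f g else inv\<^bsub>G\<^esub> f g) \<otimes>\<^bsub>G\<^esub> y) w \<one>\<^bsub>G\<^esub>"

lemma weval_Nil [simp]: "weval G f [] = \<one>\<^bsub>G\<^esub>"
  by (simp add: weval_def)

lemma weval_Cons [simp]:
  "weval G f ((g, e) # w) = (if e then f g else inv\<^bsub>G\<^esub> f g) \<otimes>\<^bsub>G\<^esub> weval G f w"
  by (simp add: weval_def)

lemma gwords_Nil [simp]: "[] \<in> gwords X"
  by (simp add: gwords_def)

lemma gwords_Cons [simp]: "(g, e) # w \<in> gwords X \<longleftrightarrow> g \<in> X \<and> w \<in> gwords X"
  by (auto simp: gwords_def)

lemma gwords_append [simp]: "u @ v \<in> gwords X \<longleftrightarrow> u \<in> gwords X \<and> v \<in> gwords X"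
  by (auto simp: gwords_def)

lemma gwords_winv [simp]: "winv u \<in> gwords X \<longleftrightarrow> u \<in> gwords X"
  by (induction u) (auto simp: winv_def)

lemma gwords_gen [simp]: "gen g \<in> gwords X \<longleftrightarrow> g \<in> X"
  by (simp add: gen_def)

lemma winv_Cons: "winv ((g, e) # u) = winv u @ [(g, \<not> e)]"
  by (simp add: winv_def)

lemma winv_winv [simp]: "winv (winv u) = u"
  by (simp add: winv_def rev_map comp_def case_prod_beta)

context group
begin

lemma weval_closed [simp]:
  "f \<in> X \<rightarrow> carrier G \<Longrightarrow> w \<in> gwords X \<Longrightarrow> weval G f w \<in> carrier G"
  by (induction w) (auto simp: Pi_iff split: prod.splits)

lemma weval_append:
  "f \<in> X \<rightarrow> carrier G \<Longrightarrow> u \<in> gwords X \<Longrightarrow> v \<in> gwords X \<Longrightarrow>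
    weval G f (u @ v) = weval G f u \<otimes> weval G f v"
proof (induction u)
  case (Cons a u)
  then show ?case
    by (cases a) (auto simp: m_assoc Pi_iff)
qed auto

lemma weval_gen: "f \<in> X \<rightarrow> carrier G \<Longrightarrow> g \<in> X \<Longrightarrow> weval G f (gen g) = f g"
  by (auto simp: gen_def Pi_iff)

lemma weval_winv:
  "f \<in> X \<rightarrow> carrier G \<Longrightarrow> u \<in> gwords X \<Longrightarrow> weval G f (winv u) = inv (weval G f u)"
proof (induction u)
  case (Cons a u)
  then show ?case
    by (cases a) (auto simp: winv_Cons weval_append[of f X] Pi_iff inv_mult_group)
qed (auto simp: winv_def)

lemma weval_weq_iff:
  assumes "f \<in> X \<rightarrow> carrier G" "u \<in> gwords X" "v \<in> gwords X"
  shows "weval G f (weq u v) = \<one> \<longleftrightarrow> weval G f u = weval G f v"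
proof
  assume "weval G f (weq u v) = \<one>"
  then have "weval G f u \<otimes> inv (weval G f v) = \<one>"
    using assms by (simp add: weq_def weval_append[of f X] weval_winv[of f X])
  then show "weval G f u = weval G f v"
    using assms by (metis inv_closed inv_equality inv_inv weval_closed)
next
  assume "weval G f u = weval G f v"
  then show "weval G f (weq u v) = \<one>"
    using assms by (simp add: weq_def weval_append[of f X] weval_winv[of f X])
qed

lemma weval_wcomm_iff:
  assumes "f \<in> X \<rightarrow> carrier G" "u \<in> gwords X" "v \<in> gwords X"
  shows "weval G f (wcomm u v) = \<one> \<longleftrightarrow>
    weval G f u \<otimes> weval G f v = weval G f v \<otimes> weval G f u"
proof -
  have "wcomm u v = weq (u @ v) (v @ u)"
    by (simp add: wcomm_def weq_def winv_def)
  then show ?thesis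
    using assms weval_weq_iff[of f X "u @ v" "v @ u"] by (simp add: weval_append[of f X])
qed

end

lemma pres_stepE:
  assumes "(u, v) \<in> pres_step X R"
  obtains a r b where "u = a @ r @ b" "v = a @ b" "a \<in> gwords X" "b \<in> gwords X"
    "r \<in> R \<or> (\<exists>g\<in>X. \<exists>e. r = [(g, e), (g, \<not> e)])"
  using assms unfolding pres_step_def by blast

lemma pres_stepI:
  assumes "u \<in> gwords X" "v \<in> gwords X" "r \<in> R \<or> (\<exists>g\<in>X. \<exists>e. r = [(g, e), (g, \<not> e)])"
  shows "(u @ r @ v, u @ v) \<in> pres_step X R"
  using assms unfolding pres_step_def by blast

lemma pres_step_append:
  assumes "(u, v) \<in> pres_step X R" "w \<in> gwords X"
  shows "(u @ w, v @ w) \<in> pres_step X R" "(w @ u, w @ v) \<in> pres_step X R"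
proof -
  obtain a r b where uv: "u = a @ r @ b" "v = a @ b" "a \<in> gwords X" "b \<in> gwords X"
      "r \<in> R \<or> (\<exists>g\<in>X. \<exists>e. r = [(g, e), (g, \<not> e)])"
    using assms(1) by (rule pres_stepE)
  have "(a @ r @ (b @ w), a @ (b @ w)) \<in> pres_step X R"
    by (rule pres_stepI) (use uv assms(2) in auto)
  then show "(u @ w, v @ w) \<in> pres_step X R" using uv by simp
  have "((w @ a) @ r @ b, (w @ a) @ b) \<in> pres_step X R"
    by (rule pres_stepI) (use uv assms(2) in auto)
  then show "(w @ u, w @ v) \<in> pres_step X R" using uv by simp
qed

lemma pres_cong_refl [simp]: "(u, u) \<in> pres_cong X R"
  by (simp add: pres_cong_def)

lemma pres_cong_sym: "(u, v) \<in> pres_cong X R \<Longrightarrow> (v, u) \<in> pres_cong X R"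
  unfolding pres_cong_def by (metis converse_Un converse_converse rtrancl_converseD sup_commute)

lemma pres_cong_trans:
  "(u, v) \<in> pres_cong X R \<Longrightarrow> (v, w) \<in> pres_cong X R \<Longrightarrow> (u, w) \<in> pres_cong X R"
  unfolding pres_cong_def by (rule rtrancl_trans)

lemma equiv_pres_cong: "equiv UNIV (pres_cong X R)"
  by (intro equivI reflI symI transI) (simp_all, (erule pres_cong_sym | erule (1) pres_cong_trans)+)

lemma pres_cong_append_right:
  assumes "(u, v) \<in> pres_cong X R" "w \<in> gwords X"
  shows "(u @ w, v @ w) \<in> pres_cong X R"
  using assms(1) unfolding pres_cong_def
proof (induction rule: rtrancl_induct)
  case (step y z)
  then have "(y @ w, z @ w) \<in> pres_step X R \<union> (pres_step X R)\<inverse>"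
    using pres_step_append(1)[of _ _ X R w] assms(2) by auto
  then show ?case using step(3) by (blast intro: rtrancl_into_rtrancl)
qed auto

lemma pres_cong_append_left:
  assumes "(u, v) \<in> pres_cong X R" "w \<in> gwords X"
  shows "(w @ u, w @ v) \<in> pres_cong X R"
  using assms(1) unfolding pres_cong_def
proof (induction rule: rtrancl_induct)
  case (step y z)
  then have "(w @ y, w @ z) \<in> pres_step X R \<union> (pres_step X R)\<inverse>"
    using pres_step_append(2)[of _ _ X R w] assms(2) by auto
  then show ?case using step(3) by (blast intro: rtrancl_into_rtrancl)
qed auto

lemma pres_cong_relator: "r \<in> R \<Longrightarrow> (r, []) \<in> pres_cong X R"
proof -
  assume "r \<in> R"
  then have "([] @ r @ [], [] @ []) \<in> pres_step X R"
    by (intro pres_stepI) auto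
  then show ?thesis unfolding pres_cong_def by auto
qed

lemma pres_cong_cancel: "u \<in> gwords X \<Longrightarrow> (u @ winv u, []) \<in> pres_cong X R"
proof (induction u)
  case Nil
  then show ?case by (simp add: winv_def)
next
  case (Cons a u)
  obtain g e where a: "a = (g, e)" by (cases a)
  have g: "g \<in> X" and u: "u \<in> gwords X" using Cons.prems a by auto
  have "([a] @ (u @ winv u) @ [(g, \<not> e)], [a] @ [] @ [(g, \<not> e)]) \<in> pres_cong X R"
    using Cons.IH[OF u] g a by (intro pres_cong_append_left pres_cong_append_right) auto
  moreover have "([] @ [(g, e), (g, \<not> e)] @ [], [] @ []) \<in> pres_step X R"
    by (rule pres_stepI) (use g in auto)
  then have "([a] @ [] @ [(g, \<not> e)], []) \<in> pres_cong X R"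
    unfolding pres_cong_def a by auto
  ultimately show ?case
    using pres_cong_trans by (fastforce simp: a winv_Cons)
qed

locale presentation =
  fixes X :: "'g set" and R :: "'g gword set"
  assumes relators: "R \<subseteq> gwords X"
begin

definition cls :: "'g gword \<Rightarrow> 'g gword set" where
  "cls u = pres_cong X R `` {u}"

lemma cls_eq_iff: "cls u = cls v \<longleftrightarrow> (u, v) \<in> pres_cong X R"
  unfolding cls_def using equiv_class_eq_iff[OF equiv_pres_cong] by auto

lemma mem_cls: "v \<in> cls u \<longleftrightarrow> (u, v) \<in> pres_cong X R"
  by (simp add: cls_def)

lemma pres_step_gwords: "(u, v) \<in> pres_step X R \<Longrightarrow> u \<in> gwords X \<and> v \<in> gwords X"
  using relators by (auto simp: pres_step_def)

lemma pres_cong_gwords: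
  assumes "(u, v) \<in> pres_cong X R" "u \<in> gwords X" shows "v \<in> gwords X"
  using assms(1) unfolding pres_cong_def
  by (induction rule: rtrancl_induct) (use assms(2) pres_step_gwords in auto)

abbreviation "P \<equiv> presented_group X R"

lemma carrier_P: "carrier P = cls ` gwords X"
  by (auto simp: presented_group_def cls_def quotient_def)

lemma one_P: "\<one>\<^bsub>P\<^esub> = cls []"
  by (simp add: presented_group_def cls_def)

lemma mult_P:
  assumes "u \<in> gwords X" "v \<in> gwords X"
  shows "cls u \<otimes>\<^bsub>P\<^esub> cls v = cls (u @ v)"
proof -
  have "pres_cong X R `` {u' @ v'} = cls (u @ v)" if "u' \<in> cls u" "v' \<in> cls v" for u' v'
  proof -
    have "(u @ v, u' @ v') \<in> pres_cong X R"
      using that assms unfolding mem_cls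
      by (meson pres_cong_append_left pres_cong_append_right pres_cong_gwords pres_cong_trans)
    then show ?thesis using cls_eq_iff cls_def by metis
  qed
  moreover have "u \<in> cls u" "v \<in> cls v" by (simp_all add: mem_cls)
  ultimately show ?thesis
    by (auto simp: presented_group_def)
qed

lemma winv_cancel_left: "u \<in> gwords X \<Longrightarrow> (winv u @ u, []) \<in> pres_cong X R"
  using pres_cong_cancel[of "winv u" X R] by simp

sublocale P: group P
proof (rule groupI)
  fix x y z assume "x \<in> carrier P" "y \<in> carrier P"  "z \<in> carrier P"
  then show "x \<otimes>\<^bsub>P\<^esub> y \<otimes>\<^bsub>P\<^esub> z = x \<otimes>\<^bsub>P\<^esub> (y \<otimes>\<^bsub>P\<^esub> z)"
    by (auto simp: carrier_P mult_P)
next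
  fix x assume "x \<in> carrier P"
  then obtain u where u: "x = cls u" "u \<in> gwords X" by (auto simp: carrier_P)
  then have "cls (winv u) \<otimes>\<^bsub>P\<^esub> x = \<one>\<^bsub>P\<^esub>"
    by (simp add: mult_P one_P cls_eq_iff winv_cancel_left)
  then show "\<exists>y\<in>carrier P. y \<otimes>\<^bsub>P\<^esub> x = \<one>\<^bsub>P\<^esub>"
    using u by (auto simp: carrier_P)
qed (auto simp: carrier_P mult_P one_P)

definition gcls :: "'g \<Rightarrow> 'g gword set" where
  "gcls g = cls (gen g)"

lemma gcls_closed: "gcls \<in> X \<rightarrow> carrier P"
  by (auto simp: gcls_def carrier_P)

lemma weval_gcls: "u \<in> gwords X \<Longrightarrow> weval P gcls u = cls u"
proof (induction u)
  case Nil
  then show ?case by (simp add: one_P)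
next
  case (Cons a u)
  obtain g e where a: "a = (g, e)" by (cases a)
  have g: "g \<in> X" and u: "u \<in> gwords X" using Cons.prems a by auto
  have "inv\<^bsub>P\<^esub> gcls g = cls [(g, False)]"
  proof (rule P.inv_equality)
    show "cls [(g, False)] \<otimes>\<^bsub>P\<^esub> gcls g = \<one>\<^bsub>P\<^esub>"
      using winv_cancel_left[of "gen g"] g
      by (simp add: gcls_def mult_P one_P cls_eq_iff) (simp add: gen_def winv_def)
  qed (use g in \<open>auto simp: carrier_P gcls_def\<close>)
  then show ?case
    using Cons.IH[OF u] a g u by (auto simp: gcls_def gen_def mult_P)
qed

lemma weval_gcls_relator: "r \<in> R \<Longrightarrow> weval P gcls r = \<one>\<^bsub>P\<^esub>"
  using relators pres_cong_relator[of r R X] by (auto simp: weval_gcls[of r] one_P cls_eq_iff subset_iff)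

lemma weval_pres_cong:
  assumes "group G" "f \<in> X \<rightarrow> carrier G" "\<And>r. r \<in> R \<Longrightarrow> weval G f r = \<one>\<^bsub>G\<^esub>"
    and "(u, v) \<in> pres_cong X R"
  shows "weval G f u = weval G f v"
proof -
  interpret group G by fact
  have weval_step: "weval G f u = weval G f v" if st: "(u, v) \<in> pres_step X R" for u v
  proof -
    obtain a r b where uv: "u = a @ r @ b" "v = a @ b" "a \<in> gwords X" "b \<in> gwords X"
        "r \<in> R \<or> (\<exists>g\<in>X. \<exists>e. r = [(g, e), (g, \<not> e)])"
      using st by (rule pres_stepE)
    have "r \<in> gwords X" using uv(5) relators by auto
    moreover from uv(5) have "weval G f r = \<one>\<^bsub>G\<^esub>"
    proof
      assume "\<exists>g\<in>X. \<exists>e. r = [(g, e), (g, \<not> e)]"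
      then obtain g e where "g \<in> X" "r = [(g, e), (g, \<not> e)]" by blast
      moreover have "f g \<in> carrier G" using \<open>g \<in> X\<close> assms(2) by blast
      ultimately show ?thesis by (cases e) auto
    qed (rule assms(3))
    ultimately show ?thesis using uv assms(2) by (simp add: weval_append[of f X])
  qed
  show ?thesis
    using assms(4) unfolding pres_cong_def
  proof (induction rule: rtrancl_induct)
    case (step y z)
    then show ?case using weval_step[of y z] weval_step[of z y] by auto
  qed simp
qed

text \<open>
  Each step of the congruence deletes a subword that evaluates to the unit, so evaluation is
  constant on the classes.
\<close>

theorem universal_property:
  assumes "group G" "f \<in> X \<rightarrow> carrier G" "\<And>r. r \<in> R \<Longrightarrow> weval G f r = \<one>\<^bsub>G\<^esub>"
  obtains F where "F \<in> hom P G" "\<And>g. g \<in> X \<Longrightarrow> F (gcls g) = f g"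
proof
  interpret group G by fact
  define F where "F = (\<lambda>A. weval G f (SOME u. u \<in> A))"
  have F: "F (cls u) = weval G f u" for u
  proof -
    have "(SOME v. v \<in> cls u) \<in> cls u" by (rule someI[of _ u]) (simp add: mem_cls)
    then show ?thesis
      using weval_pres_cong[OF assms] unfolding mem_cls F_def by metis
  qed
  show "F \<in> hom P G"
    using assms(2) by (auto simp: hom_def carrier_P mult_P F weval_append[of f X])
  show "F (gcls g) = f g" if "g \<in> X" for g
    using that assms(2) by (simp add: gcls_def F weval_gen[of f X])
qed

lemma hom_eqI:
  assumes G: "group G" and F: "F \<in> hom P G" and F': "F' \<in> hom P G"
    and eq: "\<And>g. g \<in> X \<Longrightarrow> F (gcls g) = F' (gcls g)" and A: "A \<in> carrier P"
  shows "F A = F' A"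
proof -
  interpret F: group_hom P G F
    using G F by (intro group_hom.intro group_hom_axioms.intro) (auto intro: P.group_axioms)
  interpret F': group_hom P G F'
    using G F' by (intro group_hom.intro group_hom_axioms.intro) (auto intro: P.group_axioms)
  have "F (weval P gcls u) = F' (weval P gcls u)" if "u \<in> gwords X" for u
    using that
  proof (induction u)
    case (Cons a u)
    obtain g e where a: "a = (g, e)" by (cases a)
    have g: "g \<in> X" and u: "u \<in> gwords X" using Cons.prems a by auto
    have "gcls g \<in> carrier P" "weval P gcls u \<in> carrier P"
      using g u gcls_closed P.weval_closed[OF gcls_closed] by auto
    then show ?case
      using Cons.IH[OF u] a eq[OF g] by auto
  qed auto
  then show ?thesis using A by (auto simp: carrier_P weval_gcls)
qed

end

section \<open>Periodic, left-continuous step functions\<close>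

lemma shift_int_eq:
  fixes f :: "real \<Rightarrow> 'v"
  assumes "\<And>t. f (t + 1) = f t"
  shows "f (t + of_int k) = f t"
proof -
  have *: "f (t + of_nat n) = f t" for t n
  proof (induction n)
    case (Suc n)
    then show ?case using assms[of "t + of_nat n"] by (simp add: algebra_simps)
  qed simp
  show ?thesis
    using *[of t "nat k"] *[of "t + of_int k" "nat (-k)"] by (cases "k \<ge> 0") simp_all
qed

text \<open>
  The limit from the right.
\<close>

definition after :: "(real \<Rightarrow> 'v) \<Rightarrow> real \<Rightarrow> 'v" where
  "after c t = (THE v. \<forall>\<^sub>F u in at_right t. c u = v)"

lemma after_eqI:
  assumes "\<forall>\<^sub>F u in at_right t. c u = v"
  shows "after c t = v"
  unfolding after_def
proof (rule the_equality)
  fix w assume "\<forall>\<^sub>F u in at_right t. c u = w"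
  then have "\<forall>\<^sub>F u in at_right t. w = v"
    using assms by eventually_elim auto
  then show "w = v" by (simp add: trivial_limit_at_right_real)
qed (rule assms)

lemma after_cong:
  assumes "\<forall>\<^sub>F u in at_right t. c u = c' u"
  shows "after c t = after c' t"
proof -
  have "(\<forall>\<^sub>F u in at_right t. c u = v) \<longleftrightarrow> (\<forall>\<^sub>F u in at_right t. c' u = v)" for v
    using assms by (intro eventually_subst) (auto elim: eventually_mono)
  then show ?thesis by (simp add: after_def)
qed

text \<open>
  The common form of colourings and parity functions.  The value at a crossing time \<open>t\<close> is
  that of the incoming semi-arc, and \<open>after c t\<close> that of the outgoing one.
\<close>

definition step_function :: "real set \<Rightarrow> (real \<Rightarrow> 'v) \<Rightarrow> bool" where
  "step_function X c \<longleftrightarrow>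
     (\<forall>t. c (t + 1) = c t) \<and>
     (\<forall>t. \<forall>\<^sub>F u in at_left t. c u = c t) \<and>
     (\<forall>t. \<forall>\<^sub>F u in at_right t. c u = after c t) \<and>
     (\<forall>t. t \<notin> X \<longrightarrow> after c t = c t)"

lemma step_functionD:
  assumes "step_function X c"
  shows "c (t + 1) = c t" "c (t + of_int k) = c t"
    "\<forall>\<^sub>F u in at_left t. c u = c t" "\<forall>\<^sub>F u in at_right t. c u = after c t"
    "t \<notin> X \<Longrightarrow> after c t = c t"
  using assms shift_int_eq[of c] by (auto simp: step_function_def)

lemma step_functionI:
  assumes "\<And>t. c (t + 1) = c t"
    and "\<And>t. \<forall>\<^sub>F u in at_left t. c u = c t"
    and "\<And>t. \<exists>v. (\<forall>\<^sub>F u in at_right t. c u = v) \<and> (t \<notin> X \<longrightarrow> v = c t)"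
  shows "step_function X c"
  unfolding step_function_def using assms after_eqI by metis

lemma after_shift:
  assumes "\<And>t. c (t + 1) = c t"
  shows "after c (t + of_int k) = after c t"
proof -
  have "(\<forall>\<^sub>F u in at_right (t + of_int k). c u = v) \<longleftrightarrow> (\<forall>\<^sub>F u in at_right t. c u = v)" for v
  proof -
    have "(\<forall>\<^sub>F u in at_right (t + of_int k). c u = v) \<longleftrightarrow>
        (\<forall>\<^sub>F u in at_right 0. c (u + (t + of_int k)) = v)"
      using eventually_at_right_to_0[of _ "t + of_int k"] by auto
    also have "\<dots> \<longleftrightarrow> (\<forall>\<^sub>F u in at_right 0. c (u + t) = v)"
      using shift_int_eq[of c, OF assms] by (simp add: add.assoc[symmetric])
    also have "\<dots> \<longleftrightarrow> (\<forall>\<^sub>F u in at_right t. c u = v)"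
      using eventually_at_right_to_0[of _ t] by auto
    finally show ?thesis .
  qed
  then show ?thesis by (simp add: after_def)
qed

text \<open>
  A locally constant function on a connected set is constant.  At the right end \<open>q\<close>, which may
  be a jump, only the left neighbourhood lies in the set.
\<close>

lemma step_function_const:
  assumes c: "step_function X c" and "p < q" "X \<inter> {p<..<q} = {}" and u: "u \<in> {p<..q}"
  shows "c u = after c p"
proof -
  let ?A = "{p<..q}"
  have loc: "\<forall>\<^sub>F v in at x within ?A. c x = c v" if x: "x \<in> ?A" for x
  proof -
    have L: "\<forall>\<^sub>F v in at_left x. c x = c v"
      using step_functionD(3)[OF c, of x] by eventually_elim auto
    show ?thesis
    proof (cases "x = q")
      case True
      then show ?thesis
        using L unfolding eventually_at_filter by (auto elim!: eventually_mono)
    next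
      case False
      then have "x \<notin> X" using x assms(3) by auto
      then have "\<forall>\<^sub>F v in at_right x. c x = c v"
        using step_functionD(4)[OF c, of x] step_functionD(5)[OF c] by (auto elim: eventually_mono)
      then have "\<forall>\<^sub>F v in at x. c x = c v" using L by (simp add: eventually_at_split)
      then show ?thesis using filter_leD[OF at_le[of ?A UNIV x]] by auto
    qed
  qed
  have const: "c v = c w" if "v \<in> ?A" "w \<in> ?A" for v w
    by (rule connected_local_const[where A="?A"]) (use that loc in auto)
  have "\<forall>\<^sub>F v in at_right p. c v = after c p \<and> v \<in> {p<..<q}"
    using step_functionD(4)[OF c, of p] eventually_at_right_real[OF \<open>p < q\<close>]
    by eventually_elim auto
  then obtain v where "c v = after c p" "v \<in> {p<..<q}"
    using eventually_happens trivial_limit_at_right_real by blast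
  then show ?thesis using const[of u v] u by auto
qed

lemma step_function_const':
  assumes "step_function X c" "p \<le> q" "X \<inter> {p..<q} = {}" and u: "u \<in> {p..q}"
  shows "c u = c p"
proof (cases "u = p")
  case False
  have "c u = after c p"
  proof (rule step_function_const[OF assms(1)])
    show "X \<inter> {p<..<q} = {}" using assms(3) by force
  qed (use False u in auto)
  also have "\<dots> = c p"
  proof (rule step_functionD(5)[OF assms(1)])
    have "p \<in> {p..<q}" using False u by auto
    then show "p \<notin> X" using assms(3) by blast
  qed
  finally show ?thesis .
qed simp

section \<open>Crossing times\<close>

lemma not_Ints_shift: "(s + of_int k) - (t + of_int l) \<in> \<int> \<longleftrightarrow> s - t \<in> (\<int> :: real set)"
proof -
  have "(s + of_int k) - (t + of_int l) = (s - t) + of_int (k - l)" by simp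
  then show ?thesis
    by (metis Ints_add Ints_diff Ints_of_int add_diff_cancel_right')
qed

lemma meets_sym: "meets K s t \<longleftrightarrow> meets K t s"
  by (metis Ints_minus meets_def minus_diff_eq)

lemma meets_crossing_time: "meets K s t \<Longrightarrow> s \<in> crossing_times K"
  by (auto simp: crossing_times_def)

lemma turn_sym: "turn K t s = - turn K s t"
  by (simp add: turn_def algebra_simps)

locale diagram =
  fixes K :: virtual_diagram
  assumes is_diagram: "is_virtual_knot_diagram K"
begin

abbreviation "X \<equiv> crossing_times K"
abbreviation "C \<equiv> classical_times K"

lemma curve_shift [simp]: "curve K (t + of_int k) = curve K t"
  using is_diagram by (intro shift_int_eq) (simp add: is_virtual_knot_diagram_def)

lemma meets_shift [simp]: "meets K (s + of_int k) (t + of_int l) \<longleftrightarrow> meets K s t"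
  using not_Ints_shift by (simp add: meets_def)

lemma meets_shift_left [simp]: "meets K (s + of_int k) t \<longleftrightarrow> meets K s t"
  using meets_shift[of s k t 0] by simp

lemma meets_shift_right [simp]: "meets K s (t + of_int l) \<longleftrightarrow> meets K s t"
  using meets_shift[of s 0 t l] by simp

lemma meets_unique: "meets K s t \<Longrightarrow> meets K s u \<Longrightarrow> t - u \<in> \<int>"
  using is_diagram by (auto simp: is_virtual_knot_diagram_def)

lemma turn_nonzero: "meets K s t \<Longrightarrow> turn K s t \<noteq> 0"
  using is_diagram by (auto simp: is_virtual_knot_diagram_def)

lemma crossing_times_shift [simp]: "t + of_int k \<in> X \<longleftrightarrow> t \<in> X"
  using meets_shift_left[of t k] by (auto simp: crossing_times_def)

lemma classical_times_shift [simp]: "t + of_int k \<in> C \<longleftrightarrow> t \<in> C"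
  by (simp add: classical_times_def)

lemma classical_meets: "meets K s t \<Longrightarrow> s \<in> C \<longleftrightarrow> t \<in> C"
  using meets_crossing_time[of K s t] meets_crossing_time[of K t s] meets_sym[of K s t]
  by (simp add: classical_times_def meets_def)

lemma classical_meets_iff: "meets K s t \<Longrightarrow> s \<in> C \<longleftrightarrow> curve K s \<notin> virt K"
  using meets_crossing_time by (auto simp: classical_times_def)

lemma over_under: "s \<in> C \<Longrightarrow> meets K s t \<Longrightarrow> s \<in> over K \<longleftrightarrow> t \<notin> over K"
  using is_diagram unfolding is_virtual_knot_diagram_def by blast

lemma over_classical: "over K \<subseteq> C"
  using is_diagram unfolding is_virtual_knot_diagram_def by blast

lemma over_shift [simp]: "t + of_int k \<in> over K \<longleftrightarrow> t \<in> over K"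
proof (cases "t \<in> C")
  case True
  then obtain s where "meets K t s" by (auto simp: classical_times_def crossing_times_def)
  then show ?thesis using over_under[of t s] over_under[of "t + of_int k" s] True by auto
next
  case False
  then show ?thesis using over_classical by auto
qed

lemma curve_derivative: "(curve K has_vector_derivative velocity K t) (at t)"
proof -
  have "curve K C1_differentiable_on UNIV"
    using is_diagram by (simp add: is_virtual_knot_diagram_def)
  then have "curve K differentiable (at t)"
    by (auto simp: C1_differentiable_on_eq)
  then show ?thesis
    by (simp add: velocity_def vector_derivative_works)
qed

lemma velocity_shift [simp]: "velocity K (t + of_int k) = velocity K t"
proof -
  have 1: "(curve K has_vector_derivative velocity K (t + of_int k)) (at (t + of_int k))"
    by (rule curve_derivative)
  have 2: "((\<lambda>u. u + of_int k) has_vector_derivative 1) (at t)"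
    by (auto intro!: derivative_eq_intros simp: has_vector_derivative_def)
  have "((curve K \<circ> (\<lambda>u. u + of_int k)) has_vector_derivative 1 *\<^sub>R velocity K (t + of_int k)) (at t)"
    using vector_diff_chain_at[OF 2 1] by simp
  then have "(curve K has_vector_derivative velocity K (t + of_int k)) (at t)"
    by (simp add: comp_def)
  then show ?thesis using vector_derivative_at velocity_def by metis
qed

lemma turn_shift [simp]: "turn K (s + of_int k) (t + of_int l) = turn K s t"
  by (simp add: turn_def)

text \<open>
  A third passage of the same point would be a second partner of the first one.
\<close>

lemma fibre:
  assumes s: "s \<in> X \<inter> {a..<a + 1}"
  obtains t where "s \<noteq> t" "X \<inter> {a..<a + 1} \<inter> curve K -` {curve K s} = {s, t}" "meets K s t"
proof -
  obtain t0 where t0: "meets K s t0" using s by (auto simp: crossing_times_def)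
  define t where "t = t0 + of_int (- \<lfloor>t0 - a\<rfloor>)"
  have st: "meets K s t" using t0 unfolding t_def by (simp only: meets_shift_right)
  have ta: "t \<in> {a..<a + 1}" unfolding t_def by (simp; linarith)
  have "u = s \<or> u = t" if u: "u \<in> {a..<a + 1}" "curve K u = curve K s" for u
  proof (rule ccontr)
    assume ne: "\<not> (u = s \<or> u = t)"
    have small: "v = w" if vw: "v - w \<in> \<int>" "v \<in> {a..<a + 1}" "w \<in> {a..<a + 1}" for v w :: real
    proof -
      obtain k :: int where "v - w = of_int k" using vw(1) Ints_cases by blast
      then have "\<bar>of_int k :: real\<bar> < 1" using vw(2,3) by auto
      then have "k = 0" by linarith
      then show ?thesis using \<open>v - w = of_int k\<close> by simp
    qed
    then have "meets K s u" using u s ne by (auto simp: meets_def)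
    then have "t - u \<in> \<int>" using st meets_unique by blast
    then show False using small[of t u] ta u ne by auto
  qed
  moreover have t: "s \<noteq> t" "t \<in> X" "curve K t = curve K s"
    using st meets_crossing_time[of K t s] meets_sym[of K s t] by (auto simp: meets_def)
  ultimately have "X \<inter> {a..<a + 1} \<inter> curve K -` {curve K s} = {s, t}"
    using ta s by blast
  then show ?thesis using that[of t] st t by simp
qed

lemma finite_crossing_times_period: "finite (X \<inter> {a..<a + 1})"
proof -
  have "X \<inter> {a..<a + 1} = (\<Union>p\<in>crossings K. X \<inter> {a..<a + 1} \<inter> curve K -` {p})"
    by (auto simp: crossings_def)
  moreover have "finite (X \<inter> {a..<a + 1} \<inter> curve K -` {p})" for p
  proof (cases "X \<inter> {a..<a + 1} \<inter> curve K -` {p} = {}")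
    case False
    then obtain s where "s \<in> X \<inter> {a..<a + 1}" "p = curve K s" by blast
    then show ?thesis using fibre[of s a] finite.insertI finite.emptyI by metis
  qed simp
  moreover have "finite (crossings K)"
    using is_diagram by (simp add: is_virtual_knot_diagram_def)
  ultimately show ?thesis by (metis finite_UN_I)
qed

lemma finite_crossing_times: "finite (X \<inter> {a..b})"
proof -
  have "X \<inter> {a..b} \<subseteq> (\<Union>k\<in>{..nat \<lfloor>b - a\<rfloor>}. X \<inter> {a + real k..<(a + real k) + 1})"
  proof
    fix x assume x: "x \<in> X \<inter> {a..b}"
    then have "nat \<lfloor>x - a\<rfloor> \<le> nat \<lfloor>b - a\<rfloor>" by (intro nat_mono floor_mono) auto
    moreover have "x \<in> {a + real (nat \<lfloor>x - a\<rfloor>)..<(a + real (nat \<lfloor>x - a\<rfloor>)) + 1}"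
      using x by (auto; linarith)
    ultimately show "x \<in> (\<Union>k\<in>{..nat \<lfloor>b - a\<rfloor>}. X \<inter> {a + real k..<(a + real k) + 1})"
      using x by blast
  qed
  then show ?thesis
    by (rule finite_subset) (intro finite_UN_I finite_crossing_times_period, simp)
qed

lemma gap_left: obtains u where "u < t" "{u..<t} \<inter> X = {}"
proof -
  define S where "S = insert (t - 1) (X \<inter> {t - 1..t} - {t})"
  have S: "finite S" "S \<noteq> {}" "\<And>x. x \<in> S \<Longrightarrow> x < t"
    unfolding S_def using finite_crossing_times by auto
  then have "Max S < t" by simp
  define u where "u = (Max S + t) / 2"
  have "x \<notin> X" if "x \<in> {u..<t}" for x
  proof
    assume "x \<in> X"
    moreover have "t - 1 \<le> Max S" using S by (simp add: S_def)
    ultimately have "x \<in> S" using that \<open>Max S < t\<close> unfolding S_def u_def by auto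
    then have "x \<le> Max S" using S by simp
    then show False using that \<open>Max S < t\<close> by (auto simp: u_def)
  qed
  then have "{u..<t} \<inter> X = {}" by blast
  then show ?thesis using that[of u] \<open>Max S < t\<close> unfolding u_def by simp
qed

lemma gap_right: obtains v where "t < v" "{t<..v} \<inter> X = {}"
proof -
  define S where "S = insert (t + 1) (X \<inter> {t..t + 1} - {t})"
  have S: "finite S" "S \<noteq> {}" "\<And>x. x \<in> S \<Longrightarrow> t < x"
    unfolding S_def using finite_crossing_times by auto
  then have "t < Min S" by simp
  define v where "v = (Min S + t) / 2"
  have "x \<notin> X" if "x \<in> {t<..v}" for x
  proof
    assume "x \<in> X"
    moreover have "Min S \<le> t + 1" using S by (simp add: S_def)
    ultimately have "x \<in> S" using that \<open>t < Min S\<close> unfolding S_def v_def by auto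
    then have "Min S \<le> x" using S by simp
    then show False using that \<open>t < Min S\<close> by (auto simp: v_def)
  qed
  then have "{t<..v} \<inter> X = {}" by blast
  then show ?thesis using that[of v] \<open>t < Min S\<close> unfolding v_def by simp
qed

end

section \<open>Colourings\<close>

text \<open>
  The relations of \<open>crossing_relators\<close>, read in a group, with \<open>h\<close> in the place of \<open>\<theta>\<close>.
\<close>

fun crossing_rel :: "('a, 'b) monoid_scheme \<Rightarrow> 'a \<Rightarrow> 'a \<Rightarrow> 'a \<Rightarrow> crossing_kind \<Rightarrow>
    'a \<Rightarrow> 'a \<Rightarrow> 'a \<Rightarrow> 'a \<Rightarrow> bool" where
  "crossing_rel G s q h EvenPositive x y z w \<longleftrightarrow>
     z = x \<otimes>\<^bsub>G\<^esub> y \<otimes>\<^bsub>G\<^esub> s \<otimes>\<^bsub>G\<^esub> inv\<^bsub>G\<^esub> x \<otimes>\<^bsub>G\<^esub> inv\<^bsub>G\<^esub> s \<and> w = s \<otimes>\<^bsub>G\<^esub> x \<otimes>\<^bsub>G\<^esub> inv\<^bsub>G\<^esub> s"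
| "crossing_rel G s q h EvenNegative x y z w \<longleftrightarrow>
     z = inv\<^bsub>G\<^esub> s \<otimes>\<^bsub>G\<^esub> y \<otimes>\<^bsub>G\<^esub> s \<and> w = inv\<^bsub>G\<^esub> s \<otimes>\<^bsub>G\<^esub> inv\<^bsub>G\<^esub> y \<otimes>\<^bsub>G\<^esub> s \<otimes>\<^bsub>G\<^esub> x \<otimes>\<^bsub>G\<^esub> y"
| "crossing_rel G s q h OddClassical x y z w \<longleftrightarrow>
     z = inv\<^bsub>G\<^esub> h \<otimes>\<^bsub>G\<^esub> y \<otimes>\<^bsub>G\<^esub> h \<and> w = h \<otimes>\<^bsub>G\<^esub> x \<otimes>\<^bsub>G\<^esub> inv\<^bsub>G\<^esub> h"
| "crossing_rel G s q h Virtual x y z w \<longleftrightarrow>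
     z = inv\<^bsub>G\<^esub> q \<otimes>\<^bsub>G\<^esub> y \<otimes>\<^bsub>G\<^esub> q \<and> w = q \<otimes>\<^bsub>G\<^esub> x \<otimes>\<^bsub>G\<^esub> inv\<^bsub>G\<^esub> q"

lemma gwords_weq [simp]: "weq u v \<in> gwords X \<longleftrightarrow> u \<in> gwords X \<and> v \<in> gwords X"
  by (simp add: weq_def)

lemma gwords_wcomm [simp]: "wcomm u v \<in> gwords X \<longleftrightarrow> u \<in> gwords X \<and> v \<in> gwords X"
  by (auto simp: wcomm_def)

lemma crossing_relators_iff:
  assumes "group G" and f: "f \<in> X \<rightarrow> carrier G"
    and w: "x \<in> gwords X" "y \<in> gwords X" "z \<in> gwords X" "w \<in> gwords X"
    and g: "Gen_s \<in> X" "Gen_q \<in> X" "Gen_theta \<in> X"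
  shows "(\<forall>r\<in>crossing_relators k x y z w. weval G f r = \<one>\<^bsub>G\<^esub>) \<longleftrightarrow>
    crossing_rel G (f Gen_s) (f Gen_q) (f Gen_theta) k
      (weval G f x) (weval G f y) (weval G f z) (weval G f w)"
proof -
  interpret group G by fact
  have fc: "f Gen_s \<in> carrier G" "f Gen_q \<in> carrier G" "f Gen_theta \<in> carrier G"
    using f g by auto
  show ?thesis
    using w g fc
    by (cases k) (simp_all add: weval_weq_iff[OF f] weval_append[OF f] weval_winv[OF f]
        weval_gen[OF f] weval_closed[OF f] m_assoc)
qed

lemma crossing_relators_gwords:
  assumes "x \<in> gwords X" "y \<in> gwords X" "z \<in> gwords X" "w \<in> gwords X"
    and "Gen_s \<in> X" "Gen_q \<in> X" "Gen_theta \<in> X"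
  shows "crossing_relators k x y z w \<subseteq> gwords X"
  using assms by (cases k) auto

definition commuting :: "('a, 'b) monoid_scheme \<Rightarrow> 'a \<Rightarrow> 'a \<Rightarrow> 'a \<Rightarrow> bool" where
  "commuting G s q h \<longleftrightarrow> s \<in> carrier G \<and> q \<in> carrier G \<and> h \<in> carrier G \<and>
     s \<otimes>\<^bsub>G\<^esub> q = q \<otimes>\<^bsub>G\<^esub> s \<and> s \<otimes>\<^bsub>G\<^esub> h = h \<otimes>\<^bsub>G\<^esub> s \<and> q \<otimes>\<^bsub>G\<^esub> h = h \<otimes>\<^bsub>G\<^esub> q"

definition crossing_ok :: "virtual_diagram \<Rightarrow> ('a, 'b) monoid_scheme \<Rightarrow> 'a \<Rightarrow> 'a \<Rightarrow> 'a \<Rightarrow>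
    (real \<Rightarrow> 'a) \<Rightarrow> real \<Rightarrow> real \<Rightarrow> bool" where
  "crossing_ok K G s q h c a b \<longleftrightarrow>
     (turn K a b > 0 \<longrightarrow>
      crossing_rel G s q h (kind K a b) (c a) (c b) (after c b) (after c a))"

text \<open>
  Colours are assigned to times instead of semi-arcs because the times, unlike the semi-arcs,
  are common to two diagrams that are related by a move.
\<close>

definition colouring :: "virtual_diagram \<Rightarrow> ('a, 'b) monoid_scheme \<Rightarrow> 'a \<Rightarrow> 'a \<Rightarrow> 'a \<Rightarrow>
    (real \<Rightarrow> 'a) \<Rightarrow> bool" where
  "colouring K G s q h c \<longleftrightarrow> commuting G s q h \<and> range c \<subseteq> carrier G \<and>
     step_function (crossing_times K) c \<and>
     (\<forall>a b. meets K a b \<longrightarrow> crossing_ok K G s q h c a b)"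

lemma step_function_comp:
  assumes "step_function X c"
  shows "step_function X (\<lambda>t. F (c t))" "after (\<lambda>t. F (c t)) t = F (after c t)"
proof -
  have ev: "\<forall>\<^sub>F u in at_right t. F (c u) = F (after c t)" for t
    using step_functionD(4)[OF assms, of t] by eventually_elim simp
  show "step_function X (\<lambda>t. F (c t))"
  proof (rule step_functionI)
    show "\<forall>\<^sub>F u in at_left t. F (c u) = F (c t)" for t
      using step_functionD(3)[OF assms, of t] by eventually_elim simp
    show "\<exists>v. (\<forall>\<^sub>F u in at_right t. F (c u) = v) \<and> (t \<notin> X \<longrightarrow> v = F (c t))" for t
      using ev[of t] step_functionD(5)[OF assms, of t] by metis
  qed (use step_functionD(1)[OF assms] in simp)
  show "after (\<lambda>t. F (c t)) t = F (after c t)"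
    by (rule after_eqI) (rule ev)
qed

lemma crossing_rel_hom:
  assumes "group G" "group H" "F \<in> hom G H" and com: "commuting G s q h"
    and "crossing_rel G s q h k x y z w"
    and "x \<in> carrier G" "y \<in> carrier G" "z \<in> carrier G" "w \<in> carrier G"
  shows "crossing_rel H (F s) (F q) (F h) k (F x) (F y) (F z) (F w)"
proof -
  interpret group_hom G H F
    using assms by (auto intro: group_hom.intro group_hom_axioms.intro)
  show ?thesis
    using assms(4-) by (cases k) (simp_all add: commuting_def)
qed


lemma colouring_hom:
  assumes "group G" "group H" "F \<in> hom G H" and col: "colouring K G s q h c"
  shows "colouring K H (F s) (F q) (F h) (\<lambda>t. F (c t))"
proof -
  interpret group_hom G H F
    using assms by (auto intro: group_hom.intro group_hom_axioms.intro)
  have step: "step_function (crossing_times K) c" and car: "range c \<subseteq> carrier G"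
    and com: "commuting G s q h"
    using col by (auto simp: colouring_def)
  have in_c: "c t \<in> carrier G" for t using car by auto
  have in_a: "after c t \<in> carrier G" for t
  proof -
    have "\<exists>u. c u = after c t"
      using eventually_happens[OF step_functionD(4)[OF step, of t]] trivial_limit_at_right_real
      by blast
    then show ?thesis using in_c by metis
  qed
  note rel = crossing_rel_hom[OF assms(1-3) com]
  have comH: "commuting H (F s) (F q) (F h)"
    using com by (simp add: commuting_def flip: hom_mult)
  show ?thesis
    using col rel in_c in_a comH unfolding colouring_def crossing_ok_def
    by (simp add: step_function_comp[OF step] image_subset_iff)
qed

section \<open>The universal colouring\<close>

lemma pg_relatorsE:
  assumes "r \<in> pg_relators K"
  obtains "r \<in> {wcomm w_s w_q, wcomm w_s w_theta, wcomm w_q w_theta}"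
  | a b x y z w where
      "r \<in> crossing_relators (kind K a b) (gen (Arc x)) (gen (Arc y)) (gen (Arc z)) (gen (Arc w))"
      "meets K a b" "turn K a b > 0" "{x, y, z, w} \<subseteq> semi_arcs K"
      "arc_ends_at x a" "arc_starts_at w a" "arc_ends_at y b" "arc_starts_at z b"
  using assms unfolding pg_relators_def
  by (elim UnE UnionE CollectE exE conjE) simp_all

lemma arc_ends_atD:
  assumes "arc_ends_at A t" shows "\<forall>\<^sub>F u in at_left t. u \<in> A"
  using assms unfolding arc_ends_at_def eventually_at_left_field
  by (metis greaterThanLessThan_iff less_add_same_cancel1 less_diff_eq add.commute subsetD
      diff_less_eq)

lemma arc_starts_atD:
  assumes "arc_starts_at A t" shows "\<forall>\<^sub>F u in at_right t. u \<in> A"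
  using assms unfolding arc_starts_at_def eventually_at_right_field
  by (metis greaterThanLessThan_iff less_add_same_cancel1 subsetD)

context diagram
begin

lemma semi_arc_of_eq:
  assumes "closed_segment u v \<inter> X = {}"
  shows "semi_arc_of K u = semi_arc_of K v"
proof -
  have *: "semi_arc_of K u \<subseteq> semi_arc_of K v" if uv: "closed_segment u v \<inter> X = {}" for u v :: real
  proof
    fix w assume "w \<in> semi_arc_of K u"
    then obtain k :: int where "closed_segment u (w + of_int k) \<inter> X = {}"
      by (auto simp: semi_arc_of_def)
    moreover have "closed_segment v (w + of_int k) \<subseteq>
        closed_segment u v \<union> closed_segment u (w + of_int k)"
      by (auto simp: closed_segment_eq_real_ivl split: if_splits)
    ultimately have "closed_segment v (w + of_int k) \<inter> X = {}" using uv by blast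
    then show "w \<in> semi_arc_of K v" by (auto simp: semi_arc_of_def)
  qed
  show ?thesis
    using *[OF assms] *[of v u] assms by (simp add: closed_segment_commute subset_antisym)
qed

lemma semi_arc_of_shift [simp]: "semi_arc_of K (u + of_int m) = semi_arc_of K u"
proof -
  have seg: "closed_segment (u + of_int m) (w + of_int m) \<inter> X = {} \<longleftrightarrow>
      closed_segment u w \<inter> X = {}" for u w m
  proof -
    have "closed_segment (u + of_int m) (w + of_int m) = (\<lambda>x. x + of_int m) ` closed_segment u w"
      using closed_segment_translation[of "of_int m" u w] by (simp add: add.commute)
    then show ?thesis by (auto simp: image_iff disjoint_iff)
  qed
  have "(\<exists>k::int. closed_segment (u + of_int m) (v + of_int k) \<inter> X = {}) \<longleftrightarrow>
      (\<exists>k::int. closed_segment u (v + of_int k) \<inter> X = {})" for v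
  proof -
    have "closed_segment (u + of_int m) (v + of_int k) \<inter> X = {} \<longleftrightarrow>
        closed_segment u (v + of_int (k - m)) \<inter> X = {}" for k
      using seg[of u m "v + of_int (k - m)"] by simp
    then show ?thesis by (metis add_diff_cancel_right')
  qed
  then show ?thesis by (auto simp: semi_arc_of_def)
qed

text \<open>
  The semi-arc that ends at a crossing time \<open>t\<close>, or contains the time \<open>t\<close> otherwise.
\<close>

definition arc_before :: "real \<Rightarrow> real set" where
  "arc_before t = semi_arc_of K (SOME u. u < t \<and> {u..<t} \<inter> X = {})"

lemma arc_before_eq:
  assumes "u < t" "{u..<t} \<inter> X = {}"
  shows "arc_before t = semi_arc_of K u"
proof -
  define u' where "u' = (SOME u. u < t \<and> {u..<t} \<inter> X = {})"
  have u': "u' < t" "{u'..<t} \<inter> X = {}"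
    using someI[of "\<lambda>u. u < t \<and> {u..<t} \<inter> X = {}" u] assms unfolding u'_def by auto
  have "closed_segment u' u \<subseteq> {u..<t} \<union> {u'..<t}"
    using u'(1) assms(1) by (auto simp: closed_segment_eq_real_ivl)
  then have "closed_segment u' u \<inter> X = {}" using u'(2) assms(2) by blast
  then show ?thesis
    unfolding arc_before_def u'_def[symmetric] by (rule semi_arc_of_eq)
qed

lemma arc_before_noncrossing:
  assumes "t \<notin> X" shows "arc_before t = semi_arc_of K t"
proof -
  obtain u where u: "u < t" "{u..<t} \<inter> X = {}" by (rule gap_left)
  have "closed_segment u t = insert t {u..<t}" using u(1) by (auto simp: closed_segment_eq_real_ivl)
  then show ?thesis using arc_before_eq[OF u] semi_arc_of_eq[of u t] u assms by auto
qed

lemma arc_before_shift: "arc_before (t + 1) = arc_before t"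
proof -
  obtain u where u: "u < t" "{u..<t} \<inter> X = {}" by (rule gap_left)
  have "x \<notin> X" if "x \<in> {u + 1..<t + 1}" for x
  proof -
    have "x - 1 \<in> {u..<t}" using that by auto
    then show ?thesis using u(2) crossing_times_shift[of "x - 1" 1] by auto
  qed
  then have "{u + 1..<t + 1} \<inter> X = {}" by blast
  then show ?thesis
    using arc_before_eq[OF u] arc_before_eq[of "u + 1" "t + 1"] u(1) semi_arc_of_shift[of u 1]
    by simp
qed

lemma step_function_arc_before:
  "step_function X arc_before"
  "t < v \<Longrightarrow> {t<..v} \<inter> X = {} \<Longrightarrow> after arc_before t = semi_arc_of K v"
proof -
  have L: "\<forall>\<^sub>F u in at_left t. arc_before u = arc_before t" for t
  proof -
    obtain u where u: "u < t" "{u..<t} \<inter> X = {}" by (rule gap_left)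
    have "arc_before v = arc_before t" if v: "v \<in> {u<..<t}" for v
    proof -
      have "{u..<v} \<inter> X = {}" using u v by force
      then show ?thesis using arc_before_eq[OF u] arc_before_eq[of u v] v by simp
    qed
    then show ?thesis
      using eventually_at_left_real[OF u(1)] by (auto elim: eventually_mono)
  qed
  have R: "\<forall>\<^sub>F u in at_right t. arc_before u = semi_arc_of K v"
    if v: "t < v" "{t<..v} \<inter> X = {}" for t v
  proof -
    have "arc_before u = semi_arc_of K v" if u: "u \<in> {t<..<v}" for u
    proof -
      have "u \<notin> X" using u v by force
      moreover have "closed_segment u v \<inter> X = {}"
        using u v by (auto simp: closed_segment_eq_real_ivl disjoint_iff)
      ultimately show ?thesis using arc_before_noncrossing semi_arc_of_eq by metis
    qed
    then show ?thesis
      using eventually_at_right_real[OF v(1)] by (auto elim: eventually_mono)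
  qed
  show "step_function X arc_before"
  proof (rule step_functionI)
    fix t
    obtain v where v: "t < v" "{t<..v} \<inter> X = {}" by (rule gap_right)
    have "semi_arc_of K v = arc_before t" if "t \<notin> X"
    proof -
      have "closed_segment t v = insert t {t<..v}"
        using v(1) by (auto simp: closed_segment_eq_real_ivl)
      then show ?thesis
        using arc_before_noncrossing[OF that] semi_arc_of_eq[of t v] v that by auto
    qed
    then show "\<exists>A. (\<forall>\<^sub>F u in at_right t. arc_before u = A) \<and> (t \<notin> X \<longrightarrow> A = arc_before t)"
      using R[OF v] by metis
  qed (use L arc_before_shift in auto)
  show "t < v \<Longrightarrow> {t<..v} \<inter> X = {} \<Longrightarrow> after arc_before t = semi_arc_of K v"
    by (rule after_eqI) (rule R)
qed

lemma arc_before_semi_arc: "arc_before t \<in> semi_arcs K"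
proof -
  obtain u where u: "u < t" "{u..<t} \<inter> X = {}" by (rule gap_left)
  then have "u \<notin> X" by force
  then show ?thesis using arc_before_eq[OF u] by (auto simp: semi_arcs_def)
qed

lemma after_arc_before_semi_arc: "after arc_before t \<in> semi_arcs K"
proof -
  obtain v where v: "t < v" "{t<..v} \<inter> X = {}" by (rule gap_right)
  then have "v \<notin> X" by force
  then show ?thesis using step_function_arc_before(2)[OF v] by (auto simp: semi_arcs_def)
qed

lemma arc_before_ends: "arc_ends_at (arc_before t) t"
proof -
  obtain u where u: "u < t" "{u..<t} \<inter> X = {}" by (rule gap_left)
  have "v \<in> semi_arc_of K u" if v: "u < v" "v < t" for v
  proof -
    have "closed_segment u (v + of_int 0) \<inter> X = {}"
      using u v by (auto simp: closed_segment_eq_real_ivl disjoint_iff)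
    then show ?thesis unfolding semi_arc_of_def by blast
  qed
  then show ?thesis
    using u(1) arc_before_eq[OF u] by (auto simp: arc_ends_at_def intro!: exI[of _ "t - u"])
qed

lemma after_arc_before_starts: "arc_starts_at (after arc_before t) t"
proof -
  obtain u where u: "t < u" "{t<..u} \<inter> X = {}" by (rule gap_right)
  have "v \<in> semi_arc_of K u" if v: "t < v" "v < u" for v
  proof -
    have "closed_segment u (v + of_int 0) \<inter> X = {}"
      using u v by (auto simp: closed_segment_eq_real_ivl disjoint_iff)
    then show ?thesis unfolding semi_arc_of_def by blast
  qed
  then show ?thesis
    using u(1) step_function_arc_before(2)[OF u]
    by (auto simp: arc_starts_at_def intro!: exI[of _ "u - t"])
qed

lemma step_function_const_on_semi_arc:
  assumes c: "step_function X c" and v: "v \<in> semi_arc_of K u"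
  shows "c v = c u"
proof -
  obtain k :: int where k: "closed_segment u (v + of_int k) \<inter> X = {}"
    using v by (auto simp: semi_arc_of_def)
  have "c (v + of_int k) = c u"
  proof (cases "u \<le> v + of_int k")
    case True
    then have "X \<inter> {u..<v + of_int k} = {}"
      using k by (auto simp: closed_segment_eq_real_ivl disjoint_iff)
    then show ?thesis using step_function_const'[OF c True, of "v + of_int k"] True by simp
  next
    case False
    then have "X \<inter> {v + of_int k..<u} = {}"
      using k by (auto simp: closed_segment_eq_real_ivl disjoint_iff)
    then show ?thesis using step_function_const'[OF c, of "v + of_int k" u u] False by simp
  qed
  then show ?thesis using step_functionD(2)[OF c] by simp
qed

lemma pg_relators_gwords: "pg_relators K \<subseteq> gwords (pg_generators K)"
proof -
  have "crossing_relators k (gen (Arc x)) (gen (Arc y)) (gen (Arc z)) (gen (Arc w))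
      \<subseteq> gwords (pg_generators K)" if "{x, y, z, w} \<subseteq> semi_arcs K" for k x y z w
    using that by (intro crossing_relators_gwords) (auto simp: pg_generators_def)
  then show ?thesis
    unfolding pg_relators_def by (fastforce simp: pg_generators_def)
qed

sublocale PG: presentation "pg_generators K" "pg_relators K"
  by unfold_locales (rule pg_relators_gwords)

lemma group_virtual_parity_group: "group (virtual_parity_group K)"
  unfolding virtual_parity_group_def by (rule PG.P.group_axioms)

text \<open>
  The colouring by the generators themselves.
\<close>

definition univ :: "real \<Rightarrow> pg_gen gword set" where
  "univ t = PG.gcls (Arc (arc_before t))"

lemma Gen_generators: "Gen_s \<in> pg_generators K" "Gen_q \<in> pg_generators K" "Gen_theta \<in> pg_generators K"
  by (auto simp: pg_generators_def)

lemma weval_wcomm_gens: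
  assumes "group G" "f \<in> pg_generators K \<rightarrow> carrier G"
  shows "(\<forall>r\<in>{wcomm w_s w_q, wcomm w_s w_theta, wcomm w_q w_theta}. weval G f r = \<one>\<^bsub>G\<^esub>) \<longleftrightarrow>
    commuting G (f Gen_s) (f Gen_q) (f Gen_theta)"
proof -
  interpret G: group G by fact
  have "f Gen_s \<in> carrier G" "f Gen_q \<in> carrier G" "f Gen_theta \<in> carrier G"
    using assms(2) Gen_generators by auto
  then show ?thesis
    using Gen_generators
    by (simp add: G.weval_wcomm_iff[OF assms(2)] G.weval_gen[OF assms(2)] commuting_def)
qed

lemma colouring_univ:
  "colouring K (virtual_parity_group K) (PG.gcls Gen_s) (PG.gcls Gen_q) (PG.gcls Gen_theta) univ"
  unfolding colouring_def virtual_parity_group_def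
proof (intro conjI allI impI)
  show "commuting PG.P (PG.gcls Gen_s) (PG.gcls Gen_q) (PG.gcls Gen_theta)"
  proof (subst weval_wcomm_gens[OF PG.P.group_axioms PG.gcls_closed, symmetric], rule ballI)
    fix r assume "r \<in> {wcomm w_s w_q, wcomm w_s w_theta, wcomm w_q w_theta}"
    then have "r \<in> pg_relators K" unfolding pg_relators_def by blast
    then show "weval PG.P PG.gcls r = \<one>\<^bsub>PG.P\<^esub>" by (rule PG.weval_gcls_relator)
  qed
  show "range univ \<subseteq> carrier PG.P"
    using PG.gcls_closed arc_before_semi_arc by (auto simp: univ_def pg_generators_def)
  show "step_function X univ"
    unfolding univ_def using step_function_comp(1)[OF step_function_arc_before(1)] .
  have after_univ: "after univ t = PG.gcls (Arc (after arc_before t))" for t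
    unfolding univ_def using step_function_comp(2)[OF step_function_arc_before(1)] .
  fix a b assume ab: "meets K a b"
  show "crossing_ok K PG.P (PG.gcls Gen_s) (PG.gcls Gen_q) (PG.gcls Gen_theta) univ a b"
    unfolding crossing_ok_def
  proof
    assume pos: "turn K a b > 0"
    let ?x = "arc_before a" and ?y = "arc_before b"
      and ?z = "after arc_before b" and ?w = "after arc_before a"
    have sub: "crossing_relators (kind K a b) (gen (Arc ?x)) (gen (Arc ?y)) (gen (Arc ?z)) (gen (Arc ?w))
        \<subseteq> pg_relators K"
      unfolding pg_relators_def
      using ab pos arc_before_semi_arc after_arc_before_semi_arc arc_before_ends
        after_arc_before_starts
      by (intro le_supI1 Union_upper CollectI exI[of _ a] exI[of _ b] exI[of _ ?x] exI[of _ ?y]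
          exI[of _ ?z] exI[of _ ?w]) simp
    have arcs: "Arc ?x \<in> pg_generators K" "Arc ?y \<in> pg_generators K" "Arc ?z \<in> pg_generators K"
        "Arc ?w \<in> pg_generators K"
      using arc_before_semi_arc after_arc_before_semi_arc by (auto simp: pg_generators_def)
    have "\<forall>r\<in>crossing_relators (kind K a b) (gen (Arc ?x)) (gen (Arc ?y)) (gen (Arc ?z)) (gen (Arc ?w)).
        weval PG.P PG.gcls r = \<one>\<^bsub>PG.P\<^esub>"
      using sub PG.weval_gcls_relator by blast
    then show "crossing_rel PG.P (PG.gcls Gen_s) (PG.gcls Gen_q) (PG.gcls Gen_theta) (kind K a b)
        (univ a) (univ b) (after univ b) (after univ a)"
      using arcs Gen_generators
      by (simp add: crossing_relators_iff[OF PG.P.group_axioms PG.gcls_closed]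
          PG.P.weval_gen[OF PG.gcls_closed] after_univ) (simp add: univ_def)
  qed
qed

text \<open>
  A colouring is constant on each semi-arc, and the semi-arcs named in a relator are those next
  to the two passages of the crossing.  So the colours of the semi-arcs are images of the
  generators that satisfy the relations.
\<close>

lemma colouring_factors:
  assumes G: "group G" and col: "colouring K G s q h c"
  obtains F where "F \<in> hom (virtual_parity_group K) G" "F (PG.gcls Gen_s) = s"
    "F (PG.gcls Gen_q) = q" "F (PG.gcls Gen_theta) = h" "\<And>t. F (univ t) = c t"
proof -
  interpret G: group G by fact
  have step: "step_function X c" and car: "\<And>t. c t \<in> carrier G" and com: "commuting G s q h"
    using col by (auto simp: colouring_def)
  define f where "f = (\<lambda>g. case g of Arc A \<Rightarrow> c (SOME u. u \<notin> X \<and> A = semi_arc_of K u)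
    | Gen_s \<Rightarrow> s | Gen_q \<Rightarrow> q | Gen_theta \<Rightarrow> h)"
  have fgen [simp]: "f Gen_s = s" "f Gen_q = q" "f Gen_theta = h" by (auto simp: f_def)
  have f_mem: "f (Arc A) = c v" if A: "A \<in> semi_arcs K" and v: "v \<in> A" for A v
  proof -
    obtain u where "u \<notin> X \<and> A = semi_arc_of K u" using A by (auto simp: semi_arcs_def)
    then have "(SOME u. u \<notin> X \<and> A = semi_arc_of K u) \<notin> X \<and>
        A = semi_arc_of K (SOME u. u \<notin> X \<and> A = semi_arc_of K u)"
      by (rule someI)
    then show ?thesis
      using step_function_const_on_semi_arc[OF step] v unfolding f_def by auto metis
  qed
  have f_end: "f (Arc A) = c t" if A: "A \<in> semi_arcs K" "arc_ends_at A t" for A t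
  proof -
    have "\<forall>\<^sub>F u in at_left t. u \<in> A \<and> c u = c t"
      using arc_ends_atD[OF A(2)] step_functionD(3)[OF step, of t] by eventually_elim simp
    then obtain u where "u \<in> A \<and> c u = c t"
      using eventually_happens'[OF trivial_limit_at_left_real] by blast
    then show ?thesis using f_mem[OF A(1), of u] by simp
  qed
  have f_start: "f (Arc A) = after c t" if A: "A \<in> semi_arcs K" "arc_starts_at A t" for A t
  proof -
    have "\<forall>\<^sub>F u in at_right t. u \<in> A \<and> c u = after c t"
      using arc_starts_atD[OF A(2)] step_functionD(4)[OF step, of t] by eventually_elim simp
    then obtain u where "u \<in> A \<and> c u = after c t"
      using eventually_happens'[OF trivial_limit_at_right_real] by blast
    then show ?thesis using f_mem[OF A(1), of u] by simp
  qed
  have f: "f \<in> pg_generators K \<rightarrow> carrier G"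
    using car com by (auto simp: pg_generators_def f_def commuting_def split: pg_gen.splits)
  have rel: "weval G f r = \<one>\<^bsub>G\<^esub>" if r: "r \<in> pg_relators K" for r
    using r
  proof (cases rule: pg_relatorsE)
    case 1
    then show ?thesis using weval_wcomm_gens[OF G f] com by auto
  next
    case (2 a b x y z w)
    note rr = 2(1) and ab = 2(2,3) and arcs = 2(4) and ends = 2(5-8)
    have eq: "f (Arc x) = c a" "f (Arc y) = c b" "f (Arc z) = after c b" "f (Arc w) = after c a"
      using f_end f_start arcs ends by auto
    have gens: "Arc x \<in> pg_generators K" "Arc y \<in> pg_generators K" "Arc z \<in> pg_generators K"
        "Arc w \<in> pg_generators K"
      using arcs by (auto simp: pg_generators_def)
    have "crossing_rel G s q h (kind K a b) (c a) (c b) (after c b) (after c a)"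
      using col ab by (auto simp: colouring_def crossing_ok_def)
    then have "\<forall>r\<in>crossing_relators (kind K a b) (gen (Arc x)) (gen (Arc y)) (gen (Arc z)) (gen (Arc w)).
        weval G f r = \<one>\<^bsub>G\<^esub>"
      using gens Gen_generators
      by (simp add: crossing_relators_iff[OF G f] G.weval_gen[OF f] eq)
    then show ?thesis using rr by blast
  qed
  obtain F where F: "F \<in> hom PG.P G" "\<And>g. g \<in> pg_generators K \<Longrightarrow> F (PG.gcls g) = f g"
    using PG.universal_property[OF G f rel] by metis
  show ?thesis
  proof
    show "F \<in> hom (virtual_parity_group K) G"
      using F(1) by (simp add: virtual_parity_group_def)
    show "F (univ t) = c t" for t
      using F(2)[of "Arc (arc_before t)"] arc_before_semi_arc[of t]
        f_end[OF arc_before_semi_arc arc_before_ends]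
      by (auto simp: univ_def pg_generators_def)
  qed (use F(2) Gen_generators in auto)
qed

lemma hom_eq_on_univ:
  assumes G: "group G" and F: "F \<in> hom (virtual_parity_group K) G"
    and F': "F' \<in> hom (virtual_parity_group K) G"
    and "F (PG.gcls Gen_s) = F' (PG.gcls Gen_s)" "F (PG.gcls Gen_q) = F' (PG.gcls Gen_q)"
    and "F (PG.gcls Gen_theta) = F' (PG.gcls Gen_theta)" and "\<And>t. F (univ t) = F' (univ t)"
    and A: "A \<in> carrier (virtual_parity_group K)"
  shows "F A = F' A"
proof (rule PG.hom_eqI[OF G])
  fix g assume "g \<in> pg_generators K"
  then consider u where "u \<notin> X" "g = Arc (semi_arc_of K u)" | "g \<in> {Gen_s, Gen_q, Gen_theta}"
    by (auto simp: pg_generators_def semi_arcs_def)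
  then show "F (PG.gcls g) = F' (PG.gcls g)"
  proof cases
    case (1 u)
    then have "PG.gcls g = univ u" by (simp add: univ_def arc_before_noncrossing)
    then show ?thesis using assms by simp
  qed (use assms in auto)
qed (use F F' A in \<open>simp_all add: virtual_parity_group_def\<close>)

end

section \<open>Isomorphisms from corresponding colourings\<close>

type_synonym pg_group = "pg_gen gword set monoid"

text \<open>
  The extension of the universal colouring of one diagram to the other diagram gives a
  homomorphism, in both directions.  Either composite maps a universal colouring to a colouring
  that agrees with it on \<open>E\<close>, hence everywhere; so it fixes the generators.
\<close>

theorem virtual_parity_groups_isomorphic:
  assumes "is_virtual_knot_diagram K" "is_virtual_knot_diagram L"
    and ext: "\<And>(G :: pg_group) s q h c. group G \<Longrightarrow> colouring K G s q h c \<Longrightarrow>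
      \<exists>c'. colouring L G s q h c' \<and> (\<forall>t\<in>E. c' t = c (e t))"
    and ext': "\<And>(G :: pg_group) s q h c'. group G \<Longrightarrow> colouring L G s q h c' \<Longrightarrow>
      \<exists>c. colouring K G s q h c \<and> (\<forall>t\<in>E. c' t = c (e t))"
    and uniq: "\<And>(G :: pg_group) s q h c d. group G \<Longrightarrow> colouring K G s q h c \<Longrightarrow>
      colouring K G s q h d \<Longrightarrow> (\<forall>t\<in>E. c (e t) = d (e t)) \<Longrightarrow> c = d"
    and uniq': "\<And>(G :: pg_group) s q h c d. group G \<Longrightarrow> colouring L G s q h c \<Longrightarrow>
      colouring L G s q h d \<Longrightarrow> (\<forall>t\<in>E. c t = d t) \<Longrightarrow> c = d"
  shows "virtual_parity_group K \<cong> virtual_parity_group L"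
proof -
  interpret K: diagram K by unfold_locales fact
  interpret L: diagram L by unfold_locales fact
  let ?PK = "virtual_parity_group K" and ?PL = "virtual_parity_group L"
  have gK: "group ?PK" and gL: "group ?PL"
    by (rule K.group_virtual_parity_group, rule L.group_virtual_parity_group)
  obtain c' where c': "colouring L ?PK (K.PG.gcls Gen_s) (K.PG.gcls Gen_q) (K.PG.gcls Gen_theta) c'"
      "\<forall>t\<in>E. c' t = K.univ (e t)"
    using ext[OF gK K.colouring_univ] by blast
  obtain c where c: "colouring K ?PL (L.PG.gcls Gen_s) (L.PG.gcls Gen_q) (L.PG.gcls Gen_theta) c"
      "\<forall>t\<in>E. L.univ t = c (e t)"
    using ext'[OF gL L.colouring_univ] by blast
  obtain F where F: "F \<in> hom ?PK ?PL" "F (K.PG.gcls Gen_s) = L.PG.gcls Gen_s"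
      "F (K.PG.gcls Gen_q) = L.PG.gcls Gen_q" "F (K.PG.gcls Gen_theta) = L.PG.gcls Gen_theta"
      "\<And>t. F (K.univ t) = c t"
    using K.colouring_factors[OF gL c(1)] by metis
  obtain F' where F': "F' \<in> hom ?PL ?PK" "F' (L.PG.gcls Gen_s) = K.PG.gcls Gen_s"
      "F' (L.PG.gcls Gen_q) = K.PG.gcls Gen_q" "F' (L.PG.gcls Gen_theta) = K.PG.gcls Gen_theta"
      "\<And>t. F' (L.univ t) = c' t"
    using L.colouring_factors[OF gK c'(1)] by metis
  have "(\<lambda>t. F' (c t)) = K.univ"
  proof (rule uniq[OF gK _ K.colouring_univ])
    show "colouring K ?PK (K.PG.gcls Gen_s) (K.PG.gcls Gen_q) (K.PG.gcls Gen_theta) (\<lambda>t. F' (c t))"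
      using colouring_hom[OF gL gK F'(1) c(1)] by (simp add: F')
    show "\<forall>t\<in>E. F' (c (e t)) = K.univ (e t)"
      using c(2) c'(2) F'(5) by metis
  qed
  then have 1: "F' (F (K.univ t)) = K.univ t" for t
    unfolding F(5) by metis
  have "(\<lambda>t. F (c' t)) = L.univ"
  proof (rule uniq'[OF gL _ L.colouring_univ])
    show "colouring L ?PL (L.PG.gcls Gen_s) (L.PG.gcls Gen_q) (L.PG.gcls Gen_theta) (\<lambda>t. F (c' t))"
      using colouring_hom[OF gK gL F(1) c'(1)] by (simp add: F)
    show "\<forall>t\<in>E. F (c' t) = L.univ t"
      using c(2) c'(2) F(5) by metis
  qed
  then have 2: "F (F' (L.univ t)) = L.univ t" for t
    unfolding F'(5) by metis
  have 3: "F' (F A) = A" if "A \<in> carrier ?PK" for A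
    using K.hom_eq_on_univ[OF gK, of "F' \<circ> F" id A] that F F' 1 hom_compose[OF F(1) F'(1)]
    by (auto simp: hom_def)
  have 4: "F (F' A) = A" if "A \<in> carrier ?PL" for A
    using L.hom_eq_on_univ[OF gL, of "F \<circ> F'" id A] that F F' 2 hom_compose[OF F'(1) F(1)]
    by (auto simp: hom_def)
  have "bij_betw F (carrier ?PK) (carrier ?PL)"
    using 3 4 F(1) F'(1) by (intro bij_betw_byWitness[where f'=F']) (auto simp: hom_def)
  then show ?thesis
    using F(1) by (intro is_isoI[of F]) (simp add: iso_def)
qed

section \<open>Parity\<close>

context diagram
begin

text \<open>
  Two passages have different values iff an odd number of classical passages separates them,
  where the first of the two is counted.
\<close>

definition parity_function :: "(real \<Rightarrow> bool) \<Rightarrow> bool" where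
  "parity_function f \<longleftrightarrow> step_function C f \<and> (\<forall>t\<in>C. after f t = (\<not> f t))"

definition passages :: "real \<Rightarrow> real \<Rightarrow> nat" where
  "passages p q = card (C \<inter> {p..<q})"

lemma classical_subset: "C \<subseteq> X"
  by (auto simp: classical_times_def)

lemma finite_classical: "finite (C \<inter> {p..<q})"
  by (rule finite_subset[OF _ finite_crossing_times[of p q]]) (use classical_subset in auto)

lemma passages_add:
  assumes "p \<le> q" "q \<le> r" shows "passages p r = passages p q + passages q r"
proof -
  have "C \<inter> {p..<r} = (C \<inter> {p..<q}) \<union> (C \<inter> {q..<r})" using assms by auto
  moreover have "(C \<inter> {p..<q}) \<inter> (C \<inter> {q..<r}) = {}" by auto
  ultimately show ?thesis
    unfolding passages_def using card_Un_disjoint finite_classical by metis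
qed

text \<open>
  Each classical crossing contributes its two passages.
\<close>

lemma even_passages_period: "even (passages t (t + 1))"
proof -
  let ?S = "C \<inter> {t..<t + 1}"
  have "card ?S = (\<Sum>x\<in>?S. 1)" by simp
  also have "\<dots> = (\<Sum>p\<in>curve K ` ?S. \<Sum>x | x \<in> ?S \<and> curve K x = p. 1)"
    by (rule sum.image_gen[OF finite_classical])
  also have "even \<dots>"
  proof (rule dvd_sum)
    fix p assume "p \<in> curve K ` ?S"
    then obtain s where s: "s \<in> ?S" "p = curve K s" by blast
    then have "s \<in> X \<inter> {t..<t + 1}" using classical_subset by blast
    then obtain u where u: "s \<noteq> u" "X \<inter> {t..<t + 1} \<inter> curve K -` {curve K s} = {s, u}"
      "meets K s u"
      by (rule fibre)
    have "u \<in> C" using classical_meets[OF u(3)] s by simp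
    then have "{x. x \<in> ?S \<and> curve K x = p} = {s, u}"
      using u(2) s classical_subset by blast
    then show "even (\<Sum>x | x \<in> ?S \<and> curve K x = p. 1 :: nat)" using u(1) by simp
  qed
  finally show ?thesis by (simp add: passages_def)
qed

text \<open>
  Count the passages from time 0.
\<close>

lemma parity_function_exists:
  obtains f where "parity_function f"
    "\<And>p q. p \<le> q \<Longrightarrow> (f p \<noteq> f q) = odd (passages p q)"
proof -
  define f where "f t = odd (if 0 \<le> t then passages 0 t else passages t 0)" for t :: real
  have f: "(f p \<noteq> f q) = odd (passages p q)" if "p \<le> q" for p q
  proof -
    consider "0 \<le> p" | "p < 0" "0 \<le> q" | "q < 0" by linarith
    then show ?thesis
    proof cases
      case 1
      then have "passages 0 q = passages 0 p + passages p q" using that by (intro passages_add) auto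
      then show ?thesis using 1 that by (auto simp: f_def)
    next
      case 2
      then have "passages p q = passages p 0 + passages 0 q" by (intro passages_add) auto
      then show ?thesis using 2 by (simp add: f_def)
    next
      case 3
      then have "passages p 0 = passages p q + passages q 0" using that by (intro passages_add) auto
      then show ?thesis using 3 that by (auto simp: f_def)
    qed
  qed
  have left: "\<forall>\<^sub>F u in at_left t. f u = f t" for t
  proof -
    obtain u where u: "u < t" "{u..<t} \<inter> X = {}" by (rule gap_left)
    have "f v = f t" if "v \<in> {u<..<t}" for v
    proof -
      have "C \<inter> {v..<t} \<subseteq> {u..<t} \<inter> X" using that classical_subset by auto
      then have "C \<inter> {v..<t} = {}" using u(2) by blast
      then show ?thesis using f[of v t] that by (simp add: passages_def)
    qed
    then show ?thesis
      using eventually_at_left_real[OF u(1)] by (auto elim: eventually_mono)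
  qed
  have right: "\<forall>\<^sub>F u in at_right t. f u = (f t \<noteq> (t \<in> C))" for t
  proof -
    obtain u where u: "t < u" "{t<..u} \<inter> X = {}" by (rule gap_right)
    have "f v = (f t \<noteq> (t \<in> C))" if v: "v \<in> {t<..<u}" for v
    proof -
      have "C \<inter> {t..<v} \<subseteq> insert t ({t<..u} \<inter> X)" using v classical_subset by auto
      then have "C \<inter> {t..<v} = C \<inter> {t}" using u(2) v by auto
      then show ?thesis using f[of t v] v by (cases "t \<in> C") (auto simp: passages_def)
    qed
    then show ?thesis
      using eventually_at_right_real[OF u(1)] by (auto elim: eventually_mono)
  qed
  have "f (t + 1) = f t" for t
    using f[of t "t + 1"] even_passages_period by auto
  then have "step_function C f"
    using left right by (intro step_functionI) (auto intro!: exI)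
  moreover have "after f t = (\<not> f t)" if "t \<in> C" for t
    using after_eqI[OF right[of t]] that by simp
  ultimately show ?thesis
    using that[of f] f unfolding parity_function_def by blast
qed

text \<open>Two parity functions differ by a step function without jumps, that is, by a constant.\<close>

lemma parity_function_passages:
  assumes f: "parity_function f" and "p \<le> q"
  shows "(f p \<noteq> f q) = odd (passages p q)"
proof -
  obtain g where g: "parity_function g" "\<And>p q. p \<le> q \<Longrightarrow> (g p \<noteq> g q) = odd (passages p q)"
    by (rule parity_function_exists) blast
  have fs: "step_function C f" and gs: "step_function C g"
    using f g by (auto simp: parity_function_def)
  have "step_function {} (\<lambda>t. f t = g t)"
  proof (rule step_functionI)
    show "\<forall>\<^sub>F u in at_left t. (f u = g u) = (f t = g t)" for t
      using step_functionD(3)[OF fs, of t] step_functionD(3)[OF gs, of t] by eventually_elim simp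
    have eq: "(after f t = after g t) = (f t = g t)" for t
      using f g(1) step_functionD(5)[OF fs, of t] step_functionD(5)[OF gs, of t]
      unfolding parity_function_def by metis
    have "\<forall>\<^sub>F u in at_right t. (f u = g u) = (f t = g t)" for t
      using step_functionD(4)[OF fs, of t] step_functionD(4)[OF gs, of t]
      by eventually_elim (simp only: eq)
    then show "\<exists>v. (\<forall>\<^sub>F u in at_right t. (f u = g u) = v) \<and> (t \<notin> {} \<longrightarrow> v = (f t = g t))" for t
      by blast
  qed (use step_functionD(1)[OF fs] step_functionD(1)[OF gs] in simp)
  then have "(f q = g q) = (f p = g p)"
    using step_function_const'[of "{}" "\<lambda>t. f t = g t" p q q] \<open>p \<le> q\<close> by simp
  then show ?thesis using g(2)[OF \<open>p \<le> q\<close>] by blast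
qed

text \<open>
  The letters between two passages are the passages in the half-open interval from the first to
  the second, except the first one itself; hence the negation.
\<close>

lemma odd_letters_between:
  assumes f: "parity_function f" and st: "meets K s t" and s: "s \<in> C"
  shows "odd (letters_between K s t) \<longleftrightarrow> f s = f t"
proof -
  define t' where "t' = s + frac (t - s)"
  have "s - t \<notin> \<int>" using st by (simp add: meets_def)
  then have "t - s \<notin> \<int>" by (metis Ints_minus minus_diff_eq)
  then have "s < t'" unfolding t'_def using frac_gt_0_iff by simp
  then have "C \<inter> {s..<t'} = insert s (C \<inter> {s<..<t'})" using s by auto
  moreover have "finite (C \<inter> {s<..<t'})"
    by (rule finite_subset[OF _ finite_classical[of s t']]) auto
  ultimately have "passages s t' = Suc (letters_between K s t)"
    by (simp add: passages_def letters_between_def Int_commute t'_def[symmetric])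
  moreover have "f t' = f t"
  proof -
    have "t' = t + of_int (- \<lfloor>t - s\<rfloor>)" by (simp add: t'_def frac_def)
    then show ?thesis
      using f step_functionD(2) unfolding parity_function_def by metis
  qed
  ultimately show ?thesis
    using parity_function_passages[OF f, of s t'] \<open>s < t'\<close> by auto
qed

lemma kind_eq:
  assumes f: "parity_function f" and st: "meets K s t"
  shows "kind K s t = (if s \<notin> C then Virtual else if f s = f t then OddClassical
    else if s \<in> over K then EvenPositive else EvenNegative)"
  using odd_letters_between[OF assms] meets_crossing_time[OF st]
  by (auto simp: kind_def classical_times_def)

lemma kind_shift:
  assumes st: "meets K s t" shows "kind K (s + of_int k) (t + of_int l) = kind K s t"
proof -
  obtain f where f: "parity_function f" by (rule parity_function_exists)
  then have "f (u + of_int k) = f u" for u k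
    using step_functionD(2) unfolding parity_function_def by metis
  moreover have "meets K (s + of_int k) (t + of_int l)" using st by simp
  ultimately show ?thesis using kind_eq[OF f] st by simp
qed

lemma crossing_ok_shift:
  assumes st: "meets K u v" and c: "step_function X c"
  shows "crossing_ok K G s q h c (u + of_int k) (v + of_int l) \<longleftrightarrow> crossing_ok K G s q h c u v"
proof -
  have "c (t + of_int k) = c t" "after c (t + of_int k) = after c t" for t k
    using step_functionD(2)[OF c] after_shift[of c] step_functionD(1)[OF c] by auto
  then show ?thesis by (simp add: crossing_ok_def kind_shift[OF st])
qed

end

section \<open>Changing a diagram inside a disc\<close>

lemma circ_iff: "t \<in> circ A \<longleftrightarrow> (\<exists>k::int. t - of_int k \<in> A)"
proof
  assume "t \<in> circ A"
  then obtain u k where "t = u + of_int k" "u \<in> A" by (auto simp: circ_def)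
  then have "t - of_int k \<in> A" by simp
  then show "\<exists>k::int. t - of_int k \<in> A" by blast
next
  assume "\<exists>k::int. t - of_int k \<in> A"
  then obtain k :: int where "t - of_int k \<in> A" by blast
  moreover have "t = (t - of_int k) + of_int k" by simp
  ultimately show "t \<in> circ A" unfolding circ_def by blast
qed

lemma no_int_between: "\<not> (real_of_int k < real_of_int l \<and> real_of_int l < real_of_int k + 1)"
proof -
  have "real_of_int l < real_of_int k + 1 \<longleftrightarrow> l < k + 1"
    by (metis of_int_1 of_int_add of_int_less_iff)
  then show ?thesis by simp
qed

lemma circ_shift [simp]: "t + of_int k \<in> circ A \<longleftrightarrow> t \<in> circ A"
proof -
  have "t + of_int k - of_int l = t - of_int (l - k)" "t - of_int l = t + of_int k - of_int (l + k)" for l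
    by simp_all
  then show ?thesis unfolding circ_iff by metis
qed

lemma subset_circ: "A \<subseteq> circ A"
  by (auto simp: circ_iff intro!: exI[of _ 0])

lemma circ_gap:
  fixes a b y :: real
  assumes y: "y \<in> {b + of_int k<..<a + of_int k + 1}" shows "y \<notin> circ {a..b}"
proof
  assume "y \<in> circ {a..b}"
  then obtain l :: int where "a \<le> y - of_int l" "y - of_int l \<le> b" by (auto simp: circ_iff)
  then have "of_int k < real_of_int l \<and> real_of_int l < of_int k + 1" using y by auto
  then show False using no_int_between by blast
qed

lemma closed_circ:
  assumes "b < a + 1" shows "closed (circ {a..b :: real})"
proof -
  have "\<exists>T. open T \<and> x \<in> T \<and> T \<subseteq> - circ {a..b}" if x: "x \<in> - circ {a..b}" for x
  proof (intro exI conjI)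
    let ?k = "\<lfloor>x - a\<rfloor>"
    have "x - of_int ?k \<notin> {a..b}" using x by (auto simp: circ_iff)
    then show "x \<in> {b + of_int ?k<..<a + of_int ?k + 1}" by (auto; linarith)
    show "{b + of_int ?k<..<a + of_int ?k + 1} \<subseteq> - circ {a..b}"
      using circ_gap by blast
  qed auto
  then have "open (- circ {a..b})" by (subst open_subopen) blast
  then show ?thesis by (simp add: closed_def)
qed

text \<open>
  Two diagrams that agree outside a disc.  The strands inside the disc have the same parameter
  intervals in both.
\<close>

locale disc_pair = K: diagram K + L: diagram L for K L +
  fixes D :: "complex set" and n :: nat and a b :: "nat \<Rightarrow> real"
  assumes change: "local_change D n a b K L"
begin

lemma local_change_swap: "local_change D n a b L K"
proof -
  have "curve K -` interior D = curve L -` interior D" "curve K -` D = curve L -` D"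
    using change by (auto simp: local_change_def strands_def)
  then have "curve K t \<in> interior D \<longleftrightarrow> curve L t \<in> interior D"
    "curve K t \<in> D \<longleftrightarrow> curve L t \<in> D" for t
    by blast+
  then show ?thesis using change by (simp add: local_change_def)
qed

text \<open>
  The times at which the curves run in the interior of the disc, and in the disc.
\<close>

definition inner :: "real set" where "inner = (\<Union>i<n. circ {a i<..<b i})"
definition outer :: "real set" where "outer = (\<Union>i<n. circ {a i..b i})"

lemma ab: "i < n \<Longrightarrow> a i < b i" "i < n \<Longrightarrow> b i < a i + 1"
  using change by (auto simp: local_change_def strands_def)

lemma circ_disjoint: "i < n \<Longrightarrow> j < n \<Longrightarrow> i \<noteq> j \<Longrightarrow> circ {a i..b i} \<inter> circ {a j..b j} = {}"
  using change by (auto simp: local_change_def strands_def)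

lemma vimage_inner: "curve K -` interior D = inner" "curve L -` interior D = inner"
  and vimage_outer: "curve K -` D = outer" "curve L -` D = outer"
  using change by (simp_all add: local_change_def strands_def inner_def outer_def)

lemma inner_outer: "inner \<subseteq> outer"
  using vimage_inner(1) vimage_outer(1) interior_subset[of D] by blast

lemma curves_agree: "t \<notin> inner \<Longrightarrow> curve L t = curve K t"
  using change vimage_inner(1) by (auto simp: local_change_def)

lemma inner_shift [simp]: "t + of_int k \<in> inner \<longleftrightarrow> t \<in> inner"
  and outer_shift [simp]: "t + of_int k \<in> outer \<longleftrightarrow> t \<in> outer"
  by (simp_all add: inner_def outer_def)

lemma open_complement_outer: "open (- outer)"
  unfolding outer_def using ab closed_circ by (intro open_Compl closed_UN) auto

lemma end_points_outer: "i < n \<Longrightarrow> a i + of_int k \<in> outer" "i < n \<Longrightarrow> b i + of_int k \<in> outer"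
  using ab(1)[of i] subset_circ[of "{a i..b i}"] unfolding outer_shift
  by (auto simp: outer_def less_imp_le subset_iff intro!: bexI[of _ i])

lemma strand_unique:
  assumes "i < n" "j < n" "r \<in> {a i..b i}" "r' \<in> {a j..b j}" "r - r' \<in> \<int>"
  shows "i = j \<and> r = r'"
proof -
  obtain k :: int where k: "r - r' = of_int k" using assms(5) by (auto elim: Ints_cases)
  have "r \<in> circ {a i..b i}" using assms(3) subset_circ by blast
  moreover have "r - of_int k = r'" using k by simp
  then have "r \<in> circ {a j..b j}" using assms(4) unfolding circ_iff by metis
  ultimately have ij: "i = j" using circ_disjoint[OF assms(1,2)] by blast
  then have "\<bar>of_int k :: real\<bar> < 1" using assms(3,4) ab(2)[OF assms(1)] k by auto
  then have "k = 0" by linarith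
  then show ?thesis using ij k by simp
qed

lemma end_points_not_inner:
  assumes "i < n" shows "a i + of_int k \<notin> inner" "b i + of_int k \<notin> inner"
proof -
  have "r \<notin> inner" if r: "r \<in> {a i, b i}" for r
  proof
    assume "r \<in> inner"
    then obtain j l where j: "j < n" "r - of_int l \<in> {a j<..<b j}"
      by (auto simp: inner_def circ_iff)
    then show False
      using strand_unique[OF assms j(1), of r "r - of_int l"] r ab(1)[OF assms] by auto
  qed
  then show "a i + of_int k \<notin> inner" "b i + of_int k \<notin> inner" by simp_all
qed

lemma no_crossing_on_boundary:
  assumes "t \<in> outer" "t \<notin> inner" shows "t \<notin> K.X" "t \<notin> L.X"
proof -
  have "curve K t \<in> D - interior D" "curve L t \<in> D - interior D"
    using assms vimage_inner vimage_outer by blast+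
  then have "curve K t \<in> frontier D" "curve L t \<in> frontier D"
    using closure_subset[of D] by (auto simp: frontier_def)
  moreover have "crossings K \<inter> frontier D = {}" "crossings L \<inter> frontier D = {}"
    using change by (simp_all add: local_change_def strands_def)
  ultimately have "curve K t \<notin> crossings K" "curve L t \<notin> crossings L" by blast+
  then show "t \<notin> K.X" "t \<notin> L.X" by (auto simp: crossings_def)
qed

lemma end_points_not_crossing:
  assumes "i < n"
  shows "a i + of_int k \<notin> K.X" "b i + of_int k \<notin> K.X" "a i + of_int k \<notin> L.X" "b i + of_int k \<notin> L.X"
  using no_crossing_on_boundary end_points_outer[OF assms] end_points_not_inner[OF assms] by auto

lemma inner_cases:
  assumes "t \<in> inner" obtains i r k where "i < n" "r \<in> {a i<..<b i}" "t = r + of_int k"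
proof -
  obtain i k where "i < n" "t - of_int k \<in> {a i<..<b i}"
    using assms by (auto simp: inner_def circ_iff)
  then show ?thesis using that[of i "t - of_int k" k] by simp
qed

lemma outer_cases:
  assumes "t \<in> outer" obtains i r k where "i < n" "r \<in> {a i..b i}" "t = r + of_int k"
proof -
  obtain i k where "i < n" "t - of_int k \<in> {a i..b i}"
    using assms by (auto simp: outer_def circ_iff)
  then show ?thesis using that[of i "t - of_int k" k] by simp
qed

lemma in_inner: "i < n \<Longrightarrow> r \<in> {a i<..<b i} \<Longrightarrow> r + of_int k \<in> inner"
  unfolding inner_shift using subset_circ[of "{a i<..<b i}"] by (auto simp: inner_def)

end

text \<open>
  Times \<open>k1 i < k2 i\<close> and \<open>l1 i < l2 i\<close> on the \<open>i\<close>th strand that comprise its crossings in \<open>K\<close>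
  and \<open>L\<close>.  They need not be crossing times, so that a strand without crossings is covered.
  By the last condition, the numbers of classical passages on a strand in \<open>K\<close> and \<open>L\<close> have
  the same parity.
\<close>

locale disc_change = disc_pair K L D n a b for K L D n a b +
  fixes k1 k2 l1 l2 :: "nat \<Rightarrow> real"
  assumes K_points: "i < n \<Longrightarrow> a i < k1 i \<and> k1 i < k2 i \<and> k2 i < b i"
    and K_times: "i < n \<Longrightarrow> crossing_times K \<inter> {a i<..<b i} \<subseteq> {k1 i, k2 i}"
    and L_points: "i < n \<Longrightarrow> a i < l1 i \<and> l1 i < l2 i \<and> l2 i < b i"
    and L_times: "i < n \<Longrightarrow> crossing_times L \<inter> {a i<..<b i} \<subseteq> {l1 i, l2 i}"
    and classical_passages: "i < n \<Longrightarrow>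
      ((k1 i \<in> classical_times K) = (k2 i \<in> classical_times K)) =
      ((l1 i \<in> classical_times L) = (l2 i \<in> classical_times L))"
begin

lemma disc_change_swap: "disc_change L K D n a b l1 l2 k1 k2"
  by unfold_locales (use local_change_swap K_points K_times L_points L_times classical_passages in auto)

text \<open>
  The choice operator selects the strand and the representative of \<open>t\<close> modulo 1 in its parameter
  interval, which are unique by \<open>strand_unique\<close>.  The new value starts after the times \<open>l1 i\<close>
  and \<open>l2 i\<close>, which makes the function left-continuous.
\<close>

definition glue :: "(real \<Rightarrow> 'v) \<Rightarrow> (nat \<Rightarrow> 'v) \<Rightarrow> real \<Rightarrow> 'v" where
  "glue c m t = (if t \<in> inner then
     (let (i, r) = (SOME (i, r). i < n \<and> r \<in> {a i<..<b i} \<and> t - r \<in> \<int>)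
      in if r \<le> l1 i then c (a i) else if r \<le> l2 i then m i else c (b i))
     else c t)"

lemma glue_outside: "t \<notin> inner \<Longrightarrow> glue c m t = c t"
  by (simp add: glue_def)

lemma glue_inside:
  assumes "i < n" "r \<in> {a i<..<b i}"
  shows "glue c m (r + of_int k) =
    (if r \<le> l1 i then c (a i) else if r \<le> l2 i then m i else c (b i))"
proof -
  let ?P = "\<lambda>(j, r'). j < n \<and> r' \<in> {a j<..<b j} \<and> (r + of_int k) - r' \<in> \<int>"
  have "?P (i, r)" using assms by simp
  moreover have "x = (i, r)" if x: "?P x" for x
  proof -
    obtain j r' where jr: "x = (j, r')" "j < n" "r' \<in> {a j<..<b j}" "(r + of_int k) - r' \<in> \<int>"
      using x by (cases x) auto
    have "r - r' \<in> \<int>" using jr(4) not_Ints_shift[of r k r' 0] by simp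
    then show ?thesis using strand_unique[of i j r r'] assms jr by auto
  qed
  ultimately have "(SOME x. ?P x) = (i, r)" by (rule some_equality)
  then show ?thesis
    using in_inner[OF assms] by (simp add: glue_def)
qed

lemma glue_shift:
  assumes "\<And>t. c (t + 1) = c t" shows "glue c m (t + 1) = glue c m t"
proof (cases "t \<in> inner")
  case True
  then obtain i r k where i: "i < n" "r \<in> {a i<..<b i}" "t = r + of_int k" by (rule inner_cases)
  then have "t + 1 = r + of_int (k + 1)" by simp
  then show ?thesis by (simp only: i(3) glue_inside[OF i(1,2)])
next
  case False
  then show ?thesis using inner_shift[of t 1] assms by (simp add: glue_outside)
qed

lemma away_from_other_strands:
  assumes i: "i < n" and t: "t \<in> circ {a i..b i}"
  shows "\<forall>\<^sub>F u in at t. \<forall>j\<in>{..<n} - {i}. u \<notin> circ {a j..b j}"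
proof (intro eventually_ball_finite ballI)
  fix j assume j: "j \<in> {..<n} - {i}"
  have "open (- circ {a j..b j})" using closed_circ ab(2)[of j] j by auto
  moreover have "t \<in> - circ {a j..b j}" using circ_disjoint[OF i, of j] t j by auto
  ultimately have "\<forall>\<^sub>F u in at t. u \<in> - circ {a j..b j}" by (intro eventually_at_in_open')
  then show "\<forall>\<^sub>F u in at t. u \<notin> circ {a j..b j}" by simp
qed simp

lemma not_inner:
  assumes "i < n" "\<forall>j\<in>{..<n} - {i}. u \<notin> circ {a j..b j}" "u \<notin> circ {a i..b i}"
  shows "u \<notin> inner"
proof -
  have "u \<notin> outer" using assms by (auto simp: outer_def)
  then show ?thesis using inner_outer by blast
qed

lemma near_start:
  assumes i: "i < n" shows "\<forall>\<^sub>F u in at_left (a i + of_int k). u \<notin> inner"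
proof -
  have "a i + of_int k \<in> circ {a i..b i}"
    using ab(1)[OF i] subset_circ[of "{a i..b i}"] by (simp add: subset_iff)
  note away_from_other_strands[OF i this]
  moreover have "b i + of_int (k - 1) < a i + of_int k" using ab(2)[OF i] by simp
  note eventually_at_left_real[OF this]
  ultimately have "\<forall>\<^sub>F u in at_left (a i + of_int k).
      u \<in> {b i + of_int (k - 1)<..<a i + of_int k} \<and> (\<forall>j\<in>{..<n} - {i}. u \<notin> circ {a j..b j})"
    by (auto simp: eventually_at_split eventually_conj_iff)
  then show ?thesis
    by eventually_elim (use circ_gap[of _ "b i" "k - 1" "a i"] not_inner[OF i] in auto)
qed

lemma near_end:
  assumes i: "i < n" shows "\<forall>\<^sub>F u in at_right (b i + of_int k). u \<notin> inner"
proof -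
  have "b i + of_int k \<in> circ {a i..b i}"
    using ab(1)[OF i] subset_circ[of "{a i..b i}"] by (simp add: subset_iff)
  note away_from_other_strands[OF i this]
  moreover have "b i + of_int k < a i + of_int k + 1" using ab(2)[OF i] by simp
  note eventually_at_right_real[OF this]
  ultimately have "\<forall>\<^sub>F u in at_right (b i + of_int k).
      u \<in> {b i + of_int k<..<a i + of_int k + 1} \<and> (\<forall>j\<in>{..<n} - {i}. u \<notin> circ {a j..b j})"
    by (auto simp: eventually_at_split eventually_conj_iff)
  then show ?thesis
    by eventually_elim (use circ_gap[of _ "b i" k "a i"] not_inner[OF i] in auto)
qed

lemma near_outside:
  assumes "t \<notin> outer"
  shows "\<forall>\<^sub>F u in at t. u \<notin> outer" "\<forall>\<^sub>F u in at_left t. u \<notin> outer" "\<forall>\<^sub>F u in at_right t. u \<notin> outer"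
proof -
  show "\<forall>\<^sub>F u in at t. u \<notin> outer"
    using eventually_at_in_open'[OF open_complement_outer, of t] assms by simp
  then show "\<forall>\<^sub>F u in at_left t. u \<notin> outer" "\<forall>\<^sub>F u in at_right t. u \<notin> outer"
    by (simp_all add: eventually_at_split)
qed

lemma glue_right_inside:
  assumes i: "i < n"
  shows "r \<in> {a i..<l1 i} \<Longrightarrow> \<forall>\<^sub>F u in at_right (r + of_int k). glue c m u = c (a i)"
    and "r \<in> {l1 i..<l2 i} \<Longrightarrow> \<forall>\<^sub>F u in at_right (r + of_int k). glue c m u = m i"
    and "r \<in> {l2 i..<b i} \<Longrightarrow> \<forall>\<^sub>F u in at_right (r + of_int k). glue c m u = c (b i)"
proof -
  note p = L_points[OF i]
  have *: "\<forall>\<^sub>F u in at_right (r + of_int k). glue c m u = v"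
    if "r < hi" "\<And>u. u \<in> {r<..<hi} \<Longrightarrow> glue c m (u + of_int k) = v" for r hi v
  proof -
    have "\<forall>\<^sub>F u in at_right (r + of_int k). u \<in> {r + of_int k<..<hi + of_int k}"
      using \<open>r < hi\<close> by (intro eventually_at_right_real) simp
    then show ?thesis
    proof eventually_elim
      case (elim u)
      then show ?case using that(2)[of "u - of_int k"] by simp
    qed
  qed
  show "r \<in> {a i..<l1 i} \<Longrightarrow> \<forall>\<^sub>F u in at_right (r + of_int k). glue c m u = c (a i)"
    using p by (intro *[of r "l1 i"]) (auto simp: glue_inside[OF i])
  show "r \<in> {l1 i..<l2 i} \<Longrightarrow> \<forall>\<^sub>F u in at_right (r + of_int k). glue c m u = m i"
    using p by (intro *[of r "l2 i"]) (auto simp: glue_inside[OF i])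
  show "r \<in> {l2 i..<b i} \<Longrightarrow> \<forall>\<^sub>F u in at_right (r + of_int k). glue c m u = c (b i)"
    using p by (intro *[of r "b i"]) (auto simp: glue_inside[OF i])
qed

lemma glue_left_inside:
  assumes c: "\<And>t k. c (t + of_int k) = c t" and i: "i < n" and r: "r \<in> {a i<..b i}"
  shows "\<forall>\<^sub>F u in at_left (r + of_int k). glue c m u = glue c m (r + of_int k)"
proof -
  note p = L_points[OF i]
  have *: "\<forall>\<^sub>F u in at_left (r + of_int k). glue c m u = v"
    if "lo < r" "\<And>u. u \<in> {lo<..<r} \<Longrightarrow> glue c m (u + of_int k) = v" for lo v
  proof -
    have "\<forall>\<^sub>F u in at_left (r + of_int k). u \<in> {lo + of_int k<..<r + of_int k}"
      using \<open>lo < r\<close> by (intro eventually_at_left_real) simp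
    then show ?thesis
    proof eventually_elim
      case (elim u)
      then show ?case using that(2)[of "u - of_int k"] by simp
    qed
  qed
  consider "r \<le> l1 i" | "l1 i < r" "r \<le> l2 i" | "l2 i < r" "r < b i" | "r = b i"
    using r by fastforce
  then show ?thesis
  proof cases
    case 1
    then show ?thesis using p r by (intro *[of "a i"]) (auto simp: glue_inside[OF i])
  next
    case 2
    then show ?thesis using p r by (intro *[of "l1 i"]) (auto simp: glue_inside[OF i])
  next
    case 3
    then show ?thesis using p r by (intro *[of "l2 i"]) (auto simp: glue_inside[OF i])
  next
    case 4
    have "glue c m (r + of_int k) = c (b i)"
      unfolding 4 glue_outside[OF end_points_not_inner(2)[OF i]] by (rule c)
    then show ?thesis using p r 4 by (intro *[of "l2 i"]) (auto simp: glue_inside[OF i])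
  qed
qed

text \<open>
  Away from the disc nothing changes.  Inside, jumps are possible at \<open>l1 i\<close> and \<open>l2 i\<close>, and at the
  ends of a strand the glued function has the values of \<open>c\<close> on both sides.
\<close>

lemma step_function_glue:
  assumes c: "step_function XK c"
    and out: "\<And>t. t \<notin> outer \<Longrightarrow> t \<in> XK \<Longrightarrow> t \<in> XL"
    and bd: "\<And>i k. i < n \<Longrightarrow> b i + of_int k \<notin> XK"
    and per: "\<And>t k. t + of_int k \<in> XL \<longleftrightarrow> t \<in> XL"
    and jump: "\<And>i. i < n \<Longrightarrow> l1 i \<notin> XL \<Longrightarrow> m i = c (a i)"
      "\<And>i. i < n \<Longrightarrow> l2 i \<notin> XL \<Longrightarrow> m i = c (b i)"
  shows "step_function XL (glue c m)"
proof (rule step_functionI)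
  have cs: "c (t + of_int k) = c t" for t k using step_functionD(2)[OF c] .
  show "glue c m (t + 1) = glue c m t" for t
    using glue_shift step_functionD(1)[OF c] by blast
  fix t
  have eq_out: "\<forall>\<^sub>F u in at_left t. glue c m u = c u" "\<forall>\<^sub>F u in at_right t. glue c m u = c u"
    "glue c m t = c t" if "t \<notin> outer"
    using near_outside[OF that] inner_outer that
    by (auto elim!: eventually_mono intro!: glue_outside)
  show "\<forall>\<^sub>F u in at_left t. glue c m u = glue c m t"
  proof (cases "t \<in> outer")
    case True
    then obtain i r k where i: "i < n" "r \<in> {a i..b i}" "t = r + of_int k" by (rule outer_cases)
    show ?thesis
    proof (cases "r = a i")
      case True
      have eq: "glue c m t = c t"
        unfolding i(3) True by (rule glue_outside[OF end_points_not_inner(1)[OF i(1)]])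
      show ?thesis
        using near_start[OF i(1), of k] step_functionD(3)[OF c, of t] unfolding eq unfolding i(3) True
        by eventually_elim (simp add: glue_outside)
    next
      case False
      then show ?thesis using glue_left_inside[OF cs i(1), of r] i(2,3) by auto
    qed
  next
    case False
    show ?thesis
      using eq_out(1)[OF False] step_functionD(3)[OF c, of t] unfolding eq_out(3)[OF False]
      by eventually_elim simp
  qed
  show "\<exists>v. (\<forall>\<^sub>F u in at_right t. glue c m u = v) \<and> (t \<notin> XL \<longrightarrow> v = glue c m t)"
  proof (cases "t \<in> outer")
    case True
    then obtain i r k where i: "i < n" "r \<in> {a i..b i}" "t = r + of_int k" by (rule outer_cases)
    note p = L_points[OF i(1)] and R = glue_right_inside[OF i(1)]
    have ga: "glue c m t = c (a i)" if "r = a i"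
      unfolding i(3) that glue_outside[OF end_points_not_inner(1)[OF i(1)]] by (rule cs)
    have gi: "glue c m t = (if r \<le> l1 i then c (a i) else if r \<le> l2 i then m i else c (b i))"
      if "r \<in> {a i<..<b i}" unfolding i(3) by (rule glue_inside[OF i(1) that])
    have tr: "t \<in> XL \<longleftrightarrow> r \<in> XL" using per i(3) by simp
    consider "r \<in> {a i..<l1 i}" | "r \<in> {l1 i..<l2 i}" | "r \<in> {l2 i..<b i}" | "r = b i"
      using i(2) p by fastforce
    then show ?thesis
    proof cases
      case 1
      have "glue c m t = c (a i)" using ga gi 1 p by (cases "r = a i") auto
      then show ?thesis using R(1)[OF 1] i(3) by auto
    next
      case 2
      have "m i = glue c m t" if "t \<notin> XL"
        using gi 2 p that tr jump(1)[OF i(1)] by (cases "r = l1 i") auto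
      then show ?thesis using R(2)[OF 2] i(3) by blast
    next
      case 3
      have "c (b i) = glue c m t" if "t \<notin> XL"
        using gi 3 p that tr jump(2)[OF i(1)] by (cases "r = l2 i") auto
      then show ?thesis using R(3)[OF 3] i(3) by blast
    next
      case 4
      have "glue c m t = c t"
        unfolding i(3) 4 by (rule glue_outside[OF end_points_not_inner(2)[OF i(1)]])
      moreover have "after c t = c t" using step_functionD(5)[OF c] bd[OF i(1)] i(3) 4 by simp
      moreover have "\<forall>\<^sub>F u in at_right t. glue c m u = after c t"
        using near_end[OF i(1), of k] step_functionD(4)[OF c, of t] unfolding i(3) 4
        by eventually_elim (simp add: glue_outside)
      ultimately show ?thesis by metis
    qed
  next
    case False
    have "\<forall>\<^sub>F u in at_right t. glue c m u = after c t"
      using eq_out(2)[OF False] step_functionD(4)[OF c, of t] by eventually_elim simp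
    then show ?thesis
      using eq_out(3)[OF False] step_functionD(5)[OF c, of t] out[OF False] by metis
  qed
qed

lemma glue_at:
  assumes c: "\<And>t. c (t + 1) = c t" and i: "i < n"
  shows "glue c m (l1 i) = c (a i)" "glue c m (l2 i) = m i"
    "after (glue c m) (l1 i) = m i" "after (glue c m) (l2 i) = c (b i)"
proof -
  note p = L_points[OF i]
  have cs: "c (t + of_int k) = c t" for t k using c by (rule shift_int_eq)
  show "glue c m (l1 i) = c (a i)" "glue c m (l2 i) = m i"
    using glue_inside[OF i, of "l1 i" c m 0] glue_inside[OF i, of "l2 i" c m 0] p by auto
  show "after (glue c m) (l1 i) = m i" "after (glue c m) (l2 i) = c (b i)"
    using glue_right_inside(2)[OF i, of "l1 i" c m 0] glue_right_inside(3)[OF i, of "l2 i" c m 0] p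
    by (auto intro!: after_eqI)
qed

lemma after_glue_outside:
  assumes "t \<notin> outer" shows "after (glue c m) t = after c t"
  using near_outside(3)[OF assms] inner_outer
  by (intro after_cong) (auto elim!: eventually_mono intro!: glue_outside)

lemma strand_values:
  assumes c: "step_function XL c" and i: "i < n"
    and XL: "XL \<inter> {a i<..<b i} \<subseteq> {l1 i, l2 i}" "a i \<notin> XL"
  shows "r \<in> {a i..l1 i} \<Longrightarrow> c r = c (a i)" "r \<in> {l1 i<..l2 i} \<Longrightarrow> c r = c (l2 i)"
    "r \<in> {l2 i<..b i} \<Longrightarrow> c r = c (b i)"
    "after c (l1 i) = c (l2 i)" "after c (l2 i) = c (b i)"
proof -
  note p = L_points[OF i]
  have free: "x \<notin> XL" if "a i < x" "x < b i" "x \<noteq> l1 i" "x \<noteq> l2 i" for x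
    using that XL(1) by auto
  have 1: "XL \<inter> {a i..<l1 i} = {}"
  proof -
    have "x \<notin> XL" if "a i \<le> x" "x < l1 i" for x
      using that free[of x] XL(2) p by (cases "x = a i") auto
    then show ?thesis by auto
  qed
  have 2: "XL \<inter> {l1 i<..<l2 i} = {}" and 3: "XL \<inter> {l2 i<..<b i} = {}"
    using free p by auto
  show "r \<in> {a i..l1 i} \<Longrightarrow> c r = c (a i)"
    using p by (intro step_function_const'[OF c _ 1]) auto
  have m: "c r = after c (l1 i)" if "r \<in> {l1 i<..l2 i}" for r
    using step_function_const[OF c _ 2 that] p by simp
  from m[of "l2 i"] show am: "after c (l1 i) = c (l2 i)" using p by simp
  show "r \<in> {l1 i<..l2 i} \<Longrightarrow> c r = c (l2 i)" using m[of r] am by simp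
  have e: "c r = after c (l2 i)" if "r \<in> {l2 i<..b i}" for r
    using step_function_const[OF c _ 3 that] p by simp
  from e[of "b i"] show ae: "after c (l2 i) = c (b i)" using p by simp
  show "r \<in> {l2 i<..b i} \<Longrightarrow> c r = c (b i)" using e[of r] ae by simp
qed

lemma step_function_eq_glue:
  assumes c: "step_function XL c"
    and XL: "\<And>i. i < n \<Longrightarrow> XL \<inter> {a i<..<b i} \<subseteq> {l1 i, l2 i}" "\<And>i. i < n \<Longrightarrow> a i \<notin> XL"
  shows "c = glue c (\<lambda>i. c (l2 i))"
proof
  fix t
  show "c t = glue c (\<lambda>i. c (l2 i)) t"
  proof (cases "t \<in> inner")
    case True
    then obtain i r k where i: "i < n" "r \<in> {a i<..<b i}" "t = r + of_int k" by (rule inner_cases)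
    have "c t = c r" using step_functionD(2)[OF c] i(3) by simp
    then show ?thesis
      using strand_values(1-3)[OF c i(1) XL(1)[OF i(1)] XL(2)[OF i(1)], of r] i(2)
      unfolding i(3) glue_inside[OF i(1,2)] by auto
  qed (simp add: glue_outside)
qed

lemma glue_cong:
  assumes "\<And>t. t \<notin> inner \<Longrightarrow> c t = d t" "\<And>i. i < n \<Longrightarrow> m i = m' i"
  shows "glue c m = glue d m'"
proof
  fix t
  show "glue c m t = glue d m' t"
  proof (cases "t \<in> inner")
    case True
    then obtain i r k where i: "i < n" "r \<in> {a i<..<b i}" "t = r + of_int k" by (rule inner_cases)
    have "c (a i) = d (a i)" "c (b i) = d (b i)"
      using assms(1) end_points_not_inner[OF i(1), of 0] by auto
    then show ?thesis using assms(2)[OF i(1)] unfolding i(3) glue_inside[OF i(1,2)] by simp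
  qed (simp add: glue_outside assms)
qed

end

section \<open>The algebra of the moves\<close>

text \<open>
  The relation of a crossing between a strand with labels \<open>a\<close>, \<open>a'\<close> before and behind it and a
  strand with labels \<open>b\<close>, \<open>b'\<close>.  The first strand runs from bottom left to top right iff
  \<open>\<sigma>\<close>.  The kinds \<open>k\<close> and \<open>k'\<close> are those of the crossing with the first and the second strand
  in that position; the sign of an even crossing depends on this.
\<close>

definition xing :: "('a, 'b) monoid_scheme \<Rightarrow> 'a \<Rightarrow> 'a \<Rightarrow> 'a \<Rightarrow> crossing_kind \<Rightarrow> crossing_kind \<Rightarrow>
    bool \<Rightarrow> 'a \<Rightarrow> 'a \<Rightarrow> 'a \<Rightarrow> 'a \<Rightarrow> bool" where
  "xing G s q h k k' \<sigma> a a' b b' \<longleftrightarrow>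
     (if \<sigma> then crossing_rel G s q h k a b b' a' else crossing_rel G s q h k' b a a' b')"

lemma xing_swap: "xing G s q h k k' \<sigma> a a' b b' \<longleftrightarrow> xing G s q h k' k (\<not> \<sigma>) b b' a a'"
  by (simp add: xing_def)

abbreviation "over_under \<equiv> (EvenPositive, EvenNegative)"

inductive kinds_match :: "crossing_kind \<Rightarrow> crossing_kind \<Rightarrow> bool" where
  "kinds_match Virtual Virtual"
| "kinds_match OddClassical OddClassical"
| "kinds_match EvenPositive EvenNegative"
| "kinds_match EvenNegative EvenPositive"

context group
begin

text \<open>
  What happens to the label of a strand as it passes a crossing.  It is conjugated by \<open>q\<close>, \<open>\<theta>\<close>
  or \<open>s\<close> at a virtual crossing, an odd crossing, or on the over strand of an even one, with
  exponent 1 or -1 according to the side from which it meets the other strand.  On the under strand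
  of an even crossing, \<open>under\<close> gives the new label in terms of the label \<open>a\<close> of the over strand
  before the crossing.
\<close>

definition tw :: "bool \<Rightarrow> 'a \<Rightarrow> 'a \<Rightarrow> 'a" where
  "tw \<sigma> g x = (if \<sigma> then g \<otimes> x \<otimes> inv g else inv g \<otimes> x \<otimes> g)"

definition under :: "'a \<Rightarrow> bool \<Rightarrow> 'a \<Rightarrow> 'a \<Rightarrow> 'a" where
  "under s \<sigma> a b = (if \<sigma> then a \<otimes> b \<otimes> s \<otimes> inv a \<otimes> inv s else inv s \<otimes> inv a \<otimes> s \<otimes> b \<otimes> a)"

text \<open>
  With associativity and the rule for inverses of products, these rules bring each word to its
  reduced form, so that the simplifier decides equations that hold in free groups.
\<close>

lemma cancel:
  "x \<in> carrier G \<Longrightarrow> y \<in> carrier G \<Longrightarrow> x \<otimes> (inv x \<otimes> y) = y"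
  "x \<in> carrier G \<Longrightarrow> y \<in> carrier G \<Longrightarrow> inv x \<otimes> (x \<otimes> y) = y"
  by (simp_all add: m_assoc[symmetric])

lemma left_cancel:
  "x \<in> carrier G \<Longrightarrow> y \<in> carrier G \<Longrightarrow> z \<in> carrier G \<Longrightarrow> x \<otimes> y = x \<otimes> z \<longleftrightarrow> y = z"
  by (metis cancel(2))

lemmas word_simps = m_assoc inv_mult_group cancel

lemma tw_closed [simp]: "g \<in> carrier G \<Longrightarrow> x \<in> carrier G \<Longrightarrow> tw \<sigma> g x \<in> carrier G"
  by (simp add: tw_def)

lemma under_closed [simp]:
  "s \<in> carrier G \<Longrightarrow> x \<in> carrier G \<Longrightarrow> y \<in> carrier G \<Longrightarrow> under s \<sigma> x y \<in> carrier G"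
  by (simp add: under_def)

lemma tw_inverse [simp]:
  "g \<in> carrier G \<Longrightarrow> x \<in> carrier G \<Longrightarrow> tw (\<not> \<sigma>) g (tw \<sigma> g x) = x"
  "g \<in> carrier G \<Longrightarrow> x \<in> carrier G \<Longrightarrow> tw \<sigma> g (tw (\<not> \<sigma>) g x) = x"
  by (auto simp: tw_def word_simps)

lemma tw_commute:
  "g \<in> carrier G \<Longrightarrow> x \<in> carrier G \<Longrightarrow> tw \<sigma> g (tw \<tau> g x) = tw \<tau> g (tw \<sigma> g x)"
  by (auto simp: tw_def word_simps)

lemma tw_hom:
  assumes "g \<in> carrier G" shows "tw \<sigma> g \<in> hom G G"
  using assms by (auto simp: hom_def tw_def word_simps)

lemma tw_fixed:
  assumes "g \<in> carrier G" "x \<in> carrier G" "g \<otimes> x = x \<otimes> g" shows "tw \<sigma> g x = x"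
proof -
  have "tw True g x = x" using assms by (simp add: tw_def m_assoc)
  then show ?thesis using tw_inverse(1)[OF assms(1,2), of True] by (cases \<sigma>) auto
qed

text \<open>
  Conjugation by one of the parameters is an automorphism that fixes all three of them.
\<close>

lemma xing_tw:
  assumes com: "commuting G s q h" and g: "g \<in> {s, q, h}"
    and x: "xing G s q h k k' \<sigma> a a' b b'"
    and "a \<in> carrier G" "a' \<in> carrier G" "b \<in> carrier G" "b' \<in> carrier G"
  shows "xing G s q h k k' \<sigma> (tw \<tau> g a) (tw \<tau> g a') (tw \<tau> g b) (tw \<tau> g b')"
proof -
  have gc: "g \<in> carrier G" using com g by (auto simp: commuting_def)
  have fix1: "tw \<tau> g s = s" "tw \<tau> g q = q" "tw \<tau> g h = h"
    using com g by (auto simp: commuting_def intro!: tw_fixed)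
  show ?thesis
    using crossing_rel_hom[OF is_group is_group tw_hom[OF gc] com, of _ _ _ _ _ \<tau>] x assms(4-)
    unfolding fix1 by (auto simp: xing_def)
qed

lemma xing_virtual:
  assumes "commuting G s q h" "a \<in> carrier G" "b \<in> carrier G"
  shows "xing G s q h Virtual Virtual \<sigma> a a' b b' \<longleftrightarrow> a' = tw \<sigma> q a \<and> b' = tw (\<not> \<sigma>) q b"
  using assms by (auto simp: xing_def tw_def)

lemma xing_odd:
  assumes "commuting G s q h" "a \<in> carrier G" "b \<in> carrier G"
  shows "xing G s q h OddClassical OddClassical \<sigma> a a' b b' \<longleftrightarrow> a' = tw \<sigma> h a \<and> b' = tw (\<not> \<sigma>) h b"
  using assms by (auto simp: xing_def tw_def)

lemma xing_even:
  assumes "commuting G s q h" "a \<in> carrier G" "b \<in> carrier G"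
  shows "xing G s q h EvenPositive EvenNegative \<sigma> a a' b b' \<longleftrightarrow>
    a' = tw \<sigma> s a \<and> b' = under s \<sigma> a b"
  using assms by (auto simp: xing_def tw_def under_def)

text \<open>
  The strand crosses itself, with value \<open>m\<close> on the loop.  If the crossing is virtual or odd, or
  the first passage is the upper one, then \<open>m\<close> is a conjugate of \<open>a\<close>.  If the first passage is
  the lower one, then \<open>m\<close> occurs on both sides of its equation, and cancelling it leaves the
  same conjugate.
\<close>

lemma kink:
  assumes com: "commuting G s q h" and k: "kinds_match k k'"
    and a: "a \<in> carrier G"
  shows "\<exists>v\<in>carrier G. \<forall>m\<in>carrier G. \<forall>b\<in>carrier G. xing G s q h k k' \<sigma> a m m b \<longleftrightarrow> m = v \<and> b = a"
proof -
  have sqh: "s \<in> carrier G" "q \<in> carrier G" "h \<in> carrier G" using com by (auto simp: commuting_def)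
  show ?thesis using k
  proof cases
    case 1
    show ?thesis
      using sqh a tw_inverse[of q a \<sigma>]
      by (intro bexI[of _ "tw \<sigma> q a"]) (auto simp: 1 xing_virtual[OF com])
  next
    case 2
    show ?thesis
      using sqh a tw_inverse[of h a \<sigma>]
      by (intro bexI[of _ "tw \<sigma> h a"]) (auto simp: 2 xing_odd[OF com])
  next
    case 3
    show ?thesis
      using sqh a
      by (intro bexI[of _ "tw \<sigma> s a"])
        (auto simp: 3 xing_even[OF com] tw_def under_def word_simps)
  next
    case 4
    have u: "under s (\<not> \<sigma>) m a = m \<longleftrightarrow> m = tw \<sigma> s a" if m: "m \<in> carrier G" for m
    proof (cases \<sigma>)
      case True
      have "inv s \<otimes> inv m \<otimes> s \<otimes> a \<otimes> m = m \<longleftrightarrow> inv s \<otimes> inv m \<otimes> s \<otimes> a = \<one>"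
        using m a sqh right_cancel[of m "inv s \<otimes> inv m \<otimes> s \<otimes> a" \<one>] by simp
      also have "\<dots> \<longleftrightarrow> (m \<otimes> s) \<otimes> (inv s \<otimes> inv m \<otimes> s \<otimes> a) = (m \<otimes> s) \<otimes> \<one>"
        using m a sqh by (subst left_cancel) auto
      also have "\<dots> \<longleftrightarrow> s \<otimes> a = m \<otimes> s"
        using m a sqh by (simp add: word_simps)
      also have "\<dots> \<longleftrightarrow> m = tw \<sigma> s a"
        using m a sqh True by (simp add: tw_def inv_solve_right)
      finally show ?thesis using True by (simp add: under_def)
    next
      case False
      have "m \<otimes> a \<otimes> s \<otimes> inv m \<otimes> inv s = m \<longleftrightarrow> m \<otimes> (a \<otimes> s \<otimes> inv m \<otimes> inv s) = m \<otimes> \<one>"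
        using m a sqh by (simp add: m_assoc)
      also have "\<dots> \<longleftrightarrow> a \<otimes> s \<otimes> inv m \<otimes> inv s = \<one>"
        using m a sqh by (subst left_cancel) auto
      also have "\<dots> \<longleftrightarrow> (a \<otimes> s \<otimes> inv m \<otimes> inv s) \<otimes> (s \<otimes> m) = \<one> \<otimes> (s \<otimes> m)"
        using m a sqh by (subst right_cancel) auto
      also have "\<dots> \<longleftrightarrow> a \<otimes> s = s \<otimes> m"
        using m a sqh by (simp add: word_simps)
      also have "\<dots> \<longleftrightarrow> m = tw \<sigma> s a"
        using m a sqh False by (auto simp: tw_def word_simps)
      finally show ?thesis using False by (simp add: under_def)
    qed
    have "m = under s (\<not> \<sigma>) m a \<longleftrightarrow> m = tw \<sigma> s a" if "m \<in> carrier G" for m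
      using u[OF that] by metis
    then show ?thesis
      using sqh a tw_inverse[of s a \<sigma>]
      by (intro bexI[of _ "tw \<sigma> s a"])
        (auto simp: 4 xing_swap[of _ _ _ _ EvenNegative] xing_even[OF com])
  qed
qed

text \<open>
  At the second crossing the over strand, or both strands, are conjugated back.  With the over
  strand restored, the word of the second crossing cancels that of the first on the under strand.
\<close>

lemma bigon_parallel:
  assumes com: "commuting G s q h" and k: "kinds_match k k'"
    and x: "x \<in> carrier G" "y \<in> carrier G"
  shows "\<exists>v\<in>carrier G. \<exists>w\<in>carrier G. \<forall>m\<in>carrier G. \<forall>m'\<in>carrier G. \<forall>x'\<in>carrier G. \<forall>y'\<in>carrier G.
    xing G s q h k k' \<sigma> x m y m' \<and> xing G s q h k k' (\<not> \<sigma>) m x' m' y' \<longleftrightarrow>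
    m = v \<and> m' = w \<and> x' = x \<and> y' = y"
proof -
  have sqh: "s \<in> carrier G" "q \<in> carrier G" "h \<in> carrier G" using com by (auto simp: commuting_def)
  have u: "under s (\<not> \<sigma>) (tw \<sigma> s a) (under s \<sigma> a b) = b"
    if "a \<in> carrier G" "b \<in> carrier G" for a b \<sigma>
    using that sqh by (auto simp: under_def tw_def word_simps)
  show ?thesis using k
  proof cases
    case 1
    show ?thesis
      by (rule bexI[of _ "tw \<sigma> q x"], rule bexI[of _ "tw (\<not> \<sigma>) q y"])
        (use sqh x tw_inverse[of q] in \<open>auto simp: 1 xing_virtual[OF com]\<close>)
  next
    case 2
    show ?thesis
      by (rule bexI[of _ "tw \<sigma> h x"], rule bexI[of _ "tw (\<not> \<sigma>) h y"])
        (use sqh x tw_inverse[of h] in \<open>auto simp: 2 xing_odd[OF com]\<close>)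
  next
    case 3
    show ?thesis
      by (rule bexI[of _ "tw \<sigma> s x"], rule bexI[of _ "under s \<sigma> x y"])
        (use sqh x tw_inverse[of s] u in \<open>auto simp: 3 xing_even[OF com]\<close>)
  next
    case 4
    show ?thesis
      by (rule bexI[of _ "under s (\<not> \<sigma>) y x"], rule bexI[of _ "tw (\<not> \<sigma>) s y"])
        (use sqh x tw_inverse[of s] u[of y x "\<not> \<sigma>"] in \<open>auto simp: 4 xing_swap[of _ _ _ _ EvenNegative] xing_even[OF com]\<close>)
  qed
qed

lemma bigon_antiparallel:
  assumes com: "commuting G s q h" and k: "kinds_match k k'"
    and x: "x \<in> carrier G" "y \<in> carrier G"
  shows "\<exists>v\<in>carrier G. \<exists>w\<in>carrier G. \<forall>m\<in>carrier G. \<forall>m'\<in>carrier G. \<forall>x'\<in>carrier G. \<forall>y'\<in>carrier G.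
    xing G s q h k k' \<sigma> x m m' y' \<and> xing G s q h k k' (\<not> \<sigma>) m x' y m' \<longleftrightarrow>
    m = v \<and> m' = w \<and> x' = x \<and> y' = y"
proof -
  have sqh: "s \<in> carrier G" "q \<in> carrier G" "h \<in> carrier G" using com by (auto simp: commuting_def)
  have u: "under s \<sigma> a (under s (\<not> \<sigma>) (tw \<sigma> s a) b) = b"
    if "a \<in> carrier G" "b \<in> carrier G" for a b \<sigma>
    using that sqh by (auto simp: under_def tw_def word_simps)
  show ?thesis using k
  proof cases
    case 1
    show ?thesis
      by (rule bexI[of _ "tw \<sigma> q x"], rule bexI[of _ "tw \<sigma> q y"])
        (use sqh x tw_inverse[of q] in \<open>auto simp: 1 xing_virtual[OF com]\<close>)
  next
    case 2
    show ?thesis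
      by (rule bexI[of _ "tw \<sigma> h x"], rule bexI[of _ "tw \<sigma> h y"])
        (use sqh x tw_inverse[of h] in \<open>auto simp: 2 xing_odd[OF com]\<close>)
  next
    case 3
    show ?thesis
      by (rule bexI[of _ "tw \<sigma> s x"], rule bexI[of _ "under s (\<not> \<sigma>) (tw \<sigma> s x) y"])
        (use sqh x tw_inverse[of s] u in \<open>auto simp: 3 xing_even[OF com]\<close>)
  next
    case 4
    show ?thesis
      by (rule bexI[of _ "under s (\<not> \<sigma>) (tw \<sigma> s y) x"], rule bexI[of _ "tw \<sigma> s y"])
        (use sqh x tw_inverse[of s] u in \<open>auto simp: 4 xing_swap[of _ _ _ _ EvenNegative] xing_even[OF com]\<close>)
  qed
qed

text \<open>
  The relations of three strands that cross pairwise, with values \<open>x\<close>, \<open>m\<close>, \<open>y\<close> before, between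
  and behind the two crossings on each strand.  The flags tell the order of these: \<open>Fi\<close> and
  \<open>Fj\<close> say that \<open>i\<close> meets \<open>j\<close> first and \<open>j\<close> meets \<open>i\<close> first, and \<open>Fk\<close> that \<open>k\<close> meets \<open>i\<close> first.
  A third move negates all three.
\<close>

definition triple :: "'a \<Rightarrow> 'a \<Rightarrow> 'a \<Rightarrow> crossing_kind \<times> crossing_kind \<Rightarrow> crossing_kind \<times> crossing_kind \<Rightarrow>
    crossing_kind \<times> crossing_kind \<Rightarrow> bool \<Rightarrow> bool \<Rightarrow> bool \<Rightarrow> bool \<Rightarrow> bool \<Rightarrow> bool \<Rightarrow>
    'a \<Rightarrow> 'a \<Rightarrow> 'a \<Rightarrow> 'a \<Rightarrow> 'a \<Rightarrow> 'a \<Rightarrow> 'a \<Rightarrow> 'a \<Rightarrow> 'a \<Rightarrow> bool" where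
  "triple s q h kij kik kjk \<sigma>ij \<sigma>ik \<sigma>jk Fi Fj Fk xi xj xk mi mj mk yi yj yk \<longleftrightarrow>
     xing G s q h (fst kij) (snd kij) \<sigma>ij (if Fi then xi else mi) (if Fi then mi else yi)
       (if Fj then xj else mj) (if Fj then mj else yj) \<and>
     xing G s q h (fst kik) (snd kik) \<sigma>ik (if Fi then mi else xi) (if Fi then yi else mi)
       (if Fk then xk else mk) (if Fk then mk else yk) \<and>
     xing G s q h (fst kjk) (snd kjk) \<sigma>jk (if Fj then mj else xj) (if Fj then yj else mj)
       (if Fk then mk else xk) (if Fk then yk else mk)"

text \<open>
  The strand \<open>i\<close> conjugates the others by powers of \<open>g\<close> and is itself conjugated by a power of
  \<open>g\<close> that does not depend on the order of its crossings.  The third move conjugates the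
  labels of \<open>j\<close> at the crossing of \<open>j\<close> and \<open>k\<close> by \<open>g\<close> if \<open>Fj = \<sigma>ij\<close> and by its inverse otherwise,
  and likewise those of \<open>k\<close>; the condition on the flags says that these exponents are equal.
\<close>

lemma triple_conj:
  assumes com: "commuting G s q h" and g: "g \<in> {q, h}"
    and ij: "\<And>\<sigma> a a' b b'. a \<in> carrier G \<Longrightarrow> b \<in> carrier G \<Longrightarrow>
      xing G s q h (fst kij) (snd kij) \<sigma> a a' b b' \<longleftrightarrow> a' = tw \<sigma> g a \<and> b' = tw (\<not> \<sigma>) g b"
    and ik: "\<And>\<sigma> a a' b b'. a \<in> carrier G \<Longrightarrow> b \<in> carrier G \<Longrightarrow>
      xing G s q h (fst kik) (snd kik) \<sigma> a a' b b' \<longleftrightarrow> a' = tw \<sigma> g a \<and> b' = tw (\<not> \<sigma>) g b"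
    and xs: "xi \<in> carrier G" "xj \<in> carrier G" "xk \<in> carrier G"
    and ys: "yi \<in> carrier G" "yj \<in> carrier G" "yk \<in> carrier G"
    and ms: "mi \<in> carrier G" "mj \<in> carrier G" "mk \<in> carrier G"
    and t: "triple s q h kij kik kjk \<sigma>ij \<sigma>ik \<sigma>jk Fi Fj Fk xi xj xk mi mj mk yi yj yk"
  shows "(Fj = \<sigma>ij) = (Fk = \<sigma>ik) \<Longrightarrow> \<exists>mi'\<in>carrier G. \<exists>mj'\<in>carrier G. \<exists>mk'\<in>carrier G.
      triple s q h kij kik kjk \<sigma>ij \<sigma>ik \<sigma>jk (\<not> Fi) (\<not> Fj) (\<not> Fk) xi xj xk mi' mj' mk' yi yj yk"
    and "mi = tw (if Fi then \<sigma>ij else \<sigma>ik) g xi"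
    and "mj = (if Fj then tw (\<not> \<sigma>ij) g xj else tw \<sigma>ij g yj)"
    and "mk = (if Fk then tw (\<not> \<sigma>ik) g xk else tw \<sigma>ik g yk)"
proof -
  have gc: "g \<in> carrier G" using com g by (auto simp: commuting_def)
  note inv = tw_inverse[OF gc]
  have i: "mi = tw (if Fi then \<sigma>ij else \<sigma>ik) g xi" "yi = tw (if Fi then \<sigma>ik else \<sigma>ij) g mi"
    and j: "if Fj then mj = tw (\<not> \<sigma>ij) g xj else yj = tw (\<not> \<sigma>ij) g mj"
    and k: "if Fk then mk = tw (\<not> \<sigma>ik) g xk else yk = tw (\<not> \<sigma>ik) g mk"
    using t xs ms ij ik unfolding triple_def by (auto split: if_splits)
  show "mi = tw (if Fi then \<sigma>ij else \<sigma>ik) g xi" by (rule i)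
  show j': "mj = (if Fj then tw (\<not> \<sigma>ij) g xj else tw \<sigma>ij g yj)"
    using j inv(2)[OF ms(2), of \<sigma>ij] by (auto split: if_splits)
  show k': "mk = (if Fk then tw (\<not> \<sigma>ik) g xk else tw \<sigma>ik g yk)"
    using k inv(2)[OF ms(3), of \<sigma>ik] by (auto split: if_splits)
  assume T: "(Fj = \<sigma>ij) = (Fk = \<sigma>ik)"
  define mi' where "mi' = tw (if Fi then \<sigma>ik else \<sigma>ij) g xi"
  define mj' where "mj' = (if Fj then tw \<sigma>ij g yj else tw (\<not> \<sigma>ij) g xj)"
  define mk' where "mk' = (if Fk then tw \<sigma>ik g yk else tw (\<not> \<sigma>ik) g xk)"
  have m': "mi' \<in> carrier G" "mj' \<in> carrier G" "mk' \<in> carrier G"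
    using gc xs ys by (simp_all add: mi'_def mj'_def mk'_def)
  have yi: "yi = tw (if Fi then \<sigma>ij else \<sigma>ik) g mi'"
    unfolding mi'_def i using tw_commute[OF gc xs(1)] by auto
  have jk: "xing G s q h (fst kjk) (snd kjk) \<sigma>jk (if Fj then mj else xj) (if Fj then yj else mj)
       (if Fk then mk else xk) (if Fk then yk else mk)"
    using t by (simp add: triple_def)
  have "xing G s q h (fst kjk) (snd kjk) \<sigma>jk (if Fj then xj else mj') (if Fj then mj' else yj)
       (if Fk then xk else mk') (if Fk then mk' else yk)"
  proof -
    let ?t = "tw (Fj = \<sigma>ij) g"
    have "xing G s q h (fst kjk) (snd kjk) \<sigma>jk (?t (if Fj then mj else xj)) (?t (if Fj then yj else mj))
       (?t (if Fk then mk else xk)) (?t (if Fk then yk else mk))"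
      by (rule xing_tw[OF com _ jk]) (use g xs ys ms in auto)
    moreover have "?t (if Fj then mj else xj) = (if Fj then xj else mj')"
      "?t (if Fj then yj else mj) = (if Fj then mj' else yj)"
      using inv xs ys by (auto simp: j' mj'_def)
    moreover have "?t (if Fk then mk else xk) = (if Fk then xk else mk')"
      "?t (if Fk then yk else mk) = (if Fk then mk' else yk)"
      unfolding T using inv xs ys by (auto simp: k' mk'_def)
    ultimately show ?thesis by simp
  qed
  moreover have "xing G s q h (fst kij) (snd kij) \<sigma>ij (if Fi then mi' else xi) (if Fi then yi else mi')
       (if Fj then mj' else xj) (if Fj then yj else mj')"
    using ij xs m' yi inv ys by (auto simp: mi'_def mj'_def)
  moreover have "xing G s q h (fst kik) (snd kik) \<sigma>ik (if Fi then xi else mi') (if Fi then mi' else yi)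
       (if Fk then mk' else xk) (if Fk then yk else mk')"
    using ik xs m' yi inv ys by (auto simp: mi'_def mk'_def)
  ultimately have "triple s q h kij kik kjk \<sigma>ij \<sigma>ik \<sigma>jk (\<not> Fi) (\<not> Fj) (\<not> Fk) xi xj xk mi' mj' mk' yi yj yk"
    unfolding triple_def by (cases Fi; cases Fj; cases Fk) simp_all
  then show "\<exists>mi'\<in>carrier G. \<exists>mj'\<in>carrier G. \<exists>mk'\<in>carrier G.
      triple s q h kij kik kjk \<sigma>ij \<sigma>ik \<sigma>jk (\<not> Fi) (\<not> Fj) (\<not> Fk) xi xj xk mi' mj' mk' yi yj yk"
    using m' by blast
qed

text \<open>
  The strand \<open>i\<close> lies above \<open>j\<close>, and \<open>j\<close> above \<open>k\<close>.  Labels of an over strand do not depend on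
  the strands below, so the values are computed from top to bottom.
\<close>

lemma triple_even_middle:
  assumes com: "commuting G s q h"
    and xs: "xi \<in> carrier G" "xj \<in> carrier G" "xk \<in> carrier G"
    and ms: "mi \<in> carrier G" "mj \<in> carrier G" "mk \<in> carrier G"
    and t: "triple s q h over_under over_under over_under \<sigma>ij \<sigma>ik \<sigma>jk Fi Fj Fk
      xi xj xk mi mj mk yi yj yk"
  shows "mi = tw (if Fi then \<sigma>ij else \<sigma>ik) s xi"
    and "mj = (if Fj then under s \<sigma>ij (if Fi then xi else mi) xj else tw \<sigma>jk s xj)"
    and "mk = (if Fk then under s \<sigma>ik (if Fi then mi else xi) xk
      else under s \<sigma>jk (if Fj then mj else xj) xk)"
  using t xs ms unfolding triple_def by (auto simp: xing_even[OF com] split: if_splits)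

lemma triple_even:
  assumes com: "commuting G s q h"
    and xs: "xi \<in> carrier G" "xj \<in> carrier G" "xk \<in> carrier G"
    and ms: "mi \<in> carrier G" "mj \<in> carrier G" "mk \<in> carrier G"
    and t: "triple s q h over_under over_under over_under \<sigma>ij \<sigma>ik \<sigma>jk Fi Fj Fk
      xi xj xk mi mj mk yi yj yk"
    and T: "(Fj = \<sigma>ij) = (Fk = \<sigma>ik)" "(Fi = \<sigma>ij) = (Fk = \<sigma>jk)"
  shows "\<exists>mi'\<in>carrier G. \<exists>mj'\<in>carrier G. \<exists>mk'\<in>carrier G.
    triple s q h over_under over_under over_under \<sigma>ij \<sigma>ik \<sigma>jk (\<not> Fi) (\<not> Fj) (\<not> Fk)
      xi xj xk mi' mj' mk' yi yj yk"
proof -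
  have s: "s \<in> carrier G" using com by (auto simp: commuting_def)
  note m = triple_even_middle[OF com xs ms t]
  \<comment> \<open>the values forced by \<open>triple_even_middle\<close> for the reversed order of crossings\<close>
  define mi' where "mi' = tw (if Fi then \<sigma>ik else \<sigma>ij) s xi"
  define mj' where "mj' = (if Fj then tw \<sigma>jk s xj else under s \<sigma>ij (if Fi then mi' else xi) xj)"
  define mk' where "mk' = (if Fk then under s \<sigma>jk (if Fj then xj else mj') xk
    else under s \<sigma>ik (if Fi then xi else mi') xk)"
  have m': "mi' \<in> carrier G" "mj' \<in> carrier G" "mk' \<in> carrier G"
    using s xs by (simp_all add: mi'_def mj'_def mk'_def)
  have y: "yi = tw (if Fi then \<sigma>ik else \<sigma>ij) s mi"
    "yj = (if Fj then tw \<sigma>jk s mj else under s \<sigma>ij (if Fi then xi else mi) mj)"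
    "yk = (if Fk then under s \<sigma>jk (if Fj then mj else xj) mk
      else under s \<sigma>ik (if Fi then mi else xi) mk)"
    using t xs ms unfolding triple_def by (auto simp: xing_even[OF com] split: if_splits)
  have "triple s q h over_under over_under over_under \<sigma>ij \<sigma>ik \<sigma>jk (\<not> Fi) (\<not> Fj) (\<not> Fk)
      xi xj xk mi' mj' mk' yi yj yk"
    unfolding triple_def fst_conv snd_conv
    using T s xs
    by (cases Fi; cases Fj; cases Fk; cases \<sigma>ij)
      (simp_all add: xing_even[OF com] mi'_def mj'_def mk'_def y m tw_def under_def word_simps)
  then show ?thesis using m' by blast
qed

end

section \<open>Colourings and changes inside a disc\<close>

lemma (in diagram) kinds_match:
  assumes uv: "meets K u v" shows "kinds_match (kind K u v) (kind K v u)"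
proof -
  obtain f where f: "parity_function f" by (rule parity_function_exists)
  have vu: "meets K v u" using uv meets_sym by blast
  show ?thesis
    unfolding kind_eq[OF f uv] kind_eq[OF f vu] classical_meets[OF uv]
    using over_under[OF _ uv] classical_meets[OF uv] by (auto intro: kinds_match.intros)
qed

lemma (in diagram) crossing_ok_iff_xing:
  assumes uv: "meets K u v"
  shows "crossing_ok K G s q h c u v \<and> crossing_ok K G s q h c v u \<longleftrightarrow>
    xing G s q h (kind K u v) (kind K v u) (turn K u v > 0) (c u) (after c u) (c v) (after c v)"
  using turn_nonzero[OF uv] turn_sym[of K u v] by (auto simp: crossing_ok_def xing_def)

text \<open>
  The local form of a colouring: values \<open>x i\<close>, \<open>m i\<close>, \<open>y i\<close> before, between and after the times
  \<open>l1 i < l2 i\<close> on the \<open>i\<close>th strand that satisfy the relations of all crossings at these times,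
  and do not jump at a time without crossing.
\<close>

definition strands_fit :: "virtual_diagram \<Rightarrow> nat \<Rightarrow> (nat \<Rightarrow> real) \<Rightarrow> (nat \<Rightarrow> real) \<Rightarrow>
    ('a, 'b) monoid_scheme \<Rightarrow> 'a \<Rightarrow> 'a \<Rightarrow> 'a \<Rightarrow> (nat \<Rightarrow> 'a) \<Rightarrow> (nat \<Rightarrow> 'a) \<Rightarrow> (nat \<Rightarrow> 'a) \<Rightarrow> bool" where
  "strands_fit L n l1 l2 G s q h x m y \<longleftrightarrow>
     (\<forall>i<n. m i \<in> carrier G \<and> (l1 i \<notin> crossing_times L \<longrightarrow> m i = x i) \<and>
       (l2 i \<notin> crossing_times L \<longrightarrow> m i = y i)) \<and>
     (\<forall>i<n. \<forall>j<n. \<forall>u\<in>{l1 i, l2 i}. \<forall>v\<in>{l1 j, l2 j}. meets L u v \<longrightarrow>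
       xing G s q h (kind L u v) (kind L v u) (turn L u v > 0)
         (if u = l1 i then x i else m i) (if u = l1 i then m i else y i)
         (if v = l1 j then x j else m j) (if v = l1 j then m j else y j))"

definition strands_determined :: "virtual_diagram \<Rightarrow> nat \<Rightarrow> (nat \<Rightarrow> real) \<Rightarrow> (nat \<Rightarrow> real) \<Rightarrow>
    ('a, 'b) monoid_scheme \<Rightarrow> 'a \<Rightarrow> 'a \<Rightarrow> 'a \<Rightarrow> (nat \<Rightarrow> 'a) \<Rightarrow> (nat \<Rightarrow> 'a) \<Rightarrow> bool" where
  "strands_determined L n l1 l2 G s q h x y \<longleftrightarrow>
     (\<forall>m m'. strands_fit L n l1 l2 G s q h x m y \<longrightarrow> strands_fit L n l1 l2 G s q h x m' y \<longrightarrow>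
       (\<forall>i<n. m i = m' i))"

lemma strands_fit_cong:
  assumes "\<And>i. i < n \<Longrightarrow> x i = x' i" "\<And>i. i < n \<Longrightarrow> y i = y' i"
  shows "strands_fit L n l1 l2 G s q h x m y \<longleftrightarrow> strands_fit L n l1 l2 G s q h x' m y'"
  unfolding strands_fit_def
  by (intro arg_cong2[where f="(\<and>)"] all_cong ball_cong imp_cong refl) (simp_all add: assms)

context disc_pair
begin

lemma meets_inner:
  assumes "meets K u v" shows "u \<in> inner \<longleftrightarrow> v \<in> inner"
proof -
  have "curve K u = curve K v" using assms by (simp add: meets_def)
  then show ?thesis using vimage_inner(1) by (metis vimage_eq)
qed

lemma meets_inner_L:
  assumes "meets L u v" shows "u \<in> inner \<longleftrightarrow> v \<in> inner"
proof -
  have "curve L u = curve L v" using assms by (simp add: meets_def)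
  then show ?thesis using vimage_inner(2) by (metis vimage_eq)
qed

lemma meets_outside:
  assumes "u \<notin> inner" shows "meets K u v \<longleftrightarrow> meets L u v"
proof
  assume uv: "meets K u v"
  then have "v \<notin> inner" using meets_inner assms by blast
  then show "meets L u v" using uv curves_agree assms by (simp add: meets_def)
next
  assume uv: "meets L u v"
  then have "v \<notin> inner" using meets_inner_L assms by blast
  then show "meets K u v" using uv curves_agree assms by (simp add: meets_def)
qed

lemma crossing_times_outside: "u \<notin> inner \<Longrightarrow> u \<in> K.X \<longleftrightarrow> u \<in> L.X"
  using meets_outside unfolding crossing_times_def by blast

lemma crossing_time_outer: "u \<in> K.X \<Longrightarrow> u \<notin> inner \<Longrightarrow> u \<notin> outer"
  "u \<in> L.X \<Longrightarrow> u \<notin> inner \<Longrightarrow> u \<notin> outer"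
  using no_crossing_on_boundary by blast+

lemma velocity_outside:
  assumes "t \<notin> outer" shows "velocity L t = velocity K t"
proof -
  have "(curve L has_vector_derivative velocity K t) (at t)"
  proof (rule has_vector_derivative_transform_within_open[OF K.curve_derivative open_complement_outer])
    show "curve K u = curve L u" if "u \<in> - outer" for u
    proof -
      have "u \<notin> inner" using that inner_outer by blast
      then show ?thesis using curves_agree by simp
    qed
  qed (use assms in simp)
  from vector_derivative_at[OF this] show ?thesis by (simp add: velocity_def[of L])
qed

lemma turn_outside: "u \<notin> outer \<Longrightarrow> v \<notin> outer \<Longrightarrow> turn L u v = turn K u v"
  by (simp add: turn_def velocity_outside)

lemma over_outside: "t \<notin> outer \<Longrightarrow> t \<in> over K \<longleftrightarrow> t \<in> over L"
  using change vimage_outer(1) by (auto simp: local_change_def)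

lemma virt_outside:
  assumes "t \<notin> outer" shows "curve K t \<in> virt K \<longleftrightarrow> curve L t \<in> virt L"
proof -
  have "curve L t = curve K t" "curve K t \<notin> D"
    using assms curves_agree inner_outer vimage_outer(1) by auto
  moreover have "virt K - D = virt L - D" using change by (simp add: local_change_def)
  ultimately show ?thesis by auto
qed

lemma classical_outside: "t \<notin> outer \<Longrightarrow> t \<in> K.C \<longleftrightarrow> t \<in> L.C"
  using crossing_times_outside[of t] virt_outside[of t] inner_outer
  by (auto simp: classical_times_def)

end

context disc_change
begin

text \<open>
  Gluing works for parity functions as it does for colourings.  The value of the parity function
  of \<open>K\<close> at the end of a strand fits because the strand has, up to an even number, as many
  classical passages in \<open>L\<close> as in \<open>K\<close>.
\<close>

lemma parity_functions:
  obtains f g where "K.parity_function f" "L.parity_function g" "\<And>t. t \<notin> inner \<Longrightarrow> g t = f t"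
    "\<And>i. i < n \<Longrightarrow> f (k1 i) = f (a i)" "\<And>i. i < n \<Longrightarrow> f (k2 i) = (f (a i) \<noteq> (k1 i \<in> K.C))"
    "\<And>i. i < n \<Longrightarrow> g (l1 i) = f (a i)" "\<And>i. i < n \<Longrightarrow> g (l2 i) = (f (a i) \<noteq> (l1 i \<in> L.C))"
proof -
  interpret swap: disc_change L K D n a b l1 l2 k1 k2 by (rule disc_change_swap)
  obtain f where f: "K.parity_function f" by (rule K.parity_function_exists)
  then have fs: "step_function K.C f" and flip: "\<And>t. t \<in> K.C \<Longrightarrow> after f t = (\<not> f t)"
    by (auto simp: K.parity_function_def)
  have f_after: "after f t = (f t \<noteq> (t \<in> K.C))" for t
    using flip[of t] step_functionD(5)[OF fs, of t] by auto
  have f1: "f (k1 i) = f (a i)" "f (k2 i) = (f (a i) \<noteq> (k1 i \<in> K.C))"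
    "f (b i) = ((f (a i) \<noteq> (k1 i \<in> K.C)) \<noteq> (k2 i \<in> K.C))" if i: "i < n" for i
  proof -
    have X: "K.C \<inter> {a i<..<b i} \<subseteq> {k1 i, k2 i}" "a i \<notin> K.C"
      using K_times[OF i] K.classical_subset end_points_not_crossing(1)[OF i, of 0] by auto
    note sv = swap.strand_values[OF fs i X]
    show 1: "f (k1 i) = f (a i)" using sv(1)[of "k1 i"] K_points[OF i] by simp
    show 2: "f (k2 i) = (f (a i) \<noteq> (k1 i \<in> K.C))" using sv(4) f_after[of "k1 i"] 1 by simp
    show "f (b i) = ((f (a i) \<noteq> (k1 i \<in> K.C)) \<noteq> (k2 i \<in> K.C))"
      using sv(5) f_after[of "k2 i"] 2 by simp
  qed
  define m where "m i = (f (a i) \<noteq> (l1 i \<in> L.C))" for i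
  have fb: "f (b i) = (m i \<noteq> (l2 i \<in> L.C))" if "i < n" for i
    using f1(3)[OF that] classical_passages[OF that] by (auto simp: m_def)
  define g where "g = glue f m"
  have gs: "step_function L.C g"
    unfolding g_def
  proof (rule step_function_glue[OF fs])
    show "b i + of_int k \<notin> K.C" if "i < n" for i k
      using end_points_not_crossing(2)[OF that] K.classical_subset by blast
  qed (use classical_outside fb in \<open>auto simp: m_def\<close>)
  have fper: "f (t + 1) = f t" for t using step_functionD(1)[OF fs] .
  have gper: "g (t + 1) = g t" for t using step_functionD(1)[OF gs] .
  have "after g t = (\<not> g t)" if t: "t \<in> L.C" for t
  proof (cases "t \<in> inner")
    case True
    then obtain i r k where i: "i < n" "r \<in> {a i<..<b i}" "t = r + of_int k" by (rule inner_cases)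
    have r: "r \<in> L.C" using t i(3) by simp
    then have "r = l1 i \<or> r = l2 i" using L_times[OF i(1)] i(2) L.classical_subset by blast
    then have "after g r = (\<not> g r)"
      using glue_at[of f i m, OF fper i(1)] fb[OF i(1)] r unfolding g_def[symmetric] by (auto simp: m_def)
    then show ?thesis
      using after_shift[of g r k, OF gper] shift_int_eq[of g r k, OF gper] i(3) by simp
  next
    case False
    then have "t \<notin> outer" using crossing_time_outer(2) t L.classical_subset by blast
    then show ?thesis
      using after_glue_outside[of t f m] glue_outside[OF False, of f m] flip classical_outside t
      unfolding g_def by simp
  qed
  then have g: "L.parity_function g" using gs by (simp add: L.parity_function_def)
  show ?thesis
  proof (rule that[OF f g])
    show "g t = f t" if "t \<notin> inner" for t
      unfolding g_def by (rule glue_outside[OF that])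
    show "g (l1 i) = f (a i)" "g (l2 i) = (f (a i) \<noteq> (l1 i \<in> L.C))" if "i < n" for i
      using glue_at(1,2)[of f i m, OF fper that] unfolding g_def m_def by auto
  qed (use f1 in auto)
qed

lemma kind_outside:
  assumes uv: "meets K u v" and u: "u \<notin> inner" shows "kind L u v = kind K u v"
proof -
  obtain f g where f: "K.parity_function f" and g: "L.parity_function g"
    and fg: "\<And>t. t \<notin> inner \<Longrightarrow> g t = f t"
    by (rule parity_functions) blast
  have v: "v \<notin> inner" using meets_inner[OF uv] u by blast
  have uv': "meets L u v" using meets_outside[OF u] uv by blast
  have "u \<notin> outer" using crossing_time_outer(1)[OF meets_crossing_time[OF uv] u] .
  then show ?thesis
    unfolding K.kind_eq[OF f uv] L.kind_eq[OF g uv'] fg[OF u] fg[OF v]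
    using classical_outside over_outside by simp
qed

lemma colouring_glue:
  assumes col: "colouring K G s q h c"
    and fit: "strands_fit L n l1 l2 G s q h (\<lambda>i. c (a i)) m (\<lambda>i. c (b i))"
  shows "colouring L G s q h (glue c m)"
proof -
  have step: "step_function K.X c" and car: "\<And>t. c t \<in> carrier G" and com: "commuting G s q h"
    and rel: "\<And>u v. meets K u v \<Longrightarrow> crossing_ok K G s q h c u v"
    using col by (auto simp: colouring_def)
  have cper: "c (t + 1) = c t" for t using step_functionD(1)[OF step] .
  have m: "m i \<in> carrier G" "l1 i \<notin> L.X \<Longrightarrow> m i = c (a i)" "l2 i \<notin> L.X \<Longrightarrow> m i = c (b i)"
    if "i < n" for i
    using fit that by (auto simp: strands_fit_def)
  have gstep: "step_function L.X (glue c m)"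
  proof (rule step_function_glue[OF step])
    show "b i + of_int k \<notin> K.X" if "i < n" for i k
      using end_points_not_crossing(2)[OF that] .
    show "t \<in> L.X" if "t \<notin> outer" "t \<in> K.X" for t
      using crossing_times_outside[of t] inner_outer that by blast
  qed (use m in auto)
  have gcar: "glue c m t \<in> carrier G" for t
  proof (cases "t \<in> inner")
    case True
    then obtain i r k where i: "i < n" "r \<in> {a i<..<b i}" "t = r + of_int k" by (rule inner_cases)
    show ?thesis unfolding i(3) glue_inside[OF i(1,2)] using car m(1)[OF i(1)] by simp
  next
    case False
    show ?thesis unfolding glue_outside[OF False] by (rule car)
  qed
  have "crossing_ok L G s q h (glue c m) u v" if uv: "meets L u v" for u v
  proof (cases "u \<in> inner")
    case True
    then obtain i r k where i: "i < n" "r \<in> {a i<..<b i}" "u = r + of_int k" by (rule inner_cases)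
    have "v \<in> inner" using meets_inner_L[OF uv] True by simp
    then obtain j r' l where j: "j < n" "r' \<in> {a j<..<b j}" "v = r' + of_int l" by (rule inner_cases)
    have rr: "meets L r r'" using uv i(3) j(3) by simp
    then have "meets L r' r" using meets_sym by blast
    then have pts: "r \<in> {l1 i, l2 i}" "r' \<in> {l1 j, l2 j}"
      using L_times[OF i(1)] L_times[OF j(1)] i(2) j(2) rr meets_crossing_time by blast+
    have "l1 i < l2 i" "l1 j < l2 j" using L_points i(1) j(1) by auto
    then have val: "glue c m r = (if r = l1 i then c (a i) else m i)"
      "after (glue c m) r = (if r = l1 i then m i else c (b i))"
      "glue c m r' = (if r' = l1 j then c (a j) else m j)"
      "after (glue c m) r' = (if r' = l1 j then m j else c (b j))"
      using pts glue_at[of c i m, OF cper i(1)] glue_at[of c j m, OF cper j(1)] by auto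
    have "xing G s q h (kind L r r') (kind L r' r) (turn L r r' > 0)
        (glue c m r) (after (glue c m) r) (glue c m r') (after (glue c m) r')"
      unfolding val using fit i(1) j(1) pts rr unfolding strands_fit_def by blast
    then have "crossing_ok L G s q h (glue c m) r r'"
      using L.crossing_ok_iff_xing[OF rr, of G s q h "glue c m"] by blast
    then show ?thesis
      unfolding i(3) j(3) using L.crossing_ok_shift[OF rr gstep] by blast
  next
    case False
    then have v: "v \<notin> inner" and uvK: "meets K u v"
      using meets_inner_L[OF uv] meets_outside[OF False] uv by auto
    have "u \<in> L.X" "v \<in> L.X" using uv meets_crossing_time meets_sym by blast+
    then have out: "u \<notin> outer" "v \<notin> outer" using crossing_time_outer(2) False v by blast+
    show ?thesis
      using rel[OF uvK]
      unfolding crossing_ok_def turn_outside[OF out] kind_outside[OF uvK False]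
        after_glue_outside[OF out(1)] after_glue_outside[OF out(2)] glue_outside[OF False]
        glue_outside[OF v] .
  qed
  then show ?thesis using com gcar gstep by (auto simp: colouring_def)
qed

lemma strands_fit_colouring:
  assumes col: "colouring L G s q h c"
  shows "strands_fit L n l1 l2 G s q h (\<lambda>i. c (a i)) (\<lambda>i. c (l2 i)) (\<lambda>i. c (b i))"
    and "c = glue c (\<lambda>i. c (l2 i))"
proof -
  have step: "step_function L.X c" and car: "\<And>t. c t \<in> carrier G"
    and rel: "\<And>u v. meets L u v \<Longrightarrow> crossing_ok L G s q h c u v"
    using col by (auto simp: colouring_def)
  have a: "a i \<notin> L.X" if "i < n" for i
    using end_points_not_crossing(3)[OF that, of 0] by simp
  note sv = strand_values[OF step _ L_times a]
  have l1: "c (l1 i) = c (a i)" if "i < n" for i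
    using sv(1)[of i "l1 i"] that L_points[OF that] by simp
  have val: "c u = (if u = l1 i then c (a i) else c (l2 i))"
    "after c u = (if u = l1 i then c (l2 i) else c (b i))" if "i < n" "u \<in> {l1 i, l2 i}" for i u
    using that l1 sv(4,5)[of i] by auto
  show "strands_fit L n l1 l2 G s q h (\<lambda>i. c (a i)) (\<lambda>i. c (l2 i)) (\<lambda>i. c (b i))"
    unfolding strands_fit_def
  proof (intro conjI allI impI ballI)
    fix i assume i: "i < n"
    show "c (l2 i) \<in> carrier G" by (rule car)
    show "c (l2 i) = c (a i)" if "l1 i \<notin> L.X"
      using sv(4)[OF i i i] step_functionD(5)[OF step that] l1[OF i] by simp
    show "c (l2 i) = c (b i)" if "l2 i \<notin> L.X"
      using sv(5)[OF i i i] step_functionD(5)[OF step that] by simp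
  next
    fix i j u v assume i: "i < n" and j: "j < n" and u: "u \<in> {l1 i, l2 i}" and v: "v \<in> {l1 j, l2 j}"
      and uv: "meets L u v"
    have "meets L v u" using uv meets_sym by blast
    then have "xing G s q h (kind L u v) (kind L v u) (turn L u v > 0) (c u) (after c u) (c v) (after c v)"
      using L.crossing_ok_iff_xing[OF uv, of G s q h c] rel uv by blast
    then show "xing G s q h (kind L u v) (kind L v u) (turn L u v > 0)
         (if u = l1 i then c (a i) else c (l2 i)) (if u = l1 i then c (l2 i) else c (b i))
         (if v = l1 j then c (a j) else c (l2 j)) (if v = l1 j then c (l2 j) else c (b j))"
      unfolding val[OF i u] val[OF j v] .
  qed
  show "c = glue c (\<lambda>i. c (l2 i))"
    by (rule step_function_eq_glue[OF step L_times a])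
qed

lemma colouring_extends:
  assumes ext: "\<And>m x y. strands_fit K n k1 k2 G s q h x m y \<Longrightarrow> (\<And>i. x i \<in> carrier G) \<Longrightarrow>
      (\<And>i. y i \<in> carrier G) \<Longrightarrow> \<exists>m'. strands_fit L n l1 l2 G s q h x m' y"
    and col: "colouring K G s q h c"
  shows "\<exists>c'. colouring L G s q h c' \<and> (\<forall>t\<in>- inner. c' t = c t)"
proof -
  interpret swap: disc_change L K D n a b l1 l2 k1 k2 by (rule disc_change_swap)
  have car: "\<And>t. c t \<in> carrier G" using col by (auto simp: colouring_def)
  obtain m' where "strands_fit L n l1 l2 G s q h (\<lambda>i. c (a i)) m' (\<lambda>i. c (b i))"
    using ext[OF swap.strands_fit_colouring(1)[OF col]] car by blast
  then have "colouring L G s q h (glue c m')" by (rule colouring_glue[OF col])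
  then show ?thesis by (intro exI[of _ "glue c m'"]) (simp add: glue_outside)
qed

lemma colouring_determined:
  assumes det: "\<And>x y. (\<And>i. x i \<in> carrier G) \<Longrightarrow> (\<And>i. y i \<in> carrier G) \<Longrightarrow>
      strands_determined L n l1 l2 G s q h x y"
    and c: "colouring L G s q h c" and d: "colouring L G s q h d"
    and eq: "\<forall>t\<in>- inner. c t = d t"
  shows "c = d"
proof -
  have car: "\<And>t. c t \<in> carrier G" using c by (auto simp: colouring_def)
  have ab: "d (a i) = c (a i)" "d (b i) = c (b i)" if "i < n" for i
    using eq end_points_not_inner[OF that, of 0] by auto
  have "strands_fit L n l1 l2 G s q h (\<lambda>i. c (a i)) (\<lambda>i. d (l2 i)) (\<lambda>i. c (b i))"
    using strands_fit_colouring(1)[OF d] ab by (subst strands_fit_cong) auto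
  then have "c (l2 i) = d (l2 i)" if "i < n" for i
    using det[of "\<lambda>i. c (a i)" "\<lambda>i. c (b i)"] car strands_fit_colouring(1)[OF c] that
    unfolding strands_determined_def by blast
  then have "glue c (\<lambda>i. c (l2 i)) = glue d (\<lambda>i. d (l2 i))"
    using eq by (intro glue_cong) auto
  then show ?thesis
    using strands_fit_colouring(2)[OF c] strands_fit_colouring(2)[OF d] by simp
qed

text \<open>
  By gluing, extending a colouring from one diagram to the other amounts to finding the values in
  the middle of the strands.
\<close>

theorem local_isomorphism:
  assumes fwd: "\<And>(G :: pg_group) s q h x m y. group G \<Longrightarrow> commuting G s q h \<Longrightarrow>
      (\<And>i. x i \<in> carrier G) \<Longrightarrow> (\<And>i. y i \<in> carrier G) \<Longrightarrow>
      strands_fit K n k1 k2 G s q h x m y \<Longrightarrow> \<exists>m'. strands_fit L n l1 l2 G s q h x m' y"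
    and bwd: "\<And>(G :: pg_group) s q h x m y. group G \<Longrightarrow> commuting G s q h \<Longrightarrow>
      (\<And>i. x i \<in> carrier G) \<Longrightarrow> (\<And>i. y i \<in> carrier G) \<Longrightarrow>
      strands_fit L n l1 l2 G s q h x m y \<Longrightarrow> \<exists>m'. strands_fit K n k1 k2 G s q h x m' y"
    and detK: "\<And>(G :: pg_group) s q h x y. group G \<Longrightarrow> commuting G s q h \<Longrightarrow>
      (\<And>i. x i \<in> carrier G) \<Longrightarrow> (\<And>i. y i \<in> carrier G) \<Longrightarrow> strands_determined K n k1 k2 G s q h x y"
    and detL: "\<And>(G :: pg_group) s q h x y. group G \<Longrightarrow> commuting G s q h \<Longrightarrow>
      (\<And>i. x i \<in> carrier G) \<Longrightarrow> (\<And>i. y i \<in> carrier G) \<Longrightarrow> strands_determined L n l1 l2 G s q h x y"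
  shows "virtual_parity_group K \<cong> virtual_parity_group L"
proof -
  interpret swap: disc_change L K D n a b l1 l2 k1 k2 by (rule disc_change_swap)
  have com: "commuting G s q h" if "colouring M G s q h c" for M and G :: pg_group and s q h c
    using that by (simp add: colouring_def)
  show ?thesis
  proof (rule virtual_parity_groups_isomorphic[OF K.is_diagram L.is_diagram, where E="- inner" and e="\<lambda>t. t"])
    fix G :: pg_group and s q h c d
    assume G: "group G"
    show "\<exists>c'. colouring L G s q h c' \<and> (\<forall>t\<in>- inner. c' t = c t)" if c: "colouring K G s q h c"
      by (rule colouring_extends[OF _ c]) (rule fwd[OF G com[OF c]])
    show "\<exists>c'. colouring K G s q h c' \<and> (\<forall>t\<in>- inner. c t = c' t)" if c: "colouring L G s q h c"
    proof -
      have "\<exists>c'. colouring K G s q h c' \<and> (\<forall>t\<in>- inner. c' t = c t)"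
        by (rule swap.colouring_extends[OF _ c]) (rule bwd[OF G com[OF c]])
      then obtain c' where "colouring K G s q h c' \<and> (\<forall>t\<in>- inner. c' t = c t)"
        by blast
      then show ?thesis by (intro exI[of _ c']) simp
    qed
    show "c = d" if c: "colouring K G s q h c" "colouring K G s q h d" "\<forall>t\<in>- inner. c t = d t"
      using swap.colouring_determined[OF detK[OF G com[OF c(1)]] c(1,2)] c(3) by blast
    show "c = d" if c: "colouring L G s q h c" "colouring L G s q h d" "\<forall>t\<in>- inner. c t = d t"
      using colouring_determined[OF detL[OF G com[OF c(1)]] c(1,2,3)] by blast
  qed
qed

end

section \<open>The first and second moves\<close>

lemma all_less_two: "(\<forall>i<(2::nat). P i) \<longleftrightarrow> P 0 \<and> P 1"
  by (auto simp: less_2_cases_iff)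

lemma xing_reverse:
  assumes "diagram K" "meets K u v"
  shows "xing G s q h (kind K v u) (kind K u v) (turn K v u > 0) b b' a a' \<longleftrightarrow>
    xing G s q h (kind K u v) (kind K v u) (turn K u v > 0) a a' b b'"
  using diagram.turn_nonzero[OF assms] turn_sym[of K u v] by (auto simp: xing_def)

text \<open>
  A crossing is passed at two times only, up to periods.
\<close>

lemma (in diagram) same_point:
  assumes "meets K u v" "curve K t = curve K u" shows "t - u \<in> \<int> \<or> t - v \<in> \<int>"
proof (cases "u - t \<in> \<int>")
  case True
  then show ?thesis by (metis Ints_minus minus_diff_eq)
next
  case False
  then have "meets K u t" using assms(2) by (simp add: meets_def)
  then show ?thesis using meets_unique assms(1) by blast
qed

text \<open>
  The two passages of the new crossing lie on one strand, with no other crossing in between, so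
  the relations are those of a kink.
\<close>

theorem move_I_isomorphic:
  assumes K: "is_virtual_knot_diagram K" and L: "is_virtual_knot_diagram L" and move: "move_I K L p"
  shows "virtual_parity_group K \<cong> virtual_parity_group L"
proof -
  obtain D a b where change: "local_change D 1 a b K L" and cK: "crossings K \<inter> D = {}"
    and cL: "crossings L \<inter> D = {p}"
    using move unfolding move_I_def by blast
  interpret disc_pair K L D 1 a b by unfold_locales fact+
  have K_free: "t \<notin> K.X" if "t \<in> outer" for t
    using that cK vimage_outer(1) by (auto simp: crossings_def)
  have inI: "t \<in> inner" if "t \<in> L.X" "curve L t \<in> D" for t
    using that crossing_time_outer(2)[of t] vimage_outer(2) by blast
  have strand: "\<exists>r k. r \<in> {a 0<..<b 0} \<and> t = r + of_int k" if "t \<in> inner" for t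
    using inner_cases[OF that] by (metis less_one)
  have "p \<in> crossings L" "p \<in> D" using cL by auto
  then obtain t0 s0 where ts: "meets L t0 s0" "curve L t0 = p"
    by (auto simp: crossings_def crossing_times_def)
  have t0: "t0 \<in> inner" using inI[of t0] meets_crossing_time[OF ts(1)] ts(2) \<open>p \<in> D\<close> by simp
  then have "s0 \<in> inner" using meets_inner_L[OF ts(1)] by simp
  then obtain r k r' k' where r: "r \<in> {a 0<..<b 0}" "t0 = r + of_int k"
    "r' \<in> {a 0<..<b 0}" "s0 = r' + of_int k'"
    using strand t0 by metis
  have rr: "meets L r r'" using ts(1) r(2,4) by simp
  obtain c d where cd: "c \<in> {a 0<..<b 0}" "d \<in> {a 0<..<b 0}" "c < d" "meets L c d"
  proof (cases "r < r'")
    case True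
    then show ?thesis using that[of r r'] r rr by simp
  next
    case False
    have "r \<noteq> r'" using rr by (auto simp: meets_def)
    then show ?thesis using that[of r' r] r rr False meets_sym by auto
  qed
  have "c \<in> L.X" and "d \<in> L.X" using cd(4) meets_crossing_time meets_sym by blast+
  have LX: "L.X \<inter> {a 0<..<b 0} \<subseteq> {c, d}"
  proof
    fix t assume t: "t \<in> L.X \<inter> {a 0<..<b 0}"
    have D: "curve L u \<in> D" if "u \<in> {a 0<..<b 0}" for u
      using in_inner[of 0 u 0] that inner_outer vimage_outer(2) by auto
    have "curve L t \<in> crossings L \<inter> D" "curve L c \<in> crossings L \<inter> D"
      using t D cd(1) \<open>c \<in> L.X\<close> by (auto simp: crossings_def)
    then have "curve L t = curve L c" using cL by simp
    then have "t - c \<in> \<int> \<or> t - d \<in> \<int>" using L.same_point[OF cd(4)] by simp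
    then show "t \<in> {c, d}"
      using strand_unique[of 0 0 t c] strand_unique[of 0 0 t d] t cd(1,2) by auto
  qed
  have kout: "c \<in> outer" "d \<in> outer"
    using in_inner[of 0 c 0] in_inner[of 0 d 0] cd(1,2) inner_outer by auto
  have KX: "t \<notin> K.X" if "t \<in> {a 0<..<b 0}" for t
    using in_inner[of 0 t 0] that inner_outer K_free by auto
  \<comment> \<open>in \<open>K\<close> these are times without crossing\<close>
  interpret disc_change K L D 1 a b "\<lambda>_. c" "\<lambda>_. d" "\<lambda>_. c" "\<lambda>_. d"
  proof unfold_locales
    fix i :: nat assume "i < 1"
    then have i: "i = 0" by simp
    show "a i < c \<and> c < d \<and> d < b i" using cd i by auto
    show "K.X \<inter> {a i<..<b i} \<subseteq> {c, d}" using KX i by auto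
    show "L.X \<inter> {a i<..<b i} \<subseteq> {c, d}" using LX i by simp
    have "c \<notin> K.C" "d \<notin> K.C" using K_free kout K.classical_subset by auto
    then show "((c \<in> K.C) = (d \<in> K.C)) = ((c \<in> L.C) = (d \<in> L.C))"
      using L.classical_meets[OF cd(4)] by simp
  qed
  have fitK: "strands_fit K 1 (\<lambda>_. c) (\<lambda>_. d) G s q h x m y \<longleftrightarrow>
      m 0 \<in> carrier G \<and> m 0 = x 0 \<and> m 0 = y 0" for G :: pg_group and s q h x m y
    using K_free kout meets_crossing_time[of K] by (auto simp: strands_fit_def)
  have fitL: "strands_fit L 1 (\<lambda>_. c) (\<lambda>_. d) G s q h x m y \<longleftrightarrow>
      m 0 \<in> carrier G \<and>
      xing G s q h (kind L c d) (kind L d c) (turn L c d > 0) (x 0) (m 0) (m 0) (y 0)"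
    for G :: pg_group and s q h x m y
  proof -
    have "meets L d c" "\<not> meets L c c" "\<not> meets L d d" "d \<noteq> c"
      using cd(3,4) meets_sym by (auto simp: meets_def)
    then show ?thesis
      using \<open>c \<in> L.X\<close> \<open>d \<in> L.X\<close> cd(4)
      by (auto simp: strands_fit_def xing_reverse[OF L.diagram_axioms cd(4)])
  qed
  have kinds: "kinds_match (kind L c d) (kind L d c)" by (rule L.kinds_match[OF cd(4)])
  show ?thesis
  proof (rule local_isomorphism)
    fix G :: pg_group and s q h and x y m :: "nat \<Rightarrow> pg_gen gword set"
    assume G: "group G" "commuting G s q h" "\<And>i. x i \<in> carrier G" "\<And>i. y i \<in> carrier G"
    interpret G: group G by fact
    obtain v where v: "v \<in> carrier G" "\<forall>m\<in>carrier G. \<forall>b\<in>carrier G.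
        xing G s q h (kind L c d) (kind L d c) (turn L c d > 0) (x 0) m m b \<longleftrightarrow> m = v \<and> b = x 0"
      using G.kink[OF G(2) kinds G(3)[of 0]] by blast
    have fitL': "strands_fit L 1 (\<lambda>_. c) (\<lambda>_. d) G s q h x m y \<longleftrightarrow> m 0 = v \<and> y 0 = x 0" for m
      unfolding fitL using v G(4)[of 0] by blast
    show "\<exists>m'. strands_fit L 1 (\<lambda>_. c) (\<lambda>_. d) G s q h x m' y"
      if "strands_fit K 1 (\<lambda>_. c) (\<lambda>_. d) G s q h x m y"
      using that unfolding fitK fitL' by (intro exI[of _ "\<lambda>_. v"]) metis
    show "\<exists>m'. strands_fit K 1 (\<lambda>_. c) (\<lambda>_. d) G s q h x m' y"
      if "strands_fit L 1 (\<lambda>_. c) (\<lambda>_. d) G s q h x m y"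
      using that G(3)[of 0] unfolding fitK fitL' by (intro exI[of _ "\<lambda>_. x 0"]) simp
    show "strands_determined K 1 (\<lambda>_. c) (\<lambda>_. d) G s q h x y"
      unfolding strands_determined_def fitK by auto
    show "strands_determined L 1 (\<lambda>_. c) (\<lambda>_. d) G s q h x y"
      unfolding strands_determined_def fitL' by auto
  qed
qed

lemma move_II_swap:
  assumes "move_II K L s s' t t'" shows "move_II K L s' s t' t"
proof -
  obtain D a b where "local_change D 2 a b K L" "crossings K \<inter> D = {}"
    "{s, s'} \<subseteq> {a 0<..<b 0}" "{t, t'} \<subseteq> {a 1<..<b 1}" "s \<noteq> s'" "t \<noteq> t'"
    "curve L s = curve L t" "curve L s' = curve L t'"
    "crossings L \<inter> D = {curve L s, curve L s'}" "turn L s t * turn L s' t' < 0"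
    using assms unfolding move_II_def by blast
  then show ?thesis
    unfolding move_II_def
    by (intro exI[of _ D] exI[of _ a] exI[of _ b])
      (simp add: mult.commute insert_commute)
qed

text \<open>
  The first strand meets the crossings in the order \<open>s, s'\<close>; the second one may meet them in
  either order.  The parity function changes from one crossing to the other on both strands
  or on none, so both crossings have the same parity.
\<close>

lemma move_II_isomorphic_aux:
  assumes K: "is_virtual_knot_diagram K" and L: "is_virtual_knot_diagram L"
    and move: "move_II K L s s' t t'" and less: "s < s'"
    and virt: "curve L s \<in> virt L \<longleftrightarrow> curve L s' \<in> virt L" and over: "s \<in> over L \<longleftrightarrow> s' \<in> over L"
  shows "virtual_parity_group K \<cong> virtual_parity_group L"
proof -
  obtain D a b where change: "local_change D 2 a b K L" and cK: "crossings K \<inter> D = {}"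
    and sub: "{s, s'} \<subseteq> {a 0<..<b 0}" "{t, t'} \<subseteq> {a 1<..<b 1}"
    and tt: "s \<noteq> s'" "t \<noteq> t'" and cv: "curve L s = curve L t" "curve L s' = curve L t'"
    and cL: "crossings L \<inter> D = {curve L s, curve L s'}" and turns: "turn L s t * turn L s' t' < 0"
    using move unfolding move_II_def by blast
  have s: "s \<in> {a 0<..<b 0}" "s' \<in> {a 0<..<b 0}" and t: "t \<in> {a 1<..<b 1}" "t' \<in> {a 1<..<b 1}"
    using sub by simp_all
  interpret disc_pair K L D 2 a b by unfold_locales fact+
  have K_free: "u \<notin> K.X" if "u \<in> {a i<..<b i}" "i < 2" for u i
  proof -
    have "u \<in> outer" using in_inner[of i u 0] that inner_outer by auto
    then show ?thesis using cK vimage_outer(1) by (auto simp: crossings_def)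
  qed
  have uniq: "i = j \<and> u = v" if "u \<in> {a i<..<b i}" "v \<in> {a j<..<b j}" "i < 2" "j < 2" "u - v \<in> \<int>" for u v i j
    using strand_unique[of i j u v] that by auto
  have st: "meets L s t" "meets L s' t'"
    using uniq[of s 0 t 1] uniq[of s' 0 t' 1] s t cv by (auto simp: meets_def)
  then have ts: "meets L t s" "meets L t' s'" using meets_sym by blast+
  have no: "\<not> meets L s s'" "\<not> meets L s t'" "\<not> meets L t t'" "\<not> meets L s' t"
  proof -
    have *: "curve L s \<noteq> curve L s'"
    proof
      assume "curve L s = curve L s'"
      then have "s' - s \<in> \<int> \<or> s' - t \<in> \<int>" using L.same_point[OF st(1), of s'] by simp
      then show False using uniq[of s' 0 s 0] uniq[of s' 0 t 1] s t less by auto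
    qed
    then show "\<not> meets L s s'" "\<not> meets L s t'" "\<not> meets L t t'" "\<not> meets L s' t"
      using cv by (auto simp: meets_def)
  qed
  then have no': "\<not> meets L s' s" "\<not> meets L t' s" "\<not> meets L t' t" "\<not> meets L t s'"
    using meets_sym by blast+
  have no'': "\<not> meets L u u" for u by (simp add: meets_def)
  have X: "s \<in> L.X" "s' \<in> L.X" "t \<in> L.X" "t' \<in> L.X" using st ts meets_crossing_time by blast+
  have ne: "s \<noteq> t" "s \<noteq> t'" "s' \<noteq> t" "s' \<noteq> t'"
    using uniq[of s 0 t 1] uniq[of s 0 t' 1] uniq[of s' 0 t 1] uniq[of s' 0 t' 1] s t by auto
  define l1 where "l1 i = (if i = 0 then s else min t t')" for i :: nat
  define l2 where "l2 i = (if i = 0 then s' else max t t')" for i :: nat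
  have LX: "L.X \<inter> {a i<..<b i} \<subseteq> {l1 i, l2 i}" if "i < 2" for i
  proof
    fix u assume u: "u \<in> L.X \<inter> {a i<..<b i}"
    have "u \<in> outer" using in_inner[of i u 0] u that inner_outer by auto
    then have "curve L u \<in> crossings L \<inter> D" using u vimage_outer(2) by (auto simp: crossings_def)
    then have "curve L u = curve L s \<or> curve L u = curve L s'" using cL by simp
    then consider "u - s \<in> \<int>" | "u - t \<in> \<int>" | "u - s' \<in> \<int>" | "u - t' \<in> \<int>"
      using L.same_point[OF st(1), of u] L.same_point[OF st(2), of u] by blast
    then show "u \<in> {l1 i, l2 i}"
    proof cases
      case 1 then show ?thesis using uniq[of u i s 0] u that s by (simp add: l1_def)
    next
      case 2 then show ?thesis using uniq[of u i t 1] u that t by (auto simp: l1_def l2_def min_def max_def)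
    next
      case 3 then show ?thesis using uniq[of u i s' 0] u that s by (simp add: l2_def)
    next
      case 4 then show ?thesis using uniq[of u i t' 1] u that t by (auto simp: l1_def l2_def min_def max_def)
    qed
  qed
  have C: "s' \<in> L.C \<longleftrightarrow> s \<in> L.C" "t \<in> L.C \<longleftrightarrow> s \<in> L.C" "t' \<in> L.C \<longleftrightarrow> s \<in> L.C"
    using virt L.classical_meets_iff[OF st(1)] L.classical_meets_iff[OF st(2)]
      L.classical_meets[OF st(1)] L.classical_meets[OF st(2)] by auto
  have pts: "a i < l1 i \<and> l1 i < l2 i \<and> l2 i < b i" if "i < 2" for i
    using that s t less tt by (auto simp: l1_def l2_def less_2_cases_iff min_def max_def)
  have KX: "l1 i \<notin> K.X" "l2 i \<notin> K.X" if "i < 2" for i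
    using K_free[of _ i] pts[OF that] that by auto
  interpret disc_change K L D 2 a b l1 l2 l1 l2
  proof unfold_locales
    fix i :: nat assume i: "i < 2"
    show "a i < l1 i \<and> l1 i < l2 i \<and> l2 i < b i" by (rule pts[OF i])
    show "K.X \<inter> {a i<..<b i} \<subseteq> {l1 i, l2 i}" using K_free i by auto
    show "L.X \<inter> {a i<..<b i} \<subseteq> {l1 i, l2 i}" by (rule LX[OF i])
    show "((l1 i \<in> K.C) = (l2 i \<in> K.C)) = ((l1 i \<in> L.C) = (l2 i \<in> L.C))"
      using KX[OF i] K.classical_subset C by (auto simp: l1_def l2_def min_def max_def)
  qed
  have kinds: "kind L s' t' = kind L s t \<and> kind L t' s' = kind L t s"
  proof -
    obtain f g where g: "L.parity_function g"
      "\<And>i. i < 2 \<Longrightarrow> g (l1 i) = f (a i)" "\<And>i. i < 2 \<Longrightarrow> g (l2 i) = (f (a i) \<noteq> (l1 i \<in> L.C))"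
      by (rule parity_functions) blast
    have "g s' = (g s \<noteq> (s \<in> L.C))" using g(2,3)[of 0] by (simp add: l1_def l2_def)
    moreover have "g t' = (g t \<noteq> (s \<in> L.C))"
      using g(2,3)[of 1] C by (auto simp: l1_def l2_def min_def max_def split: if_splits)
    moreover have "t \<in> over L \<longleftrightarrow> t' \<in> over L" if "s \<in> L.C"
      using L.over_under[OF _ st(1)] L.over_under[OF _ st(2)] C that over by blast
    ultimately show ?thesis
      unfolding L.kind_eq[OF g(1) st(1)] L.kind_eq[OF g(1) st(2)] L.kind_eq[OF g(1) ts(1)]
        L.kind_eq[OF g(1) ts(2)] C
      using over by auto
  qed
  define \<sigma> where "\<sigma> = (turn L s t > 0)"
  have \<sigma>: "(turn L s' t' > 0) = (\<not> \<sigma>)"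
    using turns by (auto simp: \<sigma>_def mult_less_0_iff)
  have reverse: "xing G s0 q h (kind L t s) (kind L s t) (turn L t' s' > 0) v v' u u' \<longleftrightarrow>
      xing G s0 q h (kind L s t) (kind L t s) (\<not> \<sigma>) u u' v v'"
    for G :: pg_group and s0 q h u u' v v'
    using xing_reverse[OF L.diagram_axioms st(2), of G s0 q h v v' u u'] kinds \<sigma> by simp
  have fitK: "strands_fit K 2 l1 l2 G s0 q h x m y \<longleftrightarrow>
      (\<forall>i<2. m i \<in> carrier G \<and> m i = x i \<and> m i = y i)" for G :: pg_group and s0 q h x m y
    using KX meets_crossing_time[of K] unfolding strands_fit_def by blast
  have fitL: "strands_fit L 2 l1 l2 G s0 q h x m y \<longleftrightarrow>
      m 0 \<in> carrier G \<and> m 1 \<in> carrier G \<and>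
      (if t < t' then
        xing G s0 q h (kind L s t) (kind L t s) \<sigma> (x 0) (m 0) (x 1) (m 1) \<and>
        xing G s0 q h (kind L s t) (kind L t s) (\<not> \<sigma>) (m 0) (y 0) (m 1) (y 1)
       else
        xing G s0 q h (kind L s t) (kind L t s) \<sigma> (x 0) (m 0) (m 1) (y 1) \<and>
        xing G s0 q h (kind L s t) (kind L t s) (\<not> \<sigma>) (m 0) (y 0) (x 1) (m 1))"
    for G :: pg_group and s0 q h x m y
  proof -
    note simps = strands_fit_def all_less_two l1_def l2_def st ts no no' no'' X
      xing_reverse[OF L.diagram_axioms st(1)] reverse
      \<sigma>_def[symmetric] \<sigma> kinds
    show ?thesis
    proof (cases "t < t'")
      case True
      then have [simp]: "min t t' = t" "max t t' = t'" by auto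
      show ?thesis using True less tt ne by (auto simp: simps)
    next
      case False
      then have [simp]: "min t t' = t'" "max t t' = t" by auto
      show ?thesis using False less tt ne by (auto simp: simps)
    qed
  qed
  show ?thesis
  proof (rule local_isomorphism)
    fix G :: pg_group and s0 q h and x y m :: "nat \<Rightarrow> pg_gen gword set"
    assume G: "group G" "commuting G s0 q h" "\<And>i. x i \<in> carrier G" "\<And>i. y i \<in> carrier G"
    interpret G: group G by fact
    note km = L.kinds_match[OF st(1)]
    have "\<exists>v\<in>carrier G. \<exists>w\<in>carrier G. \<forall>m. strands_fit L 2 l1 l2 G s0 q h x m y \<longleftrightarrow>
        m 0 = v \<and> m 1 = w \<and> y 0 = x 0 \<and> y 1 = x 1"
    proof (cases "t < t'")
      case True
      obtain v w where vw: "v \<in> carrier G" "w \<in> carrier G"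
        "\<forall>m\<in>carrier G. \<forall>m'\<in>carrier G. \<forall>x'\<in>carrier G. \<forall>y'\<in>carrier G.
          xing G s0 q h (kind L s t) (kind L t s) \<sigma> (x 0) m (x 1) m' \<and>
          xing G s0 q h (kind L s t) (kind L t s) (\<not> \<sigma>) m x' m' y' \<longleftrightarrow>
          m = v \<and> m' = w \<and> x' = x 0 \<and> y' = x 1"
        using G.bigon_parallel[OF G(2) km G(3)[of 0] G(3)[of 1], of \<sigma>]
        by (elim bexE) (rule that)
      show ?thesis
        unfolding fitL if_P[OF True]
        by (rule bexI[OF _ vw(1)], rule bexI[OF _ vw(2)])
          (use vw(1,2) vw(3)[rule_format, of "_ 0" "_ 1" "y 0" "y 1"] G(4) in metis)
    next
      case False
      obtain v w where vw: "v \<in> carrier G" "w \<in> carrier G"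
        "\<forall>m\<in>carrier G. \<forall>m'\<in>carrier G. \<forall>x'\<in>carrier G. \<forall>y'\<in>carrier G.
          xing G s0 q h (kind L s t) (kind L t s) \<sigma> (x 0) m m' y' \<and>
          xing G s0 q h (kind L s t) (kind L t s) (\<not> \<sigma>) m x' (x 1) m' \<longleftrightarrow>
          m = v \<and> m' = w \<and> x' = x 0 \<and> y' = x 1"
        using G.bigon_antiparallel[OF G(2) km G(3)[of 0] G(3)[of 1], of \<sigma>]
        by (elim bexE) (rule that)
      show ?thesis
        unfolding fitL if_not_P[OF False]
        by (rule bexI[OF _ vw(1)], rule bexI[OF _ vw(2)])
          (use vw(1,2) vw(3)[rule_format, of "_ 0" "_ 1" "y 0" "y 1"] G(4) in metis)
    qed
    then obtain v w where fitL': "\<And>m. strands_fit L 2 l1 l2 G s0 q h x m y \<longleftrightarrow>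
        m 0 = v \<and> m 1 = w \<and> y 0 = x 0 \<and> y 1 = x 1"
      by blast
    show "\<exists>m'. strands_fit L 2 l1 l2 G s0 q h x m' y" if "strands_fit K 2 l1 l2 G s0 q h x m y"
      using that unfolding fitK fitL' all_less_two by (intro exI[of _ "\<lambda>i. if i = 0 then v else w"]) (simp, metis)
    show "\<exists>m'. strands_fit K 2 l1 l2 G s0 q h x m' y" if "strands_fit L 2 l1 l2 G s0 q h x m y"
      using that G(3) unfolding fitK fitL' all_less_two by (intro exI[of _ x]) simp
    show "strands_determined K 2 l1 l2 G s0 q h x y"
      unfolding strands_determined_def fitK by metis
    show "strands_determined L 2 l1 l2 G s0 q h x y"
      unfolding strands_determined_def fitL' all_less_two by simp
  qed
qed

theorem move_II_isomorphic:
  assumes K: "is_virtual_knot_diagram K" and L: "is_virtual_knot_diagram L"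
    and move: "move_II K L s s' t t'"
    and virt: "curve L s \<in> virt L \<longleftrightarrow> curve L s' \<in> virt L" and over: "s \<in> over L \<longleftrightarrow> s' \<in> over L"
  shows "virtual_parity_group K \<cong> virtual_parity_group L"
proof -
  have "s \<noteq> s'" using move by (auto simp: move_II_def)
  then consider "s < s'" | "s' < s" by linarith
  then show ?thesis
  proof cases
    case 1
    show ?thesis by (rule move_II_isomorphic_aux[OF K L move 1 virt over])
  next
    case 2
    show ?thesis
      by (rule move_II_isomorphic_aux[OF K L move_II_swap[OF move] 2 virt[symmetric] over[symmetric]])
  qed
qed

section \<open>The third move\<close>

lemma all_less_three: "(\<forall>i<(3::nat). P i) \<longleftrightarrow> P 0 \<and> P 1 \<and> P 2"
  by (auto simp: numeral_3_eq_3 numeral_2_eq_2 less_Suc_eq)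

text \<open>
  The three strands in some order.
\<close>

definition roles :: "nat \<Rightarrow> nat \<Rightarrow> nat \<Rightarrow> bool" where
  "roles i j k \<longleftrightarrow> {i, j, k} = {0, 1, 2}"

lemma roles_cases:
  "roles i j k \<longleftrightarrow> (i, j, k) \<in> {(0, 1, 2), (0, 2, 1), (1, 0, 2), (1, 2, 0), (2, 0, 1), (2, 1, 0)}"
proof
  assume r: "roles i j k"
  then have "i \<in> {0, 1, 2}" "j \<in> {0, 1, 2}" "k \<in> {0, 1, 2}" unfolding roles_def by blast+
  moreover have "card {i, j, k} = 3" using r unfolding roles_def by simp
  ultimately show "(i, j, k) \<in> {(0, 1, 2), (0, 2, 1), (1, 0, 2), (1, 2, 0), (2, 0, 1), (2, 1, 0)}"
    by (auto simp: card_insert_if split: if_splits)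
qed (auto simp: roles_def)

lemma rolesD:
  assumes "roles i j k"
  shows "i < 3" "j < 3" "k < 3" "i \<noteq> j" "i \<noteq> k" "j \<noteq> k" "roles j i k" "roles i k j"
  using assms by (auto simp: roles_cases)

lemma roles_all: "roles i j k \<Longrightarrow> (\<forall>l<3. P l) \<longleftrightarrow> P i \<and> P j \<and> P k"
  by (auto simp: roles_cases all_less_three)

lemma rolesI:
  assumes "i < 3" "j < 3" "k < 3" "i \<noteq> j" "i \<noteq> k" "j \<noteq> k" shows "roles i j k"
proof -
  have "i = 0 \<or> i = 1 \<or> i = 2" "j = 0 \<or> j = 1 \<or> j = 2" "k = 0 \<or> k = 1 \<or> k = 2"
    using assms by linarith+
  then show ?thesis using assms(4-) by (elim disjE) (simp_all add: roles_cases)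
qed

lemma roles_member: "roles i j k \<Longrightarrow> l < 3 \<Longrightarrow> l = i \<or> l = j \<or> l = k"
  using roles_all[of i j k "\<lambda>l. l = i \<or> l = j \<or> l = k"] by simp

lemma roles_start: "i < 3 \<Longrightarrow> \<exists>j k. roles i j k"
  by (auto simp: roles_cases numeral_3_eq_3 numeral_2_eq_2 less_Suc_eq)

lemma roles_exist: "i < 3 \<Longrightarrow> j < 3 \<Longrightarrow> i \<noteq> j \<Longrightarrow> \<exists>k. roles i j k"
  by (auto simp: roles_cases numeral_3_eq_3 numeral_2_eq_2 less_Suc_eq)

text \<open>
  The corner of the strands \<open>j\<close> and \<open>k\<close> is reached from the strand \<open>i\<close> along either of them, and
  must be found on the same side of \<open>i\<close>.
\<close>

lemma triangle_roles:
  assumes tri: "triangle K u" and r: "roles i j k"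
    and ne: "\<And>i j k. roles i j k \<Longrightarrow> u i j \<noteq> u i k"
    and nz: "\<And>i j k. roles i j k \<Longrightarrow> turn K (u i j) (u j i) \<noteq> 0"
  shows "(u j i < u j k \<longleftrightarrow> turn K (u i j) (u j i) > 0) \<longleftrightarrow>
    (u k i < u k j \<longleftrightarrow> turn K (u i k) (u k i) > 0)"
proof -
  have sg: "sgn x = (if x > 0 then 1 else -1)" if "x \<noteq> 0" for x :: real
    using that by (simp add: sgn_real_def)
  have ne': "u 0 1 - u 0 2 \<noteq> 0" "u 1 2 - u 1 0 \<noteq> 0" "u 2 0 - u 2 1 \<noteq> 0"
    using ne[of 0 1 2] ne[of 1 2 0] ne[of 2 0 1] by (auto simp: roles_cases)
  have nz': "turn K (u 0 1) (u 1 0) \<noteq> 0" "turn K (u 1 2) (u 2 1) \<noteq> 0" "turn K (u 2 0) (u 0 2) \<noteq> 0"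
    using nz[of 0 1 2] nz[of 1 2 0] nz[of 2 0 1] by (auto simp: roles_cases)
  have rev: "turn K (u 1 0) (u 0 1) = - turn K (u 0 1) (u 1 0)"
    "turn K (u 2 1) (u 1 2) = - turn K (u 1 2) (u 2 1)"
    "turn K (u 0 2) (u 2 0) = - turn K (u 2 0) (u 0 2)"
    by (rule turn_sym)+
  define A where "A = (u 0 1 < u 0 2)"
  define B where "B = (u 1 2 < u 1 0)"
  define C where "C = (u 2 0 < u 2 1)"
  define P where "P = (turn K (u 0 1) (u 1 0) > 0)"
  define Q where "Q = (turn K (u 1 2) (u 2 1) > 0)"
  define R where "R = (turn K (u 2 0) (u 0 2) > 0)"
  have less: "u 0 2 < u 0 1 \<longleftrightarrow> \<not> A" "u 1 0 < u 1 2 \<longleftrightarrow> \<not> B" "u 2 1 < u 2 0 \<longleftrightarrow> \<not> C"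
    using ne' by (auto simp: A_def B_def C_def)
  have neg: "turn K (u 0 1) (u 1 0) < 0 \<longleftrightarrow> \<not> P" "turn K (u 1 2) (u 2 1) < 0 \<longleftrightarrow> \<not> Q"
    "turn K (u 2 0) (u 0 2) < 0 \<longleftrightarrow> \<not> R"
    using nz' by (auto simp: P_def Q_def R_def)
  have "((A = B) = P) = ((B = C) = Q)" "((B = C) = Q) = ((C = A) = R)"
    using tri unfolding triangle_def side_def Let_def sg[OF ne'(1)] sg[OF ne'(2)] sg[OF ne'(3)]
      sg[OF nz'(1)] sg[OF nz'(2)] sg[OF nz'(3)] P_def[symmetric] Q_def[symmetric] R_def[symmetric]
    by (cases A; cases B; cases C; cases P; cases Q; cases R; simp del: One_nat_def add: less)+
  moreover have "i = 0 \<and> j = 1 \<and> k = 2 \<or> i = 0 \<and> j = 2 \<and> k = 1 \<or> i = 1 \<and> j = 0 \<and> k = 2 \<or>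
      i = 1 \<and> j = 2 \<and> k = 0 \<or> i = 2 \<and> j = 0 \<and> k = 1 \<or> i = 2 \<and> j = 1 \<and> k = 0"
    using r unfolding roles_cases by simp
  ultimately show ?thesis
    by (elim disjE conjE; simp only: rev less neg neg_0_less_iff_less A_def[symmetric]
        B_def[symmetric] C_def[symmetric] P_def[symmetric] Q_def[symmetric] R_def[symmetric];
        cases A; cases B; cases C; cases R; simp)
qed

definition first_time :: "(nat \<Rightarrow> nat \<Rightarrow> real) \<Rightarrow> nat \<Rightarrow> real" where
  "first_time u i = min (u i ((i + 1) mod 3)) (u i ((i + 2) mod 3))"

definition second_time :: "(nat \<Rightarrow> nat \<Rightarrow> real) \<Rightarrow> nat \<Rightarrow> real" where
  "second_time u i = max (u i ((i + 1) mod 3)) (u i ((i + 2) mod 3))"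

lemma times_roles:
  assumes "roles i j k"
  shows "first_time u i = min (u i j) (u i k)" "second_time u i = max (u i j) (u i k)"
  using assms
  by (auto simp: roles_cases first_time_def second_time_def min.commute max.commute
      simp flip: numeral_2_eq_2)

text \<open>
  The third moves: by the last condition, two of the crossings cannot be classical if the
  remaining one is virtual.
\<close>

locale triangle_move = disc_pair K L D 3 a b for K L D a b +
  fixes u u' :: "nat \<Rightarrow> nat \<Rightarrow> real"
  assumes arcsK: "three_arcs D a b K u" and arcsL: "three_arcs D a b L u'"
    and triK: "triangle K u" and triL: "triangle L u'"
    and flip: "roles i j k \<Longrightarrow> u i j < u i k \<longleftrightarrow> u' i k < u' i j"
    and turn_same: "i < 3 \<Longrightarrow> j < 3 \<Longrightarrow> i \<noteq> j \<Longrightarrow>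
      sgn (turn K (u i j) (u j i)) = sgn (turn L (u' i j) (u' j i))"
    and virt_same: "i < 3 \<Longrightarrow> j < 3 \<Longrightarrow> i \<noteq> j \<Longrightarrow>
      curve K (u i j) \<in> virt K \<longleftrightarrow> curve L (u' i j) \<in> virt L"
    and over_same: "i < 3 \<Longrightarrow> j < 3 \<Longrightarrow> i \<noteq> j \<Longrightarrow> u i j \<in> over K \<longleftrightarrow> u' i j \<in> over L"
    and decorations: "roles i j k \<Longrightarrow> curve K (u i j) \<notin> virt K \<Longrightarrow>
      curve K (u i k) \<in> virt K \<longleftrightarrow> curve K (u j k) \<in> virt K"
begin

lemma in_arc: "i < 3 \<Longrightarrow> j < 3 \<Longrightarrow> i \<noteq> j \<Longrightarrow> u i j \<in> {a i<..<b i}"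
  using arcsK by (simp add: three_arcs_def)

lemma arcs_meet:
  assumes "i < 3" "j < 3" "i \<noteq> j" shows "meets K (u i j) (u j i)"
proof -
  have "curve K (u i j) = curve K (u j i)" using arcsK assms unfolding three_arcs_def by blast
  moreover have "u i j - u j i \<notin> \<int>"
    using strand_unique[of i j "u i j" "u j i"] in_arc[of i j] in_arc[of j i] assms by auto
  ultimately show ?thesis by (simp add: meets_def)
qed

lemma arc_point_unique:
  assumes "i < 3" "j < 3" "i \<noteq> j" "t \<in> {a k<..<b k}" "k < 3" "t - u i j \<in> \<int>"
  shows "k = i \<and> t = u i j"
  using strand_unique[of k i t "u i j"] in_arc[of i j] assms by auto

lemma times_distinct: "roles i j k \<Longrightarrow> u i j \<noteq> u i k"
proof
  assume r: "roles i j k" and eq: "u i j = u i k"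
  note R = rolesD[OF r]
  have "meets K (u i j) (u j i)" "meets K (u i j) (u k i)"
    using arcs_meet[of i j] arcs_meet[of i k] R eq by auto
  then have "u j i - u k i \<in> \<int>" using K.meets_unique by blast
  then show False using arc_point_unique[of k i "u j i" j] in_arc[of j i] R by auto
qed

lemma arcs_meet_iff:
  assumes "i < 3" "j < 3" "i \<noteq> j" "k < 3" "l < 3" "k \<noteq> l"
  shows "meets K (u i j) (u k l) \<longleftrightarrow> k = j \<and> l = i"
proof
  assume "meets K (u i j) (u k l)"
  then have "u j i - u k l \<in> \<int>" using arcs_meet[of i j] assms K.meets_unique by blast
  then have kl: "j = k" "u j i = u k l"
    using arc_point_unique[of k l "u j i" j] in_arc[of j i] assms by auto
  have "l = i"
  proof (rule ccontr)
    assume "l \<noteq> i"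
    then have "roles j i l" using assms kl(1) by (intro rolesI) auto
    from times_distinct[OF this] show False using kl by simp
  qed
  then show "k = j \<and> l = i" using kl by simp
qed (use arcs_meet assms in auto)

lemma arc_times:
  assumes i: "i < 3" and t: "t \<in> K.X" "t \<in> {a i<..<b i}"
  shows "\<exists>j<3. i \<noteq> j \<and> t = u i j"
proof -
  have "t \<in> outer" using in_inner[of i t 0] i t(2) inner_outer by auto
  then have "curve K t \<in> crossings K \<inter> D" using t(1) vimage_outer(1) by (auto simp: crossings_def)
  moreover have "crossings K \<inter> D = {curve K (u i j) | i j. i < 3 \<and> j < 3 \<and> i \<noteq> j}"
    using arcsK by (simp add: three_arcs_def)
  ultimately obtain k l where kl: "curve K t = curve K (u k l)" "k < 3" "l < 3" "k \<noteq> l" by blast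
  have "t - u k l \<in> \<int> \<or> t - u l k \<in> \<int>"
    using K.same_point[OF arcs_meet[OF kl(2-4)] kl(1)] .
  then show ?thesis
    using arc_point_unique[of k l t i] arc_point_unique[of l k t i] kl i t(2) by metis
qed

lemma arc_points:
  assumes "i < 3"
  shows "a i < first_time u i \<and> first_time u i < second_time u i \<and> second_time u i < b i"
    and "K.X \<inter> {a i<..<b i} \<subseteq> {first_time u i, second_time u i}"
proof -
  obtain j k where r: "roles i j k"
    using assms roles_start by blast
  note R = rolesD[OF r]
  show "a i < first_time u i \<and> first_time u i < second_time u i \<and> second_time u i < b i"
    using in_arc[of i j] in_arc[of i k] R times_distinct[OF r]
    by (auto simp: times_roles[OF r] min_def max_def)
  have "t = u i j \<or> t = u i k" if t: "t \<in> K.X \<inter> {a i<..<b i}" for t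
  proof -
    obtain l where "l < 3" "i \<noteq> l" "t = u i l" using arc_times[OF assms, of t] t by auto
    then show ?thesis using roles_member[OF r \<open>l < 3\<close>] by auto
  qed
  then have "K.X \<inter> {a i<..<b i} \<subseteq> {u i j, u i k}" by blast
  then show "K.X \<inter> {a i<..<b i} \<subseteq> {first_time u i, second_time u i}"
    by (simp add: times_roles[OF r] min_def max_def insert_commute)
qed

lemma classical_points: "i < 3 \<Longrightarrow> j < 3 \<Longrightarrow> i \<noteq> j \<Longrightarrow> u i j \<in> K.C \<longleftrightarrow> curve K (u i j) \<notin> virt K"
  using K.classical_meets_iff[OF arcs_meet] .

lemma strands_fit_pairs:
  "strands_fit K 3 (first_time u) (second_time u) G s q h x m y \<longleftrightarrow>
    (\<forall>i<3. m i \<in> carrier G) \<and>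
    (\<forall>i<3. \<forall>j<3. i \<noteq> j \<longrightarrow>
      xing G s q h (kind K (u i j) (u j i)) (kind K (u j i) (u i j)) (turn K (u i j) (u j i) > 0)
        (if u i j = first_time u i then x i else m i) (if u i j = first_time u i then m i else y i)
        (if u j i = first_time u j then x j else m j) (if u j i = first_time u j then m j else y j))"
    (is "?L \<longleftrightarrow> ?R")
proof -
  have set: "{first_time u i, second_time u i} = {u i j, u i k}" if "roles i j k" for i j k
    by (auto simp: times_roles[OF that] min_def max_def)
  have in_set: "u i j \<in> {first_time u i, second_time u i}" if "i < 3" "j < 3" "i \<noteq> j" for i j
    using roles_exist[OF that] set by blast
  have from_set: "\<exists>j<3. i \<noteq> j \<and> t = u i j" if i: "i < 3" and t: "t \<in> {first_time u i, second_time u i}" for i t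
  proof -
    obtain j k where r: "roles i j k"
      using i roles_start by blast
    then show ?thesis using t set[OF r] rolesD[OF r] by auto
  qed
  have "first_time u i \<in> K.X" "second_time u i \<in> K.X" if "i < 3" for i
  proof -
    have "t \<in> K.X" if "t \<in> {first_time u i, second_time u i}" for t
      using from_set[OF \<open>i < 3\<close> that] arcs_meet meets_crossing_time \<open>i < 3\<close> by blast
    then show "first_time u i \<in> K.X" "second_time u i \<in> K.X" by simp_all
  qed
  then have car: "(\<forall>i<3. m i \<in> carrier G \<and> (first_time u i \<notin> K.X \<longrightarrow> m i = x i) \<and>
       (second_time u i \<notin> K.X \<longrightarrow> m i = y i)) \<longleftrightarrow> (\<forall>i<3. m i \<in> carrier G)"
    by blast
  show ?thesis
  proof
    assume ?L
    then show ?R unfolding strands_fit_def car using in_set arcs_meet by metis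
  next
    assume R: ?R
    show ?L
      unfolding strands_fit_def car
    proof (intro conjI allI impI ballI)
      fix i j v w assume ij: "i < 3" "j < 3" and v: "v \<in> {first_time u i, second_time u i}"
        and w: "w \<in> {first_time u j, second_time u j}" and vw: "meets K v w"
      obtain k l where kl: "k < 3" "i \<noteq> k" "v = u i k" "l < 3" "j \<noteq> l" "w = u j l"
        using from_set[OF ij(1) v] from_set[OF ij(2) w] by blast
      then have "j = k" "l = i" using arcs_meet_iff[of i k j l] ij vw by auto
      then have eq: "v = u i j" "w = u j i" "i \<noteq> j" using kl by auto
      show "xing G s q h (kind K v w) (kind K w v) (0 < turn K v w)
           (if v = first_time u i then x i else m i) (if v = first_time u i then m i else y i)
           (if w = first_time u j then x j else m j) (if w = first_time u j then m j else y j)"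
        unfolding eq using R ij eq(3) by blast
    qed (use R in blast)
  qed
qed

definition kinds :: "nat \<Rightarrow> nat \<Rightarrow> crossing_kind \<times> crossing_kind" where
  "kinds i j = (kind K (u i j) (u j i), kind K (u j i) (u i j))"

definition \<sigma> :: "nat \<Rightarrow> nat \<Rightarrow> bool" where
  "\<sigma> i j = (turn K (u i j) (u j i) > 0)"

lemma strands_fit_triple:
  assumes r: "roles i j k" and G: "group G"
  shows "strands_fit K 3 (first_time u) (second_time u) G s q h x m y \<longleftrightarrow>
    (\<forall>i<3. m i \<in> carrier G) \<and>
    group.triple G s q h (kinds i j) (kinds i k) (kinds j k) (\<sigma> i j) (\<sigma> i k) (\<sigma> j k)
      (u i j < u i k) (u j i < u j k) (u k i < u k j) (x i) (x j) (x k) (m i) (m j) (m k) (y i) (y j) (y k)"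
proof -
  note R = rolesD[OF r]
  have r': "roles j k i" "roles k i j" using r by (auto simp: roles_cases)
  have first: "u i j = first_time u i \<longleftrightarrow> u i j < u i k" "u i k = first_time u i \<longleftrightarrow> \<not> u i j < u i k"
    "u j i = first_time u j \<longleftrightarrow> u j i < u j k" "u j k = first_time u j \<longleftrightarrow> \<not> u j i < u j k"
    "u k i = first_time u k \<longleftrightarrow> u k i < u k j" "u k j = first_time u k \<longleftrightarrow> \<not> u k i < u k j"
    using times_distinct[OF r] times_distinct[OF r'(1)] times_distinct[OF r'(2)]
    by (auto simp: times_roles[OF r] times_roles[OF r'(1)] times_roles[OF r'(2)] min_def)
  have m: "meets K (u i j) (u j i)" "meets K (u i k) (u k i)" "meets K (u j k) (u k j)"
    using arcs_meet R by auto
  note rev = xing_reverse[OF K.diagram_axioms m(1)] xing_reverse[OF K.diagram_axioms m(2)]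
    xing_reverse[OF K.diagram_axioms m(3)]
  have neq: "i \<noteq> j" "i \<noteq> k" "j \<noteq> k" "j \<noteq> i" "k \<noteq> i" "k \<noteq> j" using R by auto
  show ?thesis
    unfolding strands_fit_pairs roles_all[OF r] group.triple_def[OF G] kinds_def \<sigma>_def fst_conv snd_conv
    by (simp add: neq first rev conj_ac)
qed

lemma triangle_move_swap: "triangle_move L K D a b u' u"
proof -
  show ?thesis
  proof unfold_locales
    fix i j k
    show "u' i j < u' i k \<longleftrightarrow> u i k < u i j" if "roles i j k"
      using flip[OF rolesD(8)[OF that]] by simp
    show "curve L (u' i k) \<in> virt L \<longleftrightarrow> curve L (u' j k) \<in> virt L"
      if "roles i j k" "curve L (u' i j) \<notin> virt L"
      using decorations[OF that(1)] that(2) virt_same rolesD[OF that(1)] by simp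
  qed (use local_change_swap arcsK arcsL triK triL turn_same virt_same over_same in auto)
qed

lemma classical_same: "i < 3 \<Longrightarrow> j < 3 \<Longrightarrow> i \<noteq> j \<Longrightarrow> u i j \<in> K.C \<longleftrightarrow> u' i j \<in> L.C"
  using classical_points triangle_move.classical_points[OF triangle_move_swap] virt_same by simp

sublocale disc_change K L D 3 a b "first_time u" "second_time u" "first_time u'" "second_time u'"
proof unfold_locales
  fix i :: nat assume i: "i < 3"
  show "a i < first_time u i \<and> first_time u i < second_time u i \<and> second_time u i < b i"
    "K.X \<inter> {a i<..<b i} \<subseteq> {first_time u i, second_time u i}"
    by (rule arc_points[OF i])+
  show "a i < first_time u' i \<and> first_time u' i < second_time u' i \<and> second_time u' i < b i"
    "L.X \<inter> {a i<..<b i} \<subseteq> {first_time u' i, second_time u' i}"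
    by (rule triangle_move.arc_points[OF triangle_move_swap i])+
  obtain j k where r: "roles i j k"
    using i roles_start by blast
  show "((first_time u i \<in> K.C) = (second_time u i \<in> K.C)) =
      ((first_time u' i \<in> L.C) = (second_time u' i \<in> L.C))"
    using classical_same[of i j] classical_same[of i k] rolesD[OF r]
    by (auto simp: times_roles[OF r] min_def max_def)
qed

lemma sigma_same: "i < 3 \<Longrightarrow> j < 3 \<Longrightarrow> i \<noteq> j \<Longrightarrow> triangle_move.\<sigma> L u' i j = \<sigma> i j"
  using turn_same[of i j] unfolding \<sigma>_def triangle_move.\<sigma>_def[OF triangle_move_swap]
  by (metis sgn_greater)

text \<open>
  On each strand the parity function changes between the two crossings iff the first of them is
  classical.  In \<open>L\<close> the order of the crossings is reversed.
\<close>

lemma parity_points: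
  obtains f g where "K.parity_function f" "L.parity_function g"
    "\<And>i j k. roles i j k \<Longrightarrow> f (u i j) = (f (a i) \<noteq> (u i k < u i j \<and> u i k \<in> K.C))"
    "\<And>i j k. roles i j k \<Longrightarrow> g (u' i j) = (f (a i) \<noteq> (u i j < u i k \<and> u i k \<in> K.C))"
proof -
  obtain f g where fg: "K.parity_function f" "L.parity_function g"
    "\<And>i. i < 3 \<Longrightarrow> f (first_time u i) = f (a i)"
    "\<And>i. i < 3 \<Longrightarrow> f (second_time u i) = (f (a i) \<noteq> (first_time u i \<in> K.C))"
    "\<And>i. i < 3 \<Longrightarrow> g (first_time u' i) = f (a i)"
    "\<And>i. i < 3 \<Longrightarrow> g (second_time u' i) = (f (a i) \<noteq> (first_time u' i \<in> L.C))"
    by (rule parity_functions) blast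
  show ?thesis
  proof (rule that[OF fg(1,2)])
    fix i j k assume r: "roles i j k"
    note R = rolesD[OF r]
    show "f (u i j) = (f (a i) \<noteq> (u i k < u i j \<and> u i k \<in> K.C))"
      using fg(3,4)[OF R(1)] unfolding times_roles[OF r]
      by (cases "u i k < u i j") (auto simp: min_def max_def split: if_splits)
    have "u' i k < u' i j \<longleftrightarrow> u i j < u i k" "u' i j \<noteq> u' i k" "u' i k \<in> L.C \<longleftrightarrow> u i k \<in> K.C"
      using flip[OF r] triangle_move.times_distinct[OF triangle_move_swap r] classical_same[of i k] R
      by auto
    then show "g (u' i j) = (f (a i) \<noteq> (u i j < u i k \<and> u i k \<in> K.C))"
      using fg(5,6)[OF R(1)] unfolding times_roles[OF r]
      by (cases "u' i k < u' i j") (auto simp: min_def max_def split: if_splits)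
  qed
qed

text \<open>
  On both strands of a classical crossing, or on neither, a classical passage moves from one side
  of it to the other.  The parity function thus changes at both of its passages or at neither.
\<close>

lemma kinds_same:
  assumes r: "roles i j k" shows "triangle_move.kinds L u' i j = kinds i j"
proof -
  interpret swap: triangle_move L K D a b u' u by (rule triangle_move_swap)
  note R = rolesD[OF r]
  have r': "roles j i k" by (rule R(7))
  obtain f g where f: "K.parity_function f" and g: "L.parity_function g" and
    fv: "\<And>i j k. roles i j k \<Longrightarrow> f (u i j) = (f (a i) \<noteq> (u i k < u i j \<and> u i k \<in> K.C))" and
    gv: "\<And>i j k. roles i j k \<Longrightarrow> g (u' i j) = (f (a i) \<noteq> (u i j < u i k \<and> u i k \<in> K.C))"
    by (rule parity_points) blast
  have C: "u i j \<in> K.C \<longleftrightarrow> u' i j \<in> L.C" "u j i \<in> K.C \<longleftrightarrow> u' j i \<in> L.C"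
    "u j i \<in> K.C \<longleftrightarrow> u i j \<in> K.C"
    using classical_same R K.classical_meets[OF arcs_meet[of i j]] by auto
  have "(f (u i j) = f (u j i)) = (g (u' i j) = g (u' j i))" if "u i j \<in> K.C"
  proof -
    have "u i k \<in> K.C \<longleftrightarrow> u j k \<in> K.C"
      using decorations[OF r] that classical_points R by simp
    then show ?thesis
      using times_distinct[OF r] times_distinct[OF r']
      unfolding fv[OF r] fv[OF r'] gv[OF r] gv[OF r'] by auto
  qed
  then show ?thesis
    unfolding kinds_def swap.kinds_def
    using K.kind_eq[OF f arcs_meet[of i j]] K.kind_eq[OF f arcs_meet[of j i]]
      L.kind_eq[OF g swap.arcs_meet[of i j]] L.kind_eq[OF g swap.arcs_meet[of j i]]
      C over_same R by auto
qed

text \<open>The configurations that occur: the strand \<open>i\<close> crosses the other two at virtual or odd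
  crossings of the same sort, or the strands lie above each other in the order \<open>i, j, k\<close>.\<close>

definition good :: "nat \<Rightarrow> nat \<Rightarrow> nat \<Rightarrow> bool" where
  "good i j k \<longleftrightarrow>
     kinds i j = (Virtual, Virtual) \<and> kinds i k = (Virtual, Virtual) \<or>
     kinds i j = (OddClassical, OddClassical) \<and> kinds i k = (OddClassical, OddClassical) \<or>
     kinds i j = over_under \<and> kinds i k = over_under \<and> kinds j k = over_under"

lemma good_same:
  assumes "roles i j k" shows "triangle_move.good L u' i j k \<longleftrightarrow> good i j k"
proof -
  have r: "roles i k j" "roles j k i" using assms by (auto simp: roles_cases)
  show ?thesis
    unfolding good_def triangle_move.good_def[OF triangle_move_swap]
    using kinds_same[OF assms] kinds_same[OF r(1)] kinds_same[OF r(2)] by simp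
qed

text \<open>
  The relations of the two diagrams are those of a triple with the same kinds and signs and with
  opposite flags.
\<close>

lemma exchange:
  assumes r: "roles i j k" and good: "good i j k" and G: "group G" and com: "commuting G s q h"
    and x: "\<And>i. x i \<in> carrier G" and y: "\<And>i. y i \<in> carrier G"
  shows "strands_fit K 3 (first_time u) (second_time u) G s q h x m y \<Longrightarrow>
      \<exists>m'. strands_fit L 3 (first_time u') (second_time u') G s q h x m' y"
    and "strands_determined K 3 (first_time u) (second_time u) G s q h x y"
proof -
  interpret swap: triangle_move L K D a b u' u by (rule triangle_move_swap)
  interpret group G by fact
  note R = rolesD[OF r]
  have rr: "roles j i k" "roles k i j" "roles j k i" "roles i k j" using r by (auto simp: roles_cases)
  let ?T = "triple s q h (kinds i j) (kinds i k) (kinds j k) (\<sigma> i j) (\<sigma> i k) (\<sigma> j k)"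
  let ?F = "u i j < u i k" and ?G = "u j i < u j k" and ?H = "u k i < u k j"
  note fitK = strands_fit_triple[OF r G, of s q h x _ y]
  have "u' i j < u' i k \<longleftrightarrow> \<not> ?F" "u' j i < u' j k \<longleftrightarrow> \<not> ?G" "u' k i < u' k j \<longleftrightarrow> \<not> ?H"
    using flip[OF rr(4)] flip[OF rr(3)] flip[of k j i] r times_distinct[OF r] times_distinct[OF rr(1)]
      times_distinct[OF rr(2)]
    by (auto simp: roles_cases)
  then have fitL: "strands_fit L 3 (first_time u') (second_time u') G s q h x m y \<longleftrightarrow>
      (\<forall>i<3. m i \<in> carrier G) \<and>
      ?T (\<not> ?F) (\<not> ?G) (\<not> ?H) (x i) (x j) (x k) (m i) (m j) (m k) (y i) (y j) (y k)" for m
    using swap.strands_fit_triple[OF r G, of s q h x m y] R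
    by (simp add: sigma_same kinds_same[OF r] kinds_same[OF rr(4)] kinds_same[OF rr(3)])
  have nz: "turn K (u i j) (u j i) \<noteq> 0" if "roles i j k" for i j k
    using K.turn_nonzero[OF arcs_meet[of i j]] rolesD[OF that] by simp
  have tri: "(u j i < u j k \<longleftrightarrow> turn K (u i j) (u j i) > 0) \<longleftrightarrow>
      (u k i < u k j \<longleftrightarrow> turn K (u i k) (u k i) > 0)" if "roles i j k" for i j k
    by (rule triangle_roles[OF triK that]) (erule times_distinct nz)+
  have T1: "(?G = \<sigma> i j) = (?H = \<sigma> i k)"
    using tri[OF r] by (simp add: \<sigma>_def)
  have T2: "(?F = \<sigma> i j) = (?H = \<sigma> j k)"
    using tri[OF rr(1)] turn_sym[of K "u i j" "u j i"] nz[OF r]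
      times_distinct[OF rr(2)]
    by (auto simp: \<sigma>_def)
  have result: "(\<exists>mi'\<in>carrier G. \<exists>mj'\<in>carrier G. \<exists>mk'\<in>carrier G.
        ?T (\<not> ?F) (\<not> ?G) (\<not> ?H) (x i) (x j) (x k) mi' mj' mk' (y i) (y j) (y k)) \<and>
      (\<forall>m'. (\<forall>i<3. m' i \<in> carrier G) \<longrightarrow>
        ?T ?F ?G ?H (x i) (x j) (x k) (m' i) (m' j) (m' k) (y i) (y j) (y k) \<longrightarrow>
        m i = m' i \<and> m j = m' j \<and> m k = m' k)"
    if m: "\<forall>i<3. m i \<in> carrier G"
      "?T ?F ?G ?H (x i) (x j) (x k) (m i) (m j) (m k) (y i) (y j) (y k)" for m
  proof -
    have conj: ?thesis if g: "g \<in> {q, h}"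
      and cij: "\<And>\<tau> a a' b b'. a \<in> carrier G \<Longrightarrow> b \<in> carrier G \<Longrightarrow>
        xing G s q h (fst (kinds i j)) (snd (kinds i j)) \<tau> a a' b b' \<longleftrightarrow> a' = tw \<tau> g a \<and> b' = tw (\<not> \<tau>) g b"
      and cik: "\<And>\<tau> a a' b b'. a \<in> carrier G \<Longrightarrow> b \<in> carrier G \<Longrightarrow>
        xing G s q h (fst (kinds i k)) (snd (kinds i k)) \<tau> a a' b b' \<longleftrightarrow> a' = tw \<tau> g a \<and> b' = tw (\<not> \<tau>) g b"
      for g
    proof (intro conjI allI impI)
      show "\<exists>mi'\<in>carrier G. \<exists>mj'\<in>carrier G. \<exists>mk'\<in>carrier G.
          ?T (\<not> ?F) (\<not> ?G) (\<not> ?H) (x i) (x j) (x k) mi' mj' mk' (y i) (y j) (y k)"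
        by (rule triple_conj(1)[OF com g cij cik x x x y y y _ _ _ m(2) T1]) (use m(1) R in auto)
      fix m' assume m': "\<forall>i<3. m' i \<in> carrier G"
        "?T ?F ?G ?H (x i) (x j) (x k) (m' i) (m' j) (m' k) (y i) (y j) (y k)"
      note c = triple_conj(2-4)[OF com g cij cik x x x y y y _ _ _ m(2)]
      note c' = triple_conj(2-4)[OF com g cij cik x x x y y y _ _ _ m'(2)]
      show "m i = m' i" "m j = m' j" "m k = m' k"
        using c c' m(1) m'(1) R by simp_all
    qed
    from good consider "kinds i j = (Virtual, Virtual)" "kinds i k = (Virtual, Virtual)"
      | "kinds i j = (OddClassical, OddClassical)" "kinds i k = (OddClassical, OddClassical)"
      | "kinds i j = over_under" "kinds i k = over_under" "kinds j k = over_under"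
      unfolding good_def by blast
    then show ?thesis
    proof cases
      case 1
      show ?thesis by (rule conj[of q]) (simp_all add: 1 xing_virtual[OF com])
    next
      case 2
      show ?thesis by (rule conj[of h]) (simp_all add: 2 xing_odd[OF com])
    next
      case 3
      show ?thesis
      proof (intro conjI allI impI)
        show "\<exists>mi'\<in>carrier G. \<exists>mj'\<in>carrier G. \<exists>mk'\<in>carrier G.
            ?T (\<not> ?F) (\<not> ?G) (\<not> ?H) (x i) (x j) (x k) mi' mj' mk' (y i) (y j) (y k)"
          using m(1) R m(2) unfolding 3 by (intro triple_even[OF com x x x _ _ _ _ T1 T2]) auto
        fix m' assume m': "\<forall>i<3. m' i \<in> carrier G"
          "?T ?F ?G ?H (x i) (x j) (x k) (m' i) (m' j) (m' k) (y i) (y j) (y k)"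
        note c = triple_even_middle[OF com x x x _ _ _ m(2)[unfolded 3]]
        note c' = triple_even_middle[OF com x x x _ _ _ m'(2)[unfolded 3]]
        have mc: "m i \<in> carrier G" "m j \<in> carrier G" "m k \<in> carrier G"
          "m' i \<in> carrier G" "m' j \<in> carrier G" "m' k \<in> carrier G"
          using m(1) m'(1) R by auto
        show 1: "m i = m' i" using c(1)[OF mc(1-3)] c'(1)[OF mc(4-6)] by simp
        show 2: "m j = m' j" using c(2)[OF mc(1-3)] c'(2)[OF mc(4-6)] 1 by simp
        show "m k = m' k" using c(3)[OF mc(1-3)] c'(3)[OF mc(4-6)] 1 2 by simp
      qed
    qed
  qed
  show "\<exists>m'. strands_fit L 3 (first_time u') (second_time u') G s q h x m' y"
    if fit: "strands_fit K 3 (first_time u) (second_time u) G s q h x m y"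
  proof -
    from result[of m] fit[unfolded fitK]
    have "\<exists>mi'\<in>carrier G. \<exists>mj'\<in>carrier G. \<exists>mk'\<in>carrier G.
        ?T (\<not> ?F) (\<not> ?G) (\<not> ?H) (x i) (x j) (x k) mi' mj' mk' (y i) (y j) (y k)"
      by simp
    then obtain mi' mj' mk' where m': "mi' \<in> carrier G" "mj' \<in> carrier G" "mk' \<in> carrier G"
      "?T (\<not> ?F) (\<not> ?G) (\<not> ?H) (x i) (x j) (x k) mi' mj' mk' (y i) (y j) (y k)"
      by (elim bexE) (rule that)
    define m'' where "m'' l = (if l = i then mi' else if l = j then mj' else mk')" for l
    have "m'' i = mi'" "m'' j = mj'" "m'' k = mk'" using R by (auto simp: m''_def)
    then have "strands_fit L 3 (first_time u') (second_time u') G s q h x m'' y"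
      unfolding fitL roles_all[OF r] using m' by simp
    then show ?thesis by blast
  qed
  show "strands_determined K 3 (first_time u) (second_time u) G s q h x y"
    unfolding strands_determined_def
  proof (intro allI impI)
    fix m m' and l :: nat
    assume "strands_fit K 3 (first_time u) (second_time u) G s q h x m y"
      "strands_fit K 3 (first_time u) (second_time u) G s q h x m' y" and l: "l < 3"
    then have "m i = m' i \<and> m j = m' j \<and> m k = m' k" using result[of m] unfolding fitK by simp
    then show "m l = m' l" using roles_member[OF r l] by auto
  qed
qed

theorem triangle_isomorphic:
  assumes r: "roles i j k" and good: "good i j k"
  shows "virtual_parity_group K \<cong> virtual_parity_group L"
proof -
  interpret swap: triangle_move L K D a b u' u by (rule triangle_move_swap)
  have good': "swap.good i j k" using good_same[OF r] good by simp
  show ?thesis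
  proof (rule local_isomorphism)
    fix G :: pg_group and s q h and x y m :: "nat \<Rightarrow> pg_gen gword set"
    assume G: "group G" "commuting G s q h" "\<And>i. x i \<in> carrier G" "\<And>i. y i \<in> carrier G"
    show "\<exists>m'. strands_fit L 3 (first_time u') (second_time u') G s q h x m' y"
      if "strands_fit K 3 (first_time u) (second_time u) G s q h x m y"
      by (rule exchange(1)[OF r good G that])
    show "\<exists>m'. strands_fit K 3 (first_time u) (second_time u) G s q h x m' y"
      if "strands_fit L 3 (first_time u') (second_time u') G s q h x m y"
      by (rule swap.exchange(1)[OF r good' G that])
    show "strands_determined K 3 (first_time u) (second_time u) G s q h x y"
      by (rule exchange(2)[OF r good G])
    show "strands_determined L 3 (first_time u') (second_time u') G s q h x y"
      by (rule swap.exchange(2)[OF r good' G])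
  qed
qed

lemma kinds_virtual:
  "i < 3 \<Longrightarrow> j < 3 \<Longrightarrow> i \<noteq> j \<Longrightarrow> curve K (u i j) \<in> virt K \<Longrightarrow> kinds i j = (Virtual, Virtual)"
  using arcs_meet[of i j] by (simp add: kinds_def kind_def meets_def)

text \<open>
  The number of odd crossings is even, since the parity function changes on each strand.  If
  there are two, the strand that they share takes the role of \<open>i\<close>; if none is, the heights order the
  strands.
\<close>

lemma classical_good:
  assumes classical: "\<And>i j. i < 3 \<Longrightarrow> j < 3 \<Longrightarrow> i \<noteq> j \<Longrightarrow> curve K (u i j) \<notin> virt K"
    and top: "t < 3" "\<And>j. j < 3 \<Longrightarrow> t \<noteq> j \<Longrightarrow> u t j \<in> over K"
  obtains i j k where "roles i j k" "good i j k"
proof -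
  obtain f g where f: "K.parity_function f" and "L.parity_function g" and
    fv: "\<And>i j k. roles i j k \<Longrightarrow> f (u i j) = (f (a i) \<noteq> (u i k < u i j \<and> u i k \<in> K.C))"
    by (rule parity_points) blast
  have C: "u i j \<in> K.C" if "i < 3" "j < 3" "i \<noteq> j" for i j
    using classical_points[OF that] classical[OF that] by simp
  have differ: "f (u i j) \<noteq> f (u i k)" if r: "roles i j k" for i j k
    using fv[OF r] fv[OF rolesD(8)[OF r]] C[of i j] C[of i k] rolesD[OF r] times_distinct[OF r] by auto
  have odd: "kinds i j = (OddClassical, OddClassical)" if "i < 3" "j < 3" "i \<noteq> j" "f (u i j) = f (u j i)" for i j
    using K.kind_eq[OF f arcs_meet[of i j]] K.kind_eq[OF f arcs_meet[of j i]] C[of i j] C[of j i] that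
    by (simp add: kinds_def)
  have even: "kinds i j = over_under" if "i < 3" "j < 3" "i \<noteq> j" "f (u i j) \<noteq> f (u j i)" "u i j \<in> over K" for i j
    using K.kind_eq[OF f arcs_meet[of i j]] K.kind_eq[OF f arcs_meet[of j i]] C[of i j] C[of j i] that
      K.over_under[OF _ arcs_meet[of i j]]
    by (auto simp: kinds_def)
  obtain j k where r: "roles t j k"
    using top(1) roles_start by blast
  note R = rolesD[OF r]
  have rr: "roles j t k" "roles k t j" "roles t k j" using r by (auto simp: roles_cases)
  have d: "f (u t j) \<noteq> f (u t k)" "f (u j t) \<noteq> f (u j k)" "f (u k t) \<noteq> f (u k j)"
    using differ[OF r] differ[OF rr(1)] differ[OF rr(2)] by auto
  consider "f (u t j) = f (u j t)" "f (u t k) = f (u k t)"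
    | "f (u t j) = f (u j t)" "f (u j k) = f (u k j)"
    | "f (u t k) = f (u k t)" "f (u j k) = f (u k j)"
    | "f (u t j) \<noteq> f (u j t)" "f (u t k) \<noteq> f (u k t)" "f (u j k) \<noteq> f (u k j)"
    using d by blast
  then show ?thesis
  proof cases
    case 1
    then have "good t j k" using odd[of t j] odd[of t k] R by (simp add: good_def)
    then show ?thesis using that r by blast
  next
    case 2
    then have "good j t k" using odd[of j t] odd[of j k] R by (simp add: good_def)
    then show ?thesis using that rr by blast
  next
    case 3
    then have "good k t j" using odd[of k t] odd[of k j] R by (simp add: good_def)
    then show ?thesis using that rr by blast
  next
    case 4
    note tk = even[of t j] even[of t k] top(2)[of j] top(2)[of k]
    show ?thesis
    proof (cases "u j k \<in> over K")
      case True
      then have "good t j k" using even[of j k] tk R 4 by (simp add: good_def)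
      then show ?thesis using that r by blast
    next
      case False
      then have "u k j \<in> over K"
        using K.over_under[OF C arcs_meet[of j k]] R by auto
      then have "good t k j" using even[of k j] tk R 4 by (auto simp: good_def)
      then show ?thesis using that rr by blast
    qed
  qed
qed

end

theorem move_III_isomorphic:
  assumes K: "is_virtual_knot_diagram K" and L: "is_virtual_knot_diagram L"
    and move: "reidemeister_III K L \<or> virtual_reidemeister_III K L \<or> virtual_reidemeister_IV K L"
  shows "virtual_parity_group K \<cong> virtual_parity_group L"
proof -
  define classical where "classical u \<longleftrightarrow>
    (\<forall>i<3. \<forall>j<3. i \<noteq> j \<longrightarrow> curve K (u i j) \<notin> virt K) \<and> (\<exists>i<3. \<forall>j<3. i \<noteq> j \<longrightarrow> u i j \<in> over K)"
    for u :: "nat \<Rightarrow> nat \<Rightarrow> real"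
  define virtual where "virtual u \<longleftrightarrow> (\<forall>i<3. \<forall>j<3. i \<noteq> j \<longrightarrow> curve K (u i j) \<in> virt K)"
    for u :: "nat \<Rightarrow> nat \<Rightarrow> real"
  define mixed where "mixed u \<longleftrightarrow>
    (\<exists>i<3. \<forall>j<3. \<forall>k<3. j \<noteq> k \<longrightarrow> (curve K (u j k) \<in> virt K \<longleftrightarrow> j = i \<or> k = i))"
    for u :: "nat \<Rightarrow> nat \<Rightarrow> real"
  have "(\<exists>u. move_III K L u \<and> classical u) \<or> (\<exists>u. move_III K L u \<and> virtual u) \<or>
      (\<exists>u. move_III K L u \<and> mixed u)"
    using move unfolding reidemeister_III_def virtual_reidemeister_III_def
      virtual_reidemeister_IV_def classical_def virtual_def mixed_def .
  then obtain u where m3: "move_III K L u" and "classical u \<or> virtual u \<or> mixed u" by blast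
  note dec = this(2)[unfolded classical_def virtual_def mixed_def]
  obtain D a b u' where change: "local_change D 3 a b K L"
    and arcs: "three_arcs D a b K u" "three_arcs D a b L u'" and tri: "triangle K u" "triangle L u'"
    and flip: "\<forall>i<3. \<forall>j<3. \<forall>k<3. i \<noteq> j \<and> i \<noteq> k \<and> j \<noteq> k \<longrightarrow> (u i j < u i k \<longleftrightarrow> u' i k < u' i j)"
    and same: "\<forall>i<3. \<forall>j<3. i \<noteq> j \<longrightarrow>
           sgn (turn K (u i j) (u j i)) = sgn (turn L (u' i j) (u' j i)) \<and>
           (curve K (u i j) \<in> virt K \<longleftrightarrow> curve L (u' i j) \<in> virt L) \<and>
           (u i j \<in> over K \<longleftrightarrow> u' i j \<in> over L)"
    using m3 unfolding move_III_def by (elim exE conjE) (rule that)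
  interpret triangle_move K L D a b u u'
  proof unfold_locales
    fix i j k
    show "u i j < u i k \<longleftrightarrow> u' i k < u' i j" if "roles i j k"
      using flip rolesD[OF that] by simp
    show "curve K (u i k) \<in> virt K \<longleftrightarrow> curve K (u j k) \<in> virt K"
      if r: "roles i j k" and "curve K (u i j) \<notin> virt K"
      using dec rolesD[OF r] that(2) by (elim disjE conjE exE) auto
  qed (use K L change arcs tri same in auto)
  from dec show ?thesis
  proof (elim disjE conjE exE)
    fix t assume "\<forall>i<3. \<forall>j<3. i \<noteq> j \<longrightarrow> curve K (u i j) \<notin> virt K"
      "t < 3" "\<forall>j<3. t \<noteq> j \<longrightarrow> u t j \<in> over K"
    then obtain i j k where "roles i j k" "good i j k" using classical_good[of t] by blast
    then show ?thesis by (rule triangle_isomorphic)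
  next
    assume v: "\<forall>i<3. \<forall>j<3. i \<noteq> j \<longrightarrow> curve K (u i j) \<in> virt K"
    have r: "roles 0 1 2" by (simp add: roles_cases)
    then have "good 0 1 2" using v kinds_virtual rolesD[OF r] by (simp add: good_def)
    then show ?thesis by (rule triangle_isomorphic[OF r])
  next
    fix i assume i: "i < 3" and v: "\<forall>j<3. \<forall>k<3. j \<noteq> k \<longrightarrow> (curve K (u j k) \<in> virt K \<longleftrightarrow> j = i \<or> k = i)"
    obtain j k where r: "roles i j k"
      using i roles_start by blast
    then have "good i j k" using v kinds_virtual rolesD[OF r] by (simp add: good_def)
    then show ?thesis by (rule triangle_isomorphic[OF r])
  qed
qed

section \<open>Planar isotopy\<close>

lemma zero_less_mult_pos_iff: "0 < c \<Longrightarrow> 0 < c * x \<longleftrightarrow> 0 < (x :: real)"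
  by (auto simp: zero_less_mult_iff)

text \<open>
  The imaginary part of \<open>cnj v * w\<close> is the signed area spanned by \<open>v\<close> and \<open>w\<close>, which a linear map
  multiplies by its determinant.
\<close>

lemma linear_determinant:
  fixes A :: "complex \<Rightarrow> complex"
  assumes "linear A"
  shows "Im (cnj (A v) * A w) = Im (cnj (A 1) * A \<i>) * Im (cnj v * w)"
proof -
  have A: "A z = Re z *\<^sub>R A 1 + Im z *\<^sub>R A \<i>" for z
  proof -
    have "z = Re z *\<^sub>R 1 + Im z *\<^sub>R \<i>" by (simp add: complex_eq_iff)
    then have "A z = A (Re z *\<^sub>R 1 + Im z *\<^sub>R \<i>)" by simp
    then show ?thesis using assms by (simp only: linear_add linear_scale)
  qed
  show ?thesis
    unfolding A[of v] A[of w] by (simp add: algebra_simps)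
qed

lemma circle_diffeoD:
  assumes "circle_diffeo h"
  shows "h (t + of_int k) = h t + of_int k" "strict_mono h" "isCont h t" "surj h"
proof -
  have h1: "h (t + 1) = h t + 1" for t using assms by (simp add: circle_diffeo_def)
  obtain h' where h': "\<And>t. (h has_real_derivative h' t) (at t)" "\<And>t. h' t > 0"
    using assms by (auto simp: circle_diffeo_def)
  have per: "h (t + of_int k) = h t + of_int k" for t k
  proof -
    have "h (t + of_int k) - (t + of_int k) = h t - t"
      by (rule shift_int_eq) (simp add: h1)
    then show ?thesis by simp
  qed
  then show "h (t + of_int k) = h t + of_int k" .
  show "strict_mono h"
  proof (rule strict_monoI)
    fix x y :: real assume "x < y"
    then show "h x < h y"
    proof (rule DERIV_pos_imp_increasing)
      show "\<exists>d. (h has_real_derivative d) (at z) \<and> 0 < d" for z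
        using h'(1)[of z] h'(2)[of z] by (intro exI conjI)
    qed
  qed
  have cont: "isCont h t" for t using h'(1) DERIV_isCont by blast
  then show "isCont h t" .
  show "surj h"
    unfolding surj_def
  proof
    fix y
    define k where "k = \<lfloor>y - h 0\<rfloor>"
    have "h (of_int k) \<le> y" "y \<le> h (of_int (k + 1))"
      using per[of 0 k] per[of 0 "k + 1"] unfolding k_def by simp_all linarith+
    then have "\<exists>x. of_int k \<le> x \<and> x \<le> of_int (k + 1) \<and> h x = y"
      by (intro IVT) (use cont in auto)
    then show "\<exists>x. y = h x" by blast
  qed
qed

lemma eventually_left:
  fixes h :: "real \<Rightarrow> real"
  assumes mono: "strict_mono h" and cont: "isCont h t" and P: "\<forall>\<^sub>F u in at_left (h t). P u"
  shows "\<forall>\<^sub>F u in at_left t. P (h u)"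
proof -
  have "filterlim h (at_left (h t)) (at_left t)"
    unfolding filterlim_at
  proof
    have "h u \<in> {..<h t} \<and> h u \<noteq> h t" if "u \<in> {..<t}" for u
      using strict_monoD[OF mono, of u t] that by simp
    then show "\<forall>\<^sub>F u in at_left t. h u \<in> {..<h t} \<and> h u \<noteq> h t"
      unfolding eventually_at_filter by (intro always_eventually) blast
    show "(h \<longlongrightarrow> h t) (at_left t)"
      using cont by (simp add: isCont_def filterlim_at_split)
  qed
  then show ?thesis using P by (auto simp: filterlim_iff)
qed

lemma eventually_right:
  fixes h :: "real \<Rightarrow> real"
  assumes mono: "strict_mono h" and cont: "isCont h t" and P: "\<forall>\<^sub>F u in at_right (h t). P u"
  shows "\<forall>\<^sub>F u in at_right t. P (h u)"
proof -
  have "filterlim h (at_right (h t)) (at_right t)"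
    unfolding filterlim_at
  proof
    have "h u \<in> {h t<..} \<and> h u \<noteq> h t" if "u \<in> {t<..}" for u
      using strict_monoD[OF mono, of t u] that by simp
    then show "\<forall>\<^sub>F u in at_right t. h u \<in> {h t<..} \<and> h u \<noteq> h t"
      unfolding eventually_at_filter by (intro always_eventually) blast
    show "(h \<longlongrightarrow> h t) (at_right t)"
      using cont by (simp add: isCont_def filterlim_at_split)
  qed
  then show ?thesis using P by (auto simp: filterlim_iff)
qed

lemma step_function_pullback:
  assumes c: "step_function X c" and X: "\<And>t. t \<in> Y \<longleftrightarrow> h t \<in> X"
    and mono: "strict_mono h" and cont: "\<And>t. isCont h t" and shift: "\<And>t. h (t + 1) = h t + 1"
  shows "step_function Y (c \<circ> h)" "after (c \<circ> h) t = after c (h t)"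
proof -
  have R: "\<forall>\<^sub>F u in at_right t. (c \<circ> h) u = after c (h t)" for t
    using eventually_right[OF mono cont step_functionD(4)[OF c]] by simp
  show "step_function Y (c \<circ> h)"
  proof (rule step_functionI)
    show "(c \<circ> h) (t + 1) = (c \<circ> h) t" for t
      using shift step_functionD(1)[OF c] by simp
    show "\<forall>\<^sub>F u in at_left t. (c \<circ> h) u = (c \<circ> h) t" for t
      using eventually_left[OF mono cont step_functionD(3)[OF c]] by simp
    show "\<exists>v. (\<forall>\<^sub>F u in at_right t. (c \<circ> h) u = v) \<and> (t \<notin> Y \<longrightarrow> v = (c \<circ> h) t)" for t
      using R[of t] step_functionD(5)[OF c, of "h t"] X by (intro exI[of _ "after c (h t)"]) simp
  qed
  show "after (c \<circ> h) t = after c (h t)" by (rule after_eqI[OF R])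
qed

locale isotopy = K: diagram K + L: diagram L for K L +
  fixes \<phi> h
  assumes \<phi>: "plane_diffeo \<phi>" and h: "circle_diffeo h"
    and curve_L: "curve L = \<phi> \<circ> curve K \<circ> h" and virt_L: "virt L = \<phi> ` virt K"
    and over_L: "over L = h -` over K"
begin

lemma h_shift: "h (t + of_int k) = h t + of_int k"
  and h_mono: "strict_mono h" and h_cont: "isCont h t" and h_surj: "surj h"
  using circle_diffeoD[OF h] by auto

lemma h_shift1: "h (t + 1) = h t + 1"
  using h_shift[of t 1] by simp

lemma inj_phi: "inj \<phi>"
  using \<phi> by (simp add: plane_diffeo_def bij_is_inj)

lemma h_Ints: "h u - h v \<in> \<int> \<longleftrightarrow> u - v \<in> \<int>"
proof
  assume "u - v \<in> \<int>"
  then obtain k :: int where "u - v = of_int k" by (auto elim: Ints_cases)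
  then have "u = v + of_int k" by simp
  then show "h u - h v \<in> \<int>" using h_shift by simp
next
  assume "h u - h v \<in> \<int>"
  then obtain k :: int where "h u - h v = of_int k" by (auto elim: Ints_cases)
  then have "h u = h (v + of_int k)" using h_shift by simp
  then have "u = v + of_int k" using h_mono strict_mono_eq by blast
  then show "u - v \<in> \<int>" by simp
qed

lemma meets_iff: "meets L u v \<longleftrightarrow> meets K (h u) (h v)"
  using inj_phi by (auto simp: meets_def h_Ints curve_L inj_eq)

lemma crossing_times_iff: "t \<in> L.X \<longleftrightarrow> h t \<in> K.X"
  unfolding crossing_times_def using meets_iff h_surj by (auto simp: surj_def) metis

lemma virt_iff: "curve L t \<in> virt L \<longleftrightarrow> curve K (h t) \<in> virt K"
  using inj_phi by (auto simp: curve_L virt_L inj_image_mem_iff)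

lemma classical_iff: "t \<in> L.C \<longleftrightarrow> h t \<in> K.C"
  using crossing_times_iff virt_iff by (simp add: classical_times_def)

text \<open>
  The velocities are transformed by the derivative of \<open>\<phi>\<close>, whose determinant is positive, and
  scaled by the positive derivative of \<open>h\<close>.
\<close>

lemma turn_sign: "turn L u v > 0 \<longleftrightarrow> turn K (h u) (h v) > 0" if uv: "meets L u v"
proof -
  obtain \<phi>' where \<phi>': "\<And>p. (\<phi> has_derivative \<phi>' p) (at p)" "\<And>p. Im (cnj (\<phi>' p 1) * \<phi>' p \<i>) > 0"
    using \<phi> by (auto simp: plane_diffeo_def)
  obtain h' where h': "\<And>t. (h has_real_derivative h' t) (at t)" "\<And>t. h' t > 0"
    using h by (auto simp: circle_diffeo_def)
  have lin: "linear (\<phi>' p)" for p using \<phi>'(1) has_derivative_linear by blast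
  have vel: "velocity L t = h' t *\<^sub>R \<phi>' (curve K (h t)) (velocity K (h t))" for t
  proof -
    have "(h has_vector_derivative h' t) (at t)"
      using h'(1) by (simp add: has_real_derivative_iff_has_vector_derivative)
    then have "((curve K \<circ> h) has_vector_derivative h' t *\<^sub>R velocity K (h t)) (at t)"
      using K.curve_derivative[of "h t"] by (rule vector_diff_chain_at)
    then have "((curve K \<circ> h) has_derivative (\<lambda>x. x *\<^sub>R (h' t *\<^sub>R velocity K (h t)))) (at t)"
      by (simp add: has_vector_derivative_def)
    then have "((\<phi> \<circ> (curve K \<circ> h)) has_derivative
        (\<phi>' ((curve K \<circ> h) t) \<circ> (\<lambda>x. x *\<^sub>R (h' t *\<^sub>R velocity K (h t))))) (at t)"
      by (rule diff_chain_at) (rule \<phi>'(1))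
    then have "(curve L has_vector_derivative h' t *\<^sub>R \<phi>' (curve K (h t)) (velocity K (h t))) (at t)"
      unfolding has_vector_derivative_def curve_L
      by (simp add: comp_def linear_scale[OF lin])
    then show ?thesis unfolding velocity_def[of L] by (rule vector_derivative_at)
  qed
  have "curve K (h u) = curve K (h v)" using uv meets_iff by (simp add: meets_def)
  then have "turn L u v = Im (cnj (h' u *\<^sub>R \<phi>' (curve K (h u)) (velocity K (h u))) *
      (h' v *\<^sub>R \<phi>' (curve K (h u)) (velocity K (h v))))"
    unfolding turn_def vel by simp
  also have "\<dots> = h' u * h' v * Im (cnj (\<phi>' (curve K (h u)) (velocity K (h u))) *
      \<phi>' (curve K (h u)) (velocity K (h v)))"
    by (simp add: algebra_simps)
  finally have eq: "turn L u v =
      (h' u * h' v * Im (cnj (\<phi>' (curve K (h u)) 1) * \<phi>' (curve K (h u)) \<i>)) * turn K (h u) (h v)"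
    unfolding linear_determinant[OF lin, of _ "velocity K (h u)" "velocity K (h v)"] turn_def by (simp only: mult.assoc)
  have "h' u * h' v * Im (cnj (\<phi>' (curve K (h u)) 1) * \<phi>' (curve K (h u)) \<i>) > 0"
    using h'(2) \<phi>'(2) by (intro mult_pos_pos)
  then show ?thesis unfolding eq by (rule zero_less_mult_pos_iff)
qed

text \<open>
  Composing a parity function of \<open>K\<close> with \<open>h\<close> gives one of \<open>L\<close>.
\<close>

lemma kind_same: "kind L u v = kind K (h u) (h v)" if uv: "meets L u v"
proof -
  obtain f where f: "K.parity_function f" by (rule K.parity_function_exists)
  then have fs: "step_function K.C f" and flip: "\<And>t. t \<in> K.C \<Longrightarrow> after f t = (\<not> f t)"
    by (auto simp: K.parity_function_def)
  have "L.parity_function (f \<circ> h)"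
    using step_function_pullback[OF fs classical_iff h_mono h_cont h_shift1] flip classical_iff
    by (simp add: L.parity_function_def)
  then show ?thesis
    using K.kind_eq[OF f, of "h u" "h v"] L.kind_eq[of "f \<circ> h", OF _ uv] uv
    by (simp add: meets_iff classical_iff over_L)
qed

lemma colouring_pullback:
  assumes "colouring K G s q t c" shows "colouring L G s q t (c \<circ> h)"
proof -
  have step: "step_function K.X c" and rel: "\<And>u v. meets K u v \<Longrightarrow> crossing_ok K G s q t c u v"
    and "commuting G s q t" "range c \<subseteq> carrier G"
    using assms by (auto simp: colouring_def)
  note pb = step_function_pullback[OF step crossing_times_iff h_mono h_cont h_shift1]
  have "crossing_ok L G s q t (c \<circ> h) u v" if uv: "meets L u v" for u v
    using rel[of "h u" "h v"] uv meets_iff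
    by (simp add: crossing_ok_def turn_sign[OF uv] kind_same[OF uv] pb(2))
  then show ?thesis
    using \<open>commuting G s q t\<close> \<open>range c \<subseteq> carrier G\<close> pb(1) by (auto simp: colouring_def)
qed

definition h_inv :: "real \<Rightarrow> real" where
  "h_inv = inv_into UNIV h"

lemma h_h_inv [simp]: "h (h_inv t) = t" "h_inv (h t) = t"
  using h_surj strict_mono_imp_inj_on[OF h_mono] by (simp_all add: h_inv_def surj_f_inv_f)

lemma h_inv: "strict_mono h_inv" "isCont h_inv t" "h_inv (t + 1) = h_inv t + 1"
proof -
  show "strict_mono h_inv"
    by (rule strict_monoI) (metis h_h_inv(1) h_mono strict_mono_less)
  have "isCont h_inv (h (h_inv t))"
    by (rule isCont_inverse_function[where d=1]) (simp_all add: h_cont)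
  then show "isCont h_inv t" by simp
  show "h_inv (t + 1) = h_inv t + 1"
    using h_shift1[of "h_inv t"] h_h_inv by metis
qed

lemma colouring_pushforward:
  assumes "colouring L G s q t c" shows "colouring K G s q t (c \<circ> h_inv)"
proof -
  have step: "step_function L.X c" and rel: "\<And>u v. meets L u v \<Longrightarrow> crossing_ok L G s q t c u v"
    and "commuting G s q t" "range c \<subseteq> carrier G"
    using assms by (auto simp: colouring_def)
  have X: "t \<in> K.X \<longleftrightarrow> h_inv t \<in> L.X" for t using crossing_times_iff by simp
  note pb = step_function_pullback[OF step X h_inv]
  have "crossing_ok K G s q t (c \<circ> h_inv) u v" if uv: "meets K u v" for u v
  proof -
    have m: "meets L (h_inv u) (h_inv v)" using uv by (simp add: meets_iff)
    show ?thesis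
      using rel[OF m] turn_sign[OF m] kind_same[OF m] by (simp add: crossing_ok_def pb(2))
  qed
  then show ?thesis
    using \<open>commuting G s q t\<close> \<open>range c \<subseteq> carrier G\<close> pb(1) by (auto simp: colouring_def)
qed

end

theorem planar_isotopy_isomorphic:
  assumes K: "is_virtual_knot_diagram K" and L: "is_virtual_knot_diagram L"
    and iso: "planar_isotopy K L"
  shows "virtual_parity_group K \<cong> virtual_parity_group L"
proof -
  obtain \<phi> h where ph: "plane_diffeo \<phi>" "circle_diffeo h" "curve L = \<phi> \<circ> curve K \<circ> h"
      "virt L = \<phi> ` virt K" "over L = h -` over K"
    using iso unfolding planar_isotopy_def by blast
  interpret isotopy K L \<phi> h by unfold_locales (use K L ph in auto)
  show ?thesis
  proof (rule virtual_parity_groups_isomorphic[OF K L, where E=UNIV and e=h])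
    fix G :: pg_group and s q t c
    show "\<exists>c'. colouring L G s q t c' \<and> (\<forall>u\<in>UNIV. c' u = c (h u))" if "colouring K G s q t c"
      using colouring_pullback[OF that] by (intro exI[of _ "c \<circ> h"]) simp
    show "\<exists>c'. colouring K G s q t c' \<and> (\<forall>u\<in>UNIV. c u = c' (h u))" if "colouring L G s q t c"
      using colouring_pushforward[OF that] by (intro exI[of _ "c \<circ> h_inv"]) simp
    fix d
    show "c = d" if "\<forall>u\<in>UNIV. c (h u) = d (h u)"
      using that h_h_inv(1) by (metis UNIV_I ext)
    show "c = d" if "\<forall>u\<in>UNIV. c u = d u"
      using that by auto
  qed
qed

section \<open>Invariance\<close>

lemma diagrammatic_move_isomorphic:
  assumes "diagrammatic_move K L"
  shows "virtual_parity_group K \<cong> virtual_parity_group L"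
proof -
  have KL: "is_virtual_knot_diagram K" "is_virtual_knot_diagram L"
    using assms by (auto simp: diagrammatic_move_def)
  consider "planar_isotopy K L" | p where "move_I K L p"
    | s s' t t' where "move_II K L s s' t t'" "curve L s \<in> virt L \<longleftrightarrow> curve L s' \<in> virt L"
        "s \<in> over L \<longleftrightarrow> s' \<in> over L"
    | "reidemeister_III K L \<or> virtual_reidemeister_III K L \<or> virtual_reidemeister_IV K L"
  proof -
    have "s \<notin> over L" if "curve L s \<in> virt L" for s
    proof -
      have "over L \<subseteq> classical_times L"
        using KL(2) unfolding is_virtual_knot_diagram_def by blast
      then show ?thesis using that by (auto simp: classical_times_def)
    qed
    then show ?thesis
      using assms that unfolding diagrammatic_move_def reidemeister_I_def virtual_reidemeister_I_def
        reidemeister_II_def virtual_reidemeister_II_def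
      by auto
  qed
  then show ?thesis
  proof cases
    case 1 then show ?thesis by (rule planar_isotopy_isomorphic[OF KL])
  next
    case 2 then show ?thesis by (rule move_I_isomorphic[OF KL])
  next
    case 3 then show ?thesis by (rule move_II_isomorphic[OF KL])
  next
    case 4 then show ?thesis by (rule move_III_isomorphic[OF KL])
  qed
qed

theorem theorem1:
  fixes K K_hat :: virtual_diagram
  assumes "is_virtual_knot_diagram K" and "is_virtual_knot_diagram K_hat"
    and "related_by_moves K K_hat"
  shows "virtual_parity_group K \<cong> virtual_parity_group K_hat"
proof -
  have "equivclp diagrammatic_move K K_hat"
    using assms(3) by (simp add: related_by_moves_def)
  then show ?thesis
  proof (induction rule: equivclp_induct)
    case base
    show ?case by (rule iso_refl)
  next
    case (step L M)
    have "is_virtual_knot_diagram L" "is_virtual_knot_diagram M"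
      using step.hyps(2) by (auto simp: diagrammatic_move_def)
    then have "group (virtual_parity_group M)"
      by (intro diagram.group_virtual_parity_group diagram.intro)
    then have "virtual_parity_group L \<cong> virtual_parity_group M"
      using step.hyps(2) diagrammatic_move_isomorphic group.iso_sym by blast
    then show ?case using step.IH Group.iso_trans by blast
  qed
qed

end
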